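(* Let $\phi:[0,\infty)\to[0,\infty)$ be a continuous function such that (1) $\phi$ is strictly increasing and $\lim_{t\to\infty}\phi(t)=\infty$; (2) there is a constant $M>0$ with $\phi(s+t)\le M(\phi(s)+\phi(t))$ for all $s,t\in[0,\infty)$. Suppose that $$\int_1^{\infty}\frac{1}{\phi(s)}\,ds=\infty,$$ and suppose that there is a simply connected domain $G\subsetneq\mathbb{C}$ and a point $g_0\in G$ such that $$\int_G\phi\big(h_G(g_0,z)\big)\,dz<\infty.$$ Then there exist a Jordan domain $\Omega\subset\mathbb{C}$ and a point $z_0\in\Omega$ such that $$\int_{\Omega}\phi\big(h_{\Omega}(z_0,z)\big)\,dz<\infty,$$ and at the same time there exists a homeomorphic parametrization $\varphi:\partial\mathbb{D}\to\partial\Omega$ that does not have a homeomorphic $W^{1,1}$-extension.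
   Context: $\mathbb{D}$ is the open unit disk in $\mathbb{C}$. A Jordan domain is the bounded (interior) domain $\Omega$ bounded by a Jordan curve, i.e. by the image of a homeomorphic embedding of $\partial\mathbb{D}$ into $\mathbb{C}$. A homeomorphic parametrization of $\partial\Omega$ is a homeomorphism $\varphi:\partial\mathbb{D}\to\partial\Omega$. A homeomorphic $W^{1,1}$-extension of $\varphi$ is a homeomorphism $\Phi:\overline{\mathbb{D}}\to\overline{\Omega}$ with $\Phi|_{\partial\mathbb{D}}=\varphi$ and $\Phi|_{\mathbb{D}}\in W^{1,1}(\mathbb{D},\mathbb{C})$. The hyperbolic metric of a simply connected domain $\Omega\subsetneq\mathbb{C}$ is $h_\Omega(z_1,z_2)=\inf_{\gamma}\int_\gamma \frac{2|g'(z)|\,|dz|}{1-|g(z)|^2}$, the infimum being over rectifiable curves $\gamma$ in $\Omega$ joining $z_1$ and $z_2$, where $g=f^{-1}$ for a conformal homeomorphism $f:\mathbb{D}\to\Omega$. The notation $dz$ in integrals over domains denotes two-dimensional Lebesgue measure. *)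

theory Defs
  imports "HOL-Analysis.Analysis"
begin

definition inscribed_lengths :: "(real \<Rightarrow> 'a::metric_space) \<Rightarrow> real \<Rightarrow> real set" where
  "inscribed_lengths \<gamma> t =
     {\<Sum>i<n. dist (\<gamma> (\<tau> i)) (\<gamma> (\<tau> (Suc i))) | n \<tau>.
        mono_on {..n} \<tau> \<and> \<tau> ` {..n} \<subseteq> {0..t}}"

definition rectifiable_path :: "(real \<Rightarrow> 'a::metric_space) \<Rightarrow> bool" where
  "rectifiable_path \<gamma> \<longleftrightarrow> path \<gamma> \<and> bdd_above (inscribed_lengths \<gamma> 1)"

definition arc_length_fun :: "(real \<Rightarrow> 'a::metric_space) \<Rightarrow> real \<Rightarrow> real" where
  "arc_length_fun \<gamma> t = Sup (inscribed_lengths \<gamma> t)"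

text \<open>The integral of \<open>\<rho> |dz|\<close> along \<open>\<gamma>\<close>, as the Lebesgue--Stieltjes integral of \<open>\<rho> \<circ> \<gamma>\<close>
  against the arc length function.  The latter is continuous and nondecreasing when \<open>\<gamma>\<close> is
  rectifiable; it is extended by constants outside \<open>{0..1}\<close>.  For other \<open>\<gamma>\<close> the
  value is meaningless.\<close>

definition arc_length_integral :: "('a::metric_space \<Rightarrow> real) \<Rightarrow> (real \<Rightarrow> 'a) \<Rightarrow> ennreal" where
  "arc_length_integral \<rho> \<gamma> =
     (\<integral>\<^sup>+t\<in>{0..1}. ennreal (\<rho> (\<gamma> t))
        \<partial>interval_measure (\<lambda>t. arc_length_fun \<gamma> (max 0 (min 1 t))))"

definition conformal_homeomorphism ::
    "complex set \<Rightarrow> complex set \<Rightarrow> (complex \<Rightarrow> complex) \<Rightarrow> (complex \<Rightarrow> complex) \<Rightarrow> bool" where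
  "conformal_homeomorphism S T f g \<longleftrightarrow>
     homeomorphism S T f g \<and> f holomorphic_on S \<and> g holomorphic_on T"

text \<open>The density does not depend on the chosen \<open>g\<close>: two choices differ by
  post-composition with an automorphism of the disk.\<close>

definition hyperbolic_density :: "complex set \<Rightarrow> complex \<Rightarrow> real" where
  "hyperbolic_density \<Omega> z =
     (let g = (SOME g. \<exists>f. conformal_homeomorphism (ball 0 1) \<Omega> f g)
      in 2 * cmod (deriv g z) / (1 - (cmod (g z))\<^sup>2))"

text \<open>For \<open>z1, z2\<close> in a simply connected domain other than the whole plane the infimum is
  finite, so the conversion to \<open>real\<close> loses nothing.\<close>

definition hyperbolic_metric :: "complex set \<Rightarrow> complex \<Rightarrow> complex \<Rightarrow> real" where
  "hyperbolic_metric \<Omega> z1 z2 =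
     enn2real (INF \<gamma> \<in> {\<gamma>. rectifiable_path \<gamma> \<and> path_image \<gamma> \<subseteq> \<Omega> \<and>
                           pathstart \<gamma> = z1 \<and> pathfinish \<gamma> = z2}.
                 arc_length_integral (hyperbolic_density \<Omega>) \<gamma>)"

primrec Ck_function :: "nat \<Rightarrow> ('a::euclidean_space \<Rightarrow> real) \<Rightarrow> bool" where
  "Ck_function 0 f \<longleftrightarrow> continuous_on UNIV f"
| "Ck_function (Suc k) f \<longleftrightarrow>
     (\<forall>x. f differentiable (at x)) \<and>
     (\<forall>b\<in>Basis. Ck_function k (\<lambda>x. frechet_derivative f (at x) b))"

definition test_function :: "'a::euclidean_space set \<Rightarrow> ('a \<Rightarrow> real) \<Rightarrow> bool" where
  "test_function U \<psi> \<longleftrightarrow>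
     (\<forall>k. Ck_function k \<psi>) \<and>
     compact (closure {x. \<psi> x \<noteq> 0}) \<and> closure {x. \<psi> x \<noteq> 0} \<subseteq> U"

text \<open>Weak partial derivative in the coordinate direction \<open>b\<close>; meant for \<open>u\<close> and \<open>w\<close> locally
  integrable on the open set \<open>U\<close>.\<close>

definition weak_partial_derivative ::
    "'a::euclidean_space set \<Rightarrow> 'a \<Rightarrow> ('a \<Rightarrow> 'b::euclidean_space) \<Rightarrow> ('a \<Rightarrow> 'b) \<Rightarrow> bool" where
  "weak_partial_derivative U b u w \<longleftrightarrow>
     (\<forall>\<psi>. test_function U \<psi> \<longrightarrow>
        (LINT x:U|lebesgue. frechet_derivative \<psi> (at x) b *\<^sub>R u x) =
        - (LINT x:U|lebesgue. \<psi> x *\<^sub>R w x))"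

definition sobolev_W11 :: "'a::euclidean_space set \<Rightarrow> ('a \<Rightarrow> 'b::euclidean_space) \<Rightarrow> bool" where
  "sobolev_W11 U u \<longleftrightarrow>
     set_integrable lebesgue U u \<and>
     (\<forall>b\<in>Basis. \<exists>w. set_integrable lebesgue U w \<and> weak_partial_derivative U b u w)"

definition Jordan_domain :: "complex set \<Rightarrow> bool" where
  "Jordan_domain \<Omega> \<longleftrightarrow> (\<exists>J. sphere (0::complex) 1 homeomorphic J \<and> \<Omega> = inside J)"

definition homeomorphic_parametrization :: "complex set \<Rightarrow> (complex \<Rightarrow> complex) \<Rightarrow> bool" where
  "homeomorphic_parametrization \<Omega> \<phi> \<longleftrightarrow>
     (\<exists>\<phi>'. homeomorphism (sphere 0 1) (frontier \<Omega>) \<phi> \<phi>')"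

definition homeomorphic_W11_extension ::
    "complex set \<Rightarrow> (complex \<Rightarrow> complex) \<Rightarrow> (complex \<Rightarrow> complex) \<Rightarrow> bool" where
  "homeomorphic_W11_extension \<Omega> \<phi> \<Phi> \<longleftrightarrow>
     (\<exists>\<Phi>'. homeomorphism (cball 0 1) (closure \<Omega>) \<Phi> \<Phi>') \<and>
     (\<forall>z\<in>sphere 0 1. \<Phi> z = \<phi> z) \<and>
     sobolev_W11 (ball 0 1) \<Phi>"

end

theory Submission
  imports Defs "HOL-Complex_Analysis.Complex_Analysis"
begin

text \<open>
  The domain is a corridor \<open>\<bar>y - f(s)\<bar> < v(s)\<close> over \<open>\<bar>x\<bar> < 1\<close>, where \<open>s = 1 - \<bar>x\<bar>\<close> and \<open>f(s) = s sin(1/s)\<close>: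
  its centre line has infinite length near \<open>x = \<plusminus>1\<close>, but the corridor shrinks to a point there, so that
  the boundary is a Jordan curve.  Let \<open>\<Phi>\<close> be a regularization of \<open>\<phi>(t) + 1 + t\<close> and
  \<open>L(t) = 1 + \<integral>\<^sub>0\<^sup>t 1/\<Phi>\<close>, which is unbounded because \<open>\<integral>1/\<phi>\<close> diverges, and choose the width by
  \<open>v(1/L(t)) = 1/\<Phi>(t)\<close>.  By the Schwarz--Pick lemma the hyperbolic distance from the centre to the level
  \<open>s = 1/L(t)\<close> is \<open>O(1 + t)\<close>, up to a small negative power of the relative distance to the boundary.
  Hence \<open>\<phi>(h)\<close> is at most a constant times \<open>1/v\<close> times the power \<open>-1/2\<close> of that relative distance,
  and its integral over each vertical section is bounded.

  A curve in the closed corridor between the levels \<open>s > s'\<close> has length at least a constant times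
  \<open>ln(s/s')\<close>, up to an additive constant.  Parametrizing the lower boundary arc by \<open>x\<close> and rushing along
  the upper one, every homeomorphic extension maps the vertical chord over \<open>a\<close> to a curve of length at
  least \<open>1/(1 - a)\<close>.  This is not integrable in \<open>a\<close>, so no extension has an integrable weak derivative.
\<close>


section \<open>Upper bounds for the hyperbolic metric\<close>

text \<open>The shape of the corridor comes from a balance. Near the level \<open>s\<close> the
  centre line has slope of order \<open>1 / s\<close>, so a step \<open>ds\<close> costs length
  about \<open>ds / s\<close>, while inscribed discs have radius about \<open>s * v\<close>.
  Hyperbolic distance thus grows like \<open>ds / (s^2 * v)\<close>, that is, like
  \<open>dL / v\<close> with \<open>L = 1 / s\<close>. A vertical section contributes about
  \<open>v * \<phi>(h)\<close> to the area integral, which suggests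
  \<open>v = 1 / \<phi>(h)\<close>. With \<open>h\<close> as parameter \<open>t\<close> this reads
  \<open>dL = dt / \<phi>(t)\<close>, and the corridor reaches \<open>s = 0\<close> only if this
  \<open>L\<close> is unbounded; here the divergence enters. Regularizing is needed because the
  estimates differentiate the width.

  The obstacle to a lower bound is that of an extension only the boundary values and the range are
  known. The intermediate value theorem for the real part along a chord is all that is available,
  and it gives nothing if both ends of the chord lie at the same level; hence the different speeds
  on the two arcs.\<close>

lemma Schwarz_Pick_deriv_0:
  assumes holf: "f holomorphic_on ball 0 1" and no: "\<And>z. cmod z < 1 \<Longrightarrow> cmod (f z) < 1"
  shows "cmod (deriv f 0) \<le> 1 - (cmod (f 0))\<^sup>2"
proof -
  define w where "w = f 0"
  have w: "cmod w < 1" using no[of 0] by (simp add: w_def)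
  \<comment> \<open>Post-composing with the disc automorphism that sends \<open>w = f 0\<close> to 0
    reduces the claim to the Schwarz lemma; the factor \<open>1 - (cmod w)\<^sup>2\<close> is the
    reciprocal of the derivative of \<open>m\<close> at \<open>w\<close>.\<close>
  define m where "m = Moebius_function 0 w"
  have holm: "m holomorphic_on ball 0 1"
    unfolding m_def using w by (intro Moebius_function_holomorphic)
  have holk: "(m \<circ> f) holomorphic_on ball 0 1"
    using no by (intro holomorphic_on_compose_gen[OF holf holm]) auto
  have "cmod (deriv (m \<circ> f) 0) \<le> 1"
  proof (rule Schwarz_Lemma(2)[OF holk, of 0])
    show "(m \<circ> f) 0 = 0" by (simp add: m_def w_def Moebius_function_eq_zero)
    show "cmod ((m \<circ> f) z) < 1" if "cmod z < 1" for z
      using Moebius_function_norm_lt_1 w no[OF that] by (simp add: m_def)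
  qed auto
  moreover have "deriv (m \<circ> f) 0 = deriv m w * deriv f 0"
    unfolding w_def
  proof (rule deriv_chain)
    show "f field_differentiable at 0"
      using holomorphic_on_imp_differentiable_at[OF holf] by auto
    show "m field_differentiable at (f 0)"
      using holm no[of 0] holomorphic_on_imp_differentiable_at[OF holm, of "f 0"] by auto
  qed
  moreover have "deriv m w = 1 / (1 - (cmod w)\<^sup>2)"
  proof (rule DERIV_imp_deriv)
    have nz: "1 - cnj w * w \<noteq> 0"
    proof -
      have "cnj w * w = of_real ((cmod w)\<^sup>2)"
        by (simp only: mult.commute[of "cnj w"] complex_mult_cnj cmod_power2)
      moreover have "(cmod w)\<^sup>2 < 1" using w by (simp add: power_less_one_iff abs_square_less_1)
      ultimately show ?thesis by (metis eq_iff_diff_eq_0 less_irrefl of_real_1 of_real_eq_iff)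
    qed
    have eq: "cnj w * w = of_real ((cmod w)\<^sup>2)"
        by (simp only: mult.commute[of "cnj w"] complex_mult_cnj cmod_power2)
    have "((\<lambda>z. (z - w) / (1 - cnj w * z)) has_field_derivative
        ((1 - cnj w * w) - (w - w) * (- cnj w)) / (1 - cnj w * w)\<^sup>2) (at w)"
      using nz by (auto intro!: derivative_eq_intros simp: power2_eq_square)
    moreover have "((1 - cnj w * w) - (w - w) * (- cnj w)) / (1 - cnj w * w)\<^sup>2 = 1 / (1 - (cmod w)\<^sup>2)"
      using nz by (simp add: power2_eq_square eq)
    ultimately show "(m has_field_derivative 1 / (1 - (cmod w)\<^sup>2)) (at w)"
      unfolding m_def Moebius_function_simple[abs_def] by (simp only:)
  qed
  moreover have "(cmod w)\<^sup>2 < 1" using w by (simp add: power_less_one_iff abs_square_less_1)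
  moreover have "cmod (1 / (1 - (cmod w)\<^sup>2)) = 1 / (1 - (cmod w)\<^sup>2)"
  proof -
    have "1 / (1 - complex_of_real ((cmod w)\<^sup>2)) = complex_of_real (1 / (1 - (cmod w)\<^sup>2))" by simp
    then show ?thesis using \<open>(cmod w)\<^sup>2 < 1\<close> by (simp only: norm_of_real of_real_power) simp
  qed
  ultimately show ?thesis
    by (simp only: norm_mult w_def[symmetric]) (simp add: field_simps)
qed

text \<open>Domain monotonicity: \<open>2 / r\<close> is the density of the disc
  \<open>ball z r\<close> at its centre. It follows from Schwarz-Pick for the map
  \<open>\<zeta> \<mapsto> g (z + r * \<zeta>)\<close>. The argument works for whichever
  \<open>g\<close> the choice operator returns; the Riemann mapping theorem guarantees that there is
  one.\<close>

lemma hyperbolic_density_le: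
  assumes "open \<Omega>" "simply_connected \<Omega>" "\<Omega> \<noteq> UNIV" and r: "0 < r" and sub: "ball z r \<subseteq> \<Omega>"
  shows "hyperbolic_density \<Omega> z \<le> 2 / r"
proof -
  have "z \<in> \<Omega>" using sub r by auto
  have "\<exists>f g. conformal_homeomorphism (ball 0 1) \<Omega> f g"
  proof -
    obtain g f where gf: "g holomorphic_on \<Omega>" "f holomorphic_on ball 0 1"
       "\<forall>z \<in> \<Omega>. g z \<in> ball 0 1 \<and> f (g z) = z" "\<forall>z \<in> ball 0 1. f z \<in> \<Omega> \<and> g (f z) = z"
      using Riemann_mapping_theorem[of \<Omega>] assms \<open>z \<in> \<Omega>\<close> by auto
    have "homeomorphism (ball 0 1) \<Omega> f g"
      unfolding homeomorphism_def
    proof (intro conjI ballI)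
      show "f ` ball 0 1 = \<Omega>" "g ` \<Omega> = ball 0 1" using gf(3,4) by force+
    qed (use gf holomorphic_on_imp_continuous_on in auto)
    then show ?thesis using gf by (auto simp: conformal_homeomorphism_def)
  qed
  then have ex: "\<exists>g f. conformal_homeomorphism (ball 0 1) \<Omega> f g" by blast
  define g where "g = (SOME g. \<exists>f. conformal_homeomorphism (ball 0 1) \<Omega> f g)"
  obtain f where "conformal_homeomorphism (ball 0 1) \<Omega> f g"
    using someI_ex[OF ex] unfolding g_def by blast
  then have holg: "g holomorphic_on \<Omega>" and g1: "\<And>z. z \<in> \<Omega> \<Longrightarrow> cmod (g z) < 1"
    by (auto simp: conformal_homeomorphism_def homeomorphism_def)
  have d: "hyperbolic_density \<Omega> z = 2 * cmod (deriv g z) / (1 - (cmod (g z))\<^sup>2)"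
    by (simp add: hyperbolic_density_def Let_def g_def)
  define h where "h = (\<lambda>\<zeta>. g (z + of_real r * \<zeta>))"
  have inO: "z + of_real r * \<zeta> \<in> \<Omega>" if "cmod \<zeta> < 1" for \<zeta>
    using that r by (intro subsetD[OF sub]) (auto simp: dist_norm norm_mult)
  have "cmod (deriv h 0) \<le> 1 - (cmod (h 0))\<^sup>2"
  proof (rule Schwarz_Pick_deriv_0)
    show "h holomorphic_on ball 0 1"
      unfolding h_def
      by (rule holomorphic_on_compose_gen[OF _ holg, unfolded o_def])
         (use inO in \<open>auto intro!: holomorphic_intros\<close>)
    show "cmod (h \<zeta>) < 1" if "cmod \<zeta> < 1" for \<zeta>
      unfolding h_def using inO[OF that] g1 by auto
  qed
  moreover have "deriv h 0 = of_real r * deriv g z"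
  proof (rule DERIV_imp_deriv)
    have "(g has_field_derivative deriv g z) (at (z + of_real r * 0))"
      using holg \<open>z \<in> \<Omega>\<close> assms(1) by (simp add: holomorphic_derivI)
    moreover have "((\<lambda>\<zeta>. z + of_real r * \<zeta>) has_field_derivative of_real r) (at 0)"
      by (auto intro!: derivative_eq_intros)
    ultimately have "(h has_field_derivative deriv g z * of_real r) (at 0)"
      unfolding h_def by (rule DERIV_chain2)
    then show "(h has_field_derivative of_real r * deriv g z) (at 0)"
      by (simp only: mult.commute)
  qed
  moreover have "h 0 = g z" by (simp add: h_def)
  ultimately have "r * cmod (deriv g z) \<le> 1 - (cmod (g z))\<^sup>2"
    using r by (simp add: norm_mult)
  moreover have "(cmod (g z))\<^sup>2 < 1" using g1[OF \<open>z \<in> \<Omega>\<close>] by (simp add: power_less_one_iff abs_square_less_1)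
  ultimately show ?thesis
    unfolding d using r by (simp add: field_simps)
qed

section \<open>Arc length of Lipschitz curves and integrals against it\<close>

lemma inscribed_lengths_zero: "0 \<le> t \<Longrightarrow> 0 \<in> inscribed_lengths \<gamma> t"
  unfolding inscribed_lengths_def
  by (rule CollectI, rule exI[of _ 0], rule exI[of _ "\<lambda>_. t"]) (auto simp: mono_on_def)

lemma inscribed_lengths_mono: "s \<le> t \<Longrightarrow> inscribed_lengths \<gamma> s \<subseteq> inscribed_lengths \<gamma> t"
  unfolding inscribed_lengths_def by (intro Collect_mono ex_mono) auto

text \<open>Clipping the partition at \<open>a\<close> (\<open>lo\<close>) gives a chain in
  \<open>{0..a}\<close>. Each chord loses at most \<open>M\<close> times the increment of
  \<open>hi\<close>, and these increments telescope. This yields the increment bound for arc length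
  without proving its additivity.\<close>

lemma inscribed_lengths_split:
  assumes "0 \<le> a" "a \<le> b" and x: "x \<in> inscribed_lengths \<gamma> b"
    and lip: "\<And>s t. a \<le> s \<Longrightarrow> s \<le> t \<Longrightarrow> t \<le> b \<Longrightarrow> dist (\<gamma> s) (\<gamma> t) \<le> M * (t - s)"
  shows "\<exists>y \<in> inscribed_lengths \<gamma> a. x \<le> y + M * (b - a)"
proof -
  obtain n \<tau> where x: "x = (\<Sum>i<n. dist (\<gamma> (\<tau> i)) (\<gamma> (\<tau> (Suc i))))"
    and mono: "mono_on {..n} \<tau>" and im: "\<tau> ` {..n} \<subseteq> {0..b}"
    using x unfolding inscribed_lengths_def by blast
  have le: "\<tau> i \<le> \<tau> (Suc i)" if "i < n" for i
    using mono that by (auto simp: mono_on_def)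
  have rng: "0 \<le> \<tau> i" "\<tau> i \<le> b" if "i \<le> n" for i using im that by auto
  define lo hi where "lo i = min (\<tau> i) a" and "hi i = max (\<tau> i) a" for i
  define y where "y = (\<Sum>i<n. dist (\<gamma> (lo i)) (\<gamma> (lo (Suc i))))"
  have M: "0 \<le> M * (b - a)" using lip[of a b] assms zero_le_dist order_trans by blast
  have "y \<in> inscribed_lengths \<gamma> a"
    unfolding inscribed_lengths_def y_def
  proof (intro CollectI exI conjI)
    show "mono_on {..n} lo" using mono by (fastforce simp: mono_on_def lo_def)
    show "lo ` {..n} \<subseteq> {0..a}" using rng assms by (auto simp: lo_def)
  qed rule
  moreover have "x \<le> y + M * (b - a)"
  proof -
    have "dist (\<gamma> (\<tau> i)) (\<gamma> (\<tau> (Suc i))) \<le> dist (\<gamma> (lo i)) (\<gamma> (lo (Suc i))) + M * (hi (Suc i) - hi i)"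
      if "i < n" for i
    proof -
      consider "\<tau> (Suc i) \<le> a" | "a \<le> \<tau> i" | "\<tau> i \<le> a" "a \<le> \<tau> (Suc i)" by linarith
      then show ?thesis
      proof cases
        case 1 then show ?thesis using le[OF that] by (simp add: lo_def hi_def)
      next
        case 2 then show ?thesis using le[OF that] lip[of "\<tau> i" "\<tau> (Suc i)"] rng that by (simp add: lo_def hi_def)
      next
        case 3
        have "dist (\<gamma> (\<tau> i)) (\<gamma> (\<tau> (Suc i))) \<le> dist (\<gamma> (\<tau> i)) (\<gamma> a) + dist (\<gamma> a) (\<gamma> (\<tau> (Suc i)))"
          by (rule dist_triangle)
        with 3 show ?thesis using lip[of a "\<tau> (Suc i)"] rng that by (simp add: lo_def hi_def)
      qed
    qed
    then have "x \<le> y + M * (\<Sum>i<n. hi (Suc i) - hi i)"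
      unfolding x y_def sum_distrib_left sum.distrib[symmetric] by (intro sum_mono) auto
    also have "(\<Sum>i<n. hi (Suc i) - hi i) = hi n - hi 0" by (rule sum_lessThan_telescope)
    also have "M * (hi n - hi 0) \<le> M * (b - a)"
    \<comment> \<open>The hypothesis reveals the sign of \<open>M\<close> only when
      \<open>a < b\<close>.\<close>
    proof (cases "a = b")
      case True then show ?thesis using rng[of n] rng[of 0] by (simp add: hi_def)
    next
      case False
      then have "0 \<le> M" using M assms by (simp add: zero_le_mult_iff)
      then show ?thesis using rng[of n] rng[of 0] assms by (intro mult_left_mono) (auto simp: hi_def)
    qed
    finally show ?thesis by simp
  qed
  ultimately show ?thesis by blast
qed

lemma bdd_above_inscribed_lengths:
  assumes lip: "\<And>s t. 0 \<le> s \<Longrightarrow> s \<le> t \<Longrightarrow> t \<le> 1 \<Longrightarrow> dist (\<gamma> s) (\<gamma> t) \<le> M * (t - s)" and "t \<le> 1"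
  shows "bdd_above (inscribed_lengths \<gamma> t)"
proof -
  have "bdd_above (inscribed_lengths \<gamma> 1)"
  proof (rule bdd_aboveI)
    fix x assume "x \<in> inscribed_lengths \<gamma> 1"
    then obtain y where y: "y \<in> inscribed_lengths \<gamma> 0" "x \<le> y + M * (1 - 0)"
      using inscribed_lengths_split[of 0 1 x \<gamma> M] lip by auto
    then obtain n \<tau> where "y = (\<Sum>i<n. dist (\<gamma> (\<tau> i)) (\<gamma> (\<tau> (Suc i))))" "\<tau> ` {..n} \<subseteq> {0..0::real}"
      unfolding inscribed_lengths_def by blast
    then have "y = 0" by (auto intro!: sum.neutral simp: image_subset_iff)
    then show "x \<le> M" using y by simp
  qed
  then show ?thesis using inscribed_lengths_mono[OF \<open>t \<le> 1\<close>] by (rule bdd_above_mono)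
qed

text \<open>The two Lipschitz constants have different tasks: the global \<open>M\<close> makes the
  set of inscribed lengths bounded, so that its \<open>Sup\<close> is meaningful, and the local
  \<open>N\<close> controls the increment on \<open>{a..b}\<close>.\<close>

lemma arc_length_fun_diff:
  assumes lip: "\<And>s t. 0 \<le> s \<Longrightarrow> s \<le> t \<Longrightarrow> t \<le> 1 \<Longrightarrow> dist (\<gamma> s) (\<gamma> t) \<le> M * (t - s)"
    and lip': "\<And>s t. a \<le> s \<Longrightarrow> s \<le> t \<Longrightarrow> t \<le> b \<Longrightarrow> dist (\<gamma> s) (\<gamma> t) \<le> N * (t - s)"
    and "0 \<le> a" "a \<le> b" "b \<le> 1"
  shows "arc_length_fun \<gamma> a \<le> arc_length_fun \<gamma> b" "arc_length_fun \<gamma> b - arc_length_fun \<gamma> a \<le> N * (b - a)"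
proof -
  have bdd: "bdd_above (inscribed_lengths \<gamma> t)" if "t \<le> 1" for t
    using bdd_above_inscribed_lengths[OF lip that] .
  show "arc_length_fun \<gamma> a \<le> arc_length_fun \<gamma> b" unfolding arc_length_fun_def
    using bdd[OF \<open>b \<le> 1\<close>] inscribed_lengths_zero[OF \<open>0 \<le> a\<close>, of \<gamma>] inscribed_lengths_mono[OF \<open>a \<le> b\<close>]
    by (intro cSup_subset_mono) auto
  have "arc_length_fun \<gamma> b \<le> arc_length_fun \<gamma> a + N * (b - a)"
    unfolding arc_length_fun_def[of \<gamma> b]
  proof (rule cSup_least)
    show "inscribed_lengths \<gamma> b \<noteq> {}" using inscribed_lengths_zero[of b \<gamma>] assms by auto
    fix x assume "x \<in> inscribed_lengths \<gamma> b"
    then obtain y where y: "y \<in> inscribed_lengths \<gamma> a" "x \<le> y + N * (b - a)"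
      using inscribed_lengths_split[OF \<open>0 \<le> a\<close> \<open>a \<le> b\<close> _ lip'] by blast
    moreover have "y \<le> arc_length_fun \<gamma> a"
      unfolding arc_length_fun_def using y bdd[of a] assms by (intro cSup_upper) auto
    ultimately show "x \<le> arc_length_fun \<gamma> a + N * (b - a)" by linarith
  qed
  then show "arc_length_fun \<gamma> b - arc_length_fun \<gamma> a \<le> N * (b - a)" by linarith
qed

text \<open>On a short parameter interval the arc length grows at most by the local bound
  \<open>k\<close> on the speed times the length of the interval. The Stieltjes integral is
  therefore dominated by a Riemann sum of \<open>P * k\<close> over equal cells, with an error
  controlled by uniform continuity.\<close>

lemma
  fixes \<gamma> :: "real \<Rightarrow> 'a::real_normed_vector"
  assumes deriv: "\<And>t. t \<in> {0..1} \<Longrightarrow> (\<gamma> has_vector_derivative \<gamma>' t) (at t within {0..1})"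
    and speed: "\<And>t. t \<in> {0..1} \<Longrightarrow> norm (\<gamma>' t) \<le> k t"
    and dens: "\<And>t. t \<in> {0..1} \<Longrightarrow> \<rho> (\<gamma> t) \<le> P t" "\<And>t. t \<in> {0..1} \<Longrightarrow> 0 \<le> P t"
    and cont: "continuous_on {0..1} k" "continuous_on {0..1} P"
    and K: "\<And>t. t \<in> {0..1} \<Longrightarrow> P t * k t \<le> K"
  shows rectifiable_path_C1: "rectifiable_path \<gamma>"
    and arc_length_integral_le: "arc_length_integral \<rho> \<gamma> \<le> ennreal K"
proof -
  have knn: "0 \<le> k t" if "t \<in> {0..1}" for t using speed[OF that] norm_ge_zero order_trans by blast
  have lip: "dist (\<gamma> s) (\<gamma> t) \<le> N * (t - s)"
    if "0 \<le> a" "a \<le> s" "s \<le> t" "t \<le> b" "b \<le> 1" and N: "\<And>u. u \<in> {a..b} \<Longrightarrow> k u \<le> N" for a b N s t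
  proof -
    have "norm (\<gamma> t - \<gamma> s) \<le> N * norm (t - s)"
    proof (rule differentiable_bound[of "{a..b}" \<gamma> "\<lambda>x h. h *\<^sub>R \<gamma>' x"])
      fix x assume x: "x \<in> {a..b}"
      then show "(\<gamma> has_derivative (\<lambda>h. h *\<^sub>R \<gamma>' x)) (at x within {a..b})"
        using deriv[of x] that unfolding has_vector_derivative_def
        by (auto intro: has_derivative_subset)
      have "norm (\<gamma>' x) \<le> N" using speed[of x] N[OF x] x that by (auto intro: order_trans)
      then show "onorm (\<lambda>h. h *\<^sub>R \<gamma>' x) \<le> N"
        by (intro onorm_le) (simp add: mult.commute[of N] mult_left_mono)
    qed (use that in auto)
    then show ?thesis using that by (simp add: dist_norm norm_minus_commute)
  qed
  obtain M where M: "\<And>u. u \<in> {0..1} \<Longrightarrow> k u \<le> M" "\<And>u. u \<in> {0..1} \<Longrightarrow> P u \<le> M"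
  proof -
    have "bdd_above (k ` {0..1})" "bdd_above (P ` {0..1})"
      using cont by (auto intro!: bounded_imp_bdd_above compact_imp_bounded compact_continuous_image)
    then obtain A B where "\<And>u. u \<in> {0..1} \<Longrightarrow> k u \<le> A" "\<And>u. u \<in> {0..1} \<Longrightarrow> P u \<le> B"
      unfolding bdd_above_def by (metis imageI)
    then show ?thesis by (intro that[of "max A B"]) (auto simp: le_max_iff_disj)
  qed
  have M0: "0 \<le> M" using M(1)[of 0] knn[of 0] by auto
  have glip: "dist (\<gamma> s) (\<gamma> t) \<le> M * (t - s)" if "0 \<le> s" "s \<le> t" "t \<le> 1" for s t
    using lip[of 0 s t 1 M] M that by auto
  have path: "path \<gamma>"
    unfolding path_def using deriv by (metis continuous_on_vector_derivative)
  with bdd_above_inscribed_lengths[OF glip] show "rectifiable_path \<gamma>"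
    by (simp add: rectifiable_path_def)
  define F where "F t = arc_length_fun \<gamma> (max 0 (min 1 t))" for t
  have Fmono: "F s \<le> F t" if "s \<le> t" for s t
    unfolding F_def using that by (intro arc_length_fun_diff(1)[OF glip glip]) auto
  have Fcont: "continuous_on UNIV F"
  proof -
    have "F t - F s \<le> M * (t - s)" if "s \<le> t" for s t
    proof -
      have "F t - F s \<le> M * (max 0 (min 1 t) - max 0 (min 1 s))"
        unfolding F_def using that by (intro arc_length_fun_diff(2)[OF glip glip]) auto
      also have "\<dots> \<le> M * (t - s)" using M0 that by (intro mult_left_mono) auto
      finally show ?thesis .
    qed
    then have "dist (F t) (F s) \<le> M * dist t s" for s t
      using Fmono[of s t] Fmono[of t s]
      by (cases s t rule: linorder_cases) (auto simp: dist_real_def)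
    then have "M-lipschitz_on UNIV F" using M0 by (intro lipschitz_onI) auto
    then show ?thesis by (rule lipschitz_on_continuous_on)
  qed
  have emF: "emeasure (interval_measure F) {a..b} = ennreal (F b - F a)" if "a \<le> b" for a b
    using that Fmono Fcont by (intro emeasure_interval_measure_Icc) auto
  \<comment> \<open>Expanding \<open>(P + \<epsilon>) * (k + \<epsilon>)\<close> leaves the error
    \<open>\<epsilon> * (P + k + \<epsilon>)\<close>, at most
    \<open>\<epsilon> * (2 * M + 1)\<close> because \<open>\<epsilon> \<le> 1\<close>.\<close>
  have bound: "arc_length_integral \<rho> \<gamma> \<le> ennreal (K + \<epsilon> * (2 * M + 1))" if "0 < \<epsilon>" "\<epsilon> \<le> 1" for \<epsilon>
  proof -
    have "uniformly_continuous_on {0..1} k" "uniformly_continuous_on {0..1} P"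
      using cont by (auto intro: compact_uniformly_continuous)
    then obtain d1 d2 where d: "d1 > 0" "\<And>x x'. x\<in>{0..1} \<Longrightarrow> x'\<in>{0..1} \<Longrightarrow> dist x' x < d1 \<Longrightarrow> dist (k x') (k x) < \<epsilon>"
       "d2 > 0" "\<And>x x'. x\<in>{0..1} \<Longrightarrow> x'\<in>{0..1} \<Longrightarrow> dist x' x < d2 \<Longrightarrow> dist (P x') (P x) < \<epsilon>"
      using \<open>0 < \<epsilon>\<close> unfolding uniformly_continuous_on_def by metis
    define d where "d = min d1 d2"
    have "d > 0" using d by (simp add: d_def)
    then obtain n0 where n0: "inverse (real (Suc n0)) < d" using reals_Archimedean by blast
    define n where "n = Suc n0"
    have n: "n > 0" "1 / real n < d" using n0 by (auto simp: n_def inverse_eq_divide)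
    define a where "a i = real i / real n" for i :: nat
    have a: "a i \<le> a (Suc i)" "a (Suc i) - a i = 1 / n" for i using n by (auto simp: a_def field_simps)
    have a01: "0 \<le> a i" "i \<le> n \<Longrightarrow> a i \<le> 1" for i using n by (auto simp: a_def)
    have near: "k u \<le> k (a i) + \<epsilon>" "P u \<le> P (a i) + \<epsilon>" if "i < n" "u \<in> {a i..a (Suc i)}" for i u
    proof -
      have "dist u (a i) < d" "u \<in> {0..1}" "a i \<in> {0..1}"
        using that a[of i] n a01[of i] a01[of "Suc i"] by (auto simp: dist_real_def)
      then have "dist (k u) (k (a i)) < \<epsilon>" "dist (P u) (P (a i)) < \<epsilon>"
        using d by (auto simp: d_def)
      then show "k u \<le> k (a i) + \<epsilon>" "P u \<le> P (a i) + \<epsilon>" by (auto simp: dist_real_def)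
    qed
    \<comment> \<open>Adjacent closed cells share an endpoint; counting it twice is harmless for an
      upper bound.\<close>
    have cover: "\<exists>i<n. t \<in> {a i..a (Suc i)}" if "t \<in> {0..1}" for t
    proof (cases "t = 1")
      case True then show ?thesis using n by (intro exI[of _ "n - 1"]) (auto simp: a_def)
    next
      case False
      define i where "i = nat \<lfloor>t * n\<rfloor>"
      have "0 \<le> t * n" "t * n < n" using that False n by auto
      then have "real i \<le> t * n" "t * n \<le> real i + 1" "i < n" unfolding i_def by linarith+
      then show ?thesis using n by (intro exI[of _ i]) (auto simp: a_def field_simps)
    qed
    have "arc_length_integral \<rho> \<gamma> \<le> (\<integral>\<^sup>+t. (\<Sum>i<n. ennreal (P (a i) + \<epsilon>) * indicator {a i..a (Suc i)} t) \<partial>interval_measure F)"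
      unfolding arc_length_integral_def F_def[symmetric]
    proof (rule nn_integral_mono)
      fix t
      show "ennreal (\<rho> (\<gamma> t)) * indicator {0..1} t \<le> (\<Sum>i<n. ennreal (P (a i) + \<epsilon>) * indicator {a i..a (Suc i)} t)"
      proof (cases "t \<in> {0..1}")
        case True
        then obtain i where i: "i < n" "t \<in> {a i..a (Suc i)}" using cover by blast
        have "ennreal (\<rho> (\<gamma> t)) \<le> ennreal (P (a i) + \<epsilon>) * indicator {a i..a (Suc i)} t"
          using i near(2)[OF i] dens(1)[OF True] by (auto intro!: ennreal_leI)
        also have "\<dots> \<le> (\<Sum>i<n. ennreal (P (a i) + \<epsilon>) * indicator {a i..a (Suc i)} t)"
          using i by (intro member_le_sum) auto
        finally show ?thesis using True by simp
      qed auto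
    qed
    also have "\<dots> = (\<Sum>i<n. ennreal (P (a i) + \<epsilon>) * ennreal (F (a (Suc i)) - F (a i)))"
      by (subst nn_integral_sum) (auto simp: nn_integral_cmult emF[OF a(1)])
    also have "\<dots> \<le> (\<Sum>i<n. ennreal ((K + \<epsilon> * (2 * M + 1)) / n))"
    proof (rule sum_mono)
      fix i assume "i \<in> {..<n}"
      then have i: "i < n" by simp
      have ai: "a i \<in> {0..1}" using i a01 by auto
      have "F (a (Suc i)) - F (a i) = arc_length_fun \<gamma> (a (Suc i)) - arc_length_fun \<gamma> (a i)"
        using a01 i by (simp add: F_def)
      also have "\<dots> \<le> (k (a i) + \<epsilon>) * (a (Suc i) - a i)"
        using a01 a i near(1)[OF i]
        by (intro arc_length_fun_diff(2)[OF glip lip[of "a i" _ _ "a (Suc i)"]]) auto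
      finally have 1: "F (a (Suc i)) - F (a i) \<le> (k (a i) + \<epsilon>) / n" by (simp add: a)
      have "ennreal (P (a i) + \<epsilon>) * ennreal (F (a (Suc i)) - F (a i)) = ennreal ((P (a i) + \<epsilon>) * (F (a (Suc i)) - F (a i)))"
        using dens(2)[OF ai] \<open>0 < \<epsilon>\<close> Fmono[OF a(1)] by (simp add: ennreal_mult)
      also have "(P (a i) + \<epsilon>) * (F (a (Suc i)) - F (a i)) \<le> (P (a i) + \<epsilon>) * ((k (a i) + \<epsilon>) / n)"
        using dens(2)[OF ai] \<open>0 < \<epsilon>\<close> 1 by (intro mult_left_mono) auto
      also have "\<dots> = (P (a i) * k (a i) + \<epsilon> * (P (a i) + k (a i) + \<epsilon>)) / n" by (simp add: field_simps)
      also have "\<dots> \<le> (K + \<epsilon> * (2 * M + 1)) / n"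
        using K[OF ai] M[OF ai] that by (intro divide_right_mono add_mono mult_left_mono) auto
      finally show "ennreal (P (a i) + \<epsilon>) * ennreal (F (a (Suc i)) - F (a i)) \<le> ennreal ((K + \<epsilon> * (2 * M + 1)) / n)"
        by (simp add: ennreal_leI)
    qed
    also have "\<dots> = ennreal (K + \<epsilon> * (2 * M + 1))"
    proof -
      have "0 \<le> K" using K[of 0] mult_nonneg_nonneg[OF dens(2)[of 0] knn[of 0]] by simp
      then have "0 \<le> K + \<epsilon> * (2 * M + 1)" using M0 that by auto
      then show ?thesis using n by (subst sum_ennreal) auto
    qed
    finally show ?thesis .
  qed
  show "arc_length_integral \<rho> \<gamma> \<le> ennreal K"
  proof (rule ennreal_le_epsilon)
    fix e :: real assume "e > 0"
    define \<epsilon> where "\<epsilon> = min 1 (e / (2 * M + 1))"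
    have e: "0 < \<epsilon>" "\<epsilon> \<le> 1" using \<open>e > 0\<close> M0 by (auto simp: \<epsilon>_def)
    have "\<epsilon> * (2 * M + 1) \<le> e"
    proof -
      have "\<epsilon> * (2 * M + 1) \<le> e / (2 * M + 1) * (2 * M + 1)"
        using M0 by (intro mult_right_mono) (auto simp: \<epsilon>_def)
      then show ?thesis using M0 by simp
    qed
    then have "arc_length_integral \<rho> \<gamma> \<le> ennreal (K + e)"
      using bound[OF e] by (meson add_left_mono ennreal_leI order_trans)
    also have "0 \<le> K" using K[of 0] mult_nonneg_nonneg[OF dens(2)[of 0] knn[of 0]] by simp
    then have "ennreal (K + e) = ennreal K + ennreal e" using \<open>e > 0\<close> by simp
    finally show "arc_length_integral \<rho> \<gamma> \<le> ennreal K + ennreal e" .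
  qed
qed

text \<open>The hyperbolic speed is at most \<open>2 / r t * k t\<close>, hence at most
  \<open>K\<close>, and the parameter interval has length 1. Continuous majorants \<open>k\<close>
  and \<open>r\<close> spare computing the exact speed and the exact distance to the
  boundary.\<close>

lemma hyperbolic_metric_le:
  assumes "open \<Omega>" "simply_connected \<Omega>" "\<Omega> \<noteq> UNIV"
    and deriv: "\<And>t. t \<in> {0..1} \<Longrightarrow> (\<gamma> has_vector_derivative \<gamma>' t) (at t within {0..1})"
    and speed: "\<And>t. t \<in> {0..1} \<Longrightarrow> norm (\<gamma>' t) \<le> k t"
    and ball: "\<And>t. t \<in> {0..1} \<Longrightarrow> ball (\<gamma> t) (r t) \<subseteq> \<Omega>" "\<And>t. t \<in> {0..1} \<Longrightarrow> 0 < r t"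
    and cont: "continuous_on {0..1} k" "continuous_on {0..1} r"
    and K: "\<And>t. t \<in> {0..1} \<Longrightarrow> 2 * k t \<le> K * r t"
  shows "hyperbolic_metric \<Omega> (\<gamma> 0) (\<gamma> 1) \<le> K"
proof -
  have "\<gamma> t \<in> \<Omega>" if "t \<in> {0..1}" for t using ball[OF that] by auto
  have dens: "hyperbolic_density \<Omega> (\<gamma> t) \<le> 2 / r t" if "t \<in> {0..1}" for t
    using hyperbolic_density_le[OF assms(1-3) ball(2) ball(1)] that by blast
  have pos: "0 \<le> 2 / r t" if "t \<in> {0..1}" for t using ball(2)[OF that] by simp
  have contP: "continuous_on {0..1} (\<lambda>t. 2 / r t)"
    using cont ball(2) by (intro continuous_intros) (auto simp: less_imp_neq[symmetric])
  have le: "2 / r t * k t \<le> K" if "t \<in> {0..1}" for t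
    using K[OF that] ball(2)[OF that] by (simp add: field_simps)
  have "arc_length_integral (hyperbolic_density \<Omega>) \<gamma> \<le> ennreal K" "rectifiable_path \<gamma>"
    using arc_length_integral_le[OF deriv speed dens pos cont(1) contP le]
      rectifiable_path_C1[OF deriv speed dens pos cont(1) contP le] by blast+
  then have "(INF \<gamma> \<in> {\<gamma>'. rectifiable_path \<gamma>' \<and> path_image \<gamma>' \<subseteq> \<Omega> \<and> pathstart \<gamma>' = \<gamma> 0 \<and> pathfinish \<gamma>' = \<gamma> 1}.
                 arc_length_integral (hyperbolic_density \<Omega>) \<gamma>) \<le> ennreal K"
    using \<open>\<And>t. t \<in> {0..1} \<Longrightarrow> \<gamma> t \<in> \<Omega>\<close>
    by (intro INF_lower2[of \<gamma>]) (auto simp: path_image_def pathstart_def pathfinish_def)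
  \<comment> \<open>\<open>ennreal\<close> truncates negative numbers, so the bound passes to
    \<open>real\<close> only for nonnegative \<open>K\<close>.\<close>
  moreover have "0 \<le> K"
  proof -
    have "0 \<le> k 0" using speed[of 0] norm_ge_zero order_trans by (meson atLeastAtMost_iff order_refl zero_le_one)
    then have "0 \<le> K * r 0" using K[of 0] by simp
    then show ?thesis using ball(2)[of 0] by (simp add: zero_le_mult_iff)
  qed
  ultimately show ?thesis unfolding hyperbolic_metric_def by (rule enn2real_leI[rotated])
qed

section \<open>Smooth bump functions\<close>

text \<open>A one-variable analogue of \<open>Ck_function\<close> in which the derivative is
  supplied existentially: closure under sums, products and affine substitution is then an induction
  on explicit derivatives, without evaluating \<open>frechet_derivative\<close>.\<close>

primrec smooth_upto :: "nat \<Rightarrow> (real \<Rightarrow> real) \<Rightarrow> bool" where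
  "smooth_upto 0 f \<longleftrightarrow> continuous_on UNIV f"
| "smooth_upto (Suc k) f \<longleftrightarrow> (\<exists>f'. (\<forall>x. (f has_real_derivative f' x) (at x)) \<and> smooth_upto k f')"

lemma smooth_upto_SucI:
  "(\<And>x. (f has_real_derivative f' x) (at x)) \<Longrightarrow> smooth_upto k f' \<Longrightarrow> smooth_upto (Suc k) f"
  by auto

lemma smooth_upto_continuous: "smooth_upto k f \<Longrightarrow> continuous_on UNIV f"
  by (cases k) (auto intro: DERIV_continuous_on)

lemma smooth_upto_Suc_D: "smooth_upto (Suc k) f \<Longrightarrow> smooth_upto k f"
  by (induction k arbitrary: f) (auto intro: DERIV_continuous_on)

lemma smooth_upto_const: "smooth_upto k (\<lambda>_. c)"
  by (induction k arbitrary: c) (auto intro!: exI[of _ "\<lambda>_. 0"])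

lemma smooth_upto_add: "smooth_upto k f \<Longrightarrow> smooth_upto k g \<Longrightarrow> smooth_upto k (\<lambda>x. f x + g x)"
proof (induction k arbitrary: f g)
  case (Suc k)
  then obtain f' g' where "\<forall>x. (f has_real_derivative f' x) (at x)" "smooth_upto k f'"
    "\<forall>x. (g has_real_derivative g' x) (at x)" "smooth_upto k g'" by auto
  then show ?case using Suc.IH by (auto intro!: exI[of _ "\<lambda>x. f' x + g' x"] DERIV_add)
qed (auto intro!: continuous_intros)

lemma smooth_upto_mult: "smooth_upto k f \<Longrightarrow> smooth_upto k g \<Longrightarrow> smooth_upto k (\<lambda>x. f x * g x)"
proof (induction k arbitrary: f g)
  case (Suc k)
  then obtain f' g' where fg: "\<forall>x. (f has_real_derivative f' x) (at x)" "smooth_upto k f'"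
    "\<forall>x. (g has_real_derivative g' x) (at x)" "smooth_upto k g'" by auto
  have fg': "smooth_upto k f" "smooth_upto k g" using Suc.prems smooth_upto_Suc_D by blast+
  have "smooth_upto k (\<lambda>x. f' x * g x + g' x * f x)" using fg fg' Suc.IH by (intro smooth_upto_add) auto
  moreover have "((\<lambda>x. f x * g x) has_real_derivative f' x * g x + g' x * f x) (at x)" for x
    using fg DERIV_mult by blast
  ultimately show ?case by (intro smooth_upto_SucI)
qed (auto intro!: continuous_intros)

lemma smooth_upto_affine: "smooth_upto k f \<Longrightarrow> smooth_upto k (\<lambda>x. f (c * x + d))"
proof (induction k arbitrary: f)
  case 0 then show ?case by (auto intro!: continuous_on_compose2[of UNIV f] continuous_intros)
next
  case (Suc k)
  then obtain f' where f': "\<forall>x. (f has_real_derivative f' x) (at x)" "smooth_upto k f'" by auto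
  have "((\<lambda>x. f (c * x + d)) has_real_derivative f' (c * x + d) * c) (at x)" for x
    using f' by (intro DERIV_chain2[of f]) (auto intro!: derivative_eq_intros)
  moreover have "smooth_upto k (\<lambda>x. f' (c * x + d) * c)"
    using Suc.IH[OF f'(2)] smooth_upto_const by (intro smooth_upto_mult)
  ultimately show ?case by (intro smooth_upto_SucI)
qed

lemma smooth_upto_sum:
  "(\<And>i. i < (n::nat) \<Longrightarrow> smooth_upto k (f i)) \<Longrightarrow> smooth_upto k (\<lambda>x. \<Sum>i<n. f i x)"
  by (induction n) (auto intro!: smooth_upto_const smooth_upto_add)

text \<open>Differentiation of \<open>p(1/x) e\<^bsup>-1/x\<^esup>\<close> only changes the polynomial \<open>p\<close>, so this family is
  closed under derivatives, also across \<open>0\<close>.\<close>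

definition flat :: "real poly \<Rightarrow> real \<Rightarrow> real" where
  "flat p x = (if 0 < x then poly p (1 / x) * exp (- (1 / x)) else 0)"

lemma flat_tendsto_0: "(flat p \<longlongrightarrow> 0) (at_right 0)"
proof -
  have "((\<lambda>y. poly p y * exp (- y)) \<longlongrightarrow> 0) at_top"
  proof -
    have "((\<lambda>y. \<Sum>i\<le>degree p. coeff p i * (y ^ i / exp y)) \<longlongrightarrow> (\<Sum>i\<le>degree p. coeff p i * 0)) at_top"
      by (intro tendsto_intros tendsto_power_div_exp_0)
    moreover have "(\<lambda>y. \<Sum>i\<le>degree p. coeff p i * (y ^ i / exp y)) = (\<lambda>y. poly p y * exp (- y))"
      by (simp add: poly_altdef sum_distrib_right exp_minus divide_inverse mult.assoc)
    ultimately show ?thesis by simp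
  qed
  then have "((\<lambda>x. poly p (inverse x) * exp (- inverse x)) \<longlongrightarrow> 0) (at_right 0)"
    by (rule filterlim_compose[OF _ filterlim_inverse_at_top_right])
  moreover have "eventually (\<lambda>x. poly p (inverse x) * exp (- inverse x) = flat p x) (at_right 0)"
    unfolding eventually_at_filter by (auto simp: flat_def inverse_eq_divide)
  ultimately show ?thesis by (simp cong: tendsto_cong)
qed

text \<open>With \<open>y = 1 / x\<close> one has \<open>dy/dx = - y^2\<close>, so differentiating
  \<open>p(y) * exp (- y)\<close> gives \<open>y^2 * (p(y) - p'(y)) * exp (- y)\<close>; the factor
  \<open>[:0, 0, 1:]\<close> is \<open>y^2\<close>. At 0 the right difference quotient of
  \<open>flat p\<close> is \<open>flat ([:0, 1:] * p)\<close>, which tends to 0.\<close>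

lemma flat_deriv: "(flat p has_real_derivative flat ([:0, 0, 1:] * (p - pderiv p)) x) (at x)"
proof -
  consider "x < 0" | "0 < x" | "x = 0" by linarith
  then show ?thesis
  proof cases
    case 1
    have "((\<lambda>_. 0) has_real_derivative 0) (at x)" by simp
    then have "(flat p has_real_derivative 0) (at x)"
      by (rule has_field_derivative_transform_within_open[of _ _ _ "{..<0}"]) (use 1 in \<open>auto simp: flat_def\<close>)
    then show ?thesis using 1 by (simp add: flat_def)
  next
    case 2
    have "((\<lambda>x. poly p (1 / x) * exp (- (1 / x))) has_real_derivative
      poly (pderiv p) (1 / x) * (- 1 / x\<^sup>2) * exp (- (1 / x)) + exp (- (1 / x)) * (1 / x\<^sup>2) * poly p (1 / x)) (at x)"
      using 2 by (auto intro!: derivative_eq_intros poly_DERIV[THEN DERIV_chain2] simp: power2_eq_square)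
    then have "(flat p has_real_derivative
      poly (pderiv p) (1 / x) * (- 1 / x\<^sup>2) * exp (- (1 / x)) + exp (- (1 / x)) * (1 / x\<^sup>2) * poly p (1 / x)) (at x)"
      by (rule has_field_derivative_transform_within_open[of _ _ _ "{0<..}"]) (use 2 in \<open>auto simp: flat_def\<close>)
    moreover have "poly (pderiv p) (1 / x) * (- 1 / x\<^sup>2) * exp (- (1 / x)) + exp (- (1 / x)) * (1 / x\<^sup>2) * poly p (1 / x)
       = flat ([:0, 0, 1:] * (p - pderiv p)) x"
      using 2 by (simp add: flat_def field_simps power2_eq_square)
    ultimately show ?thesis by simp
  next
    case 3
    have "((\<lambda>h. (flat p (0 + h) - flat p 0) / h) \<longlongrightarrow> 0) (at 0)"
    proof -
      have "((\<lambda>h. (flat p (0 + h) - flat p 0) / h) \<longlongrightarrow> 0) (at_right 0)"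
      proof (rule tendsto_cong[THEN iffD1, OF _ flat_tendsto_0[of "[:0, 1:] * p"]])
        show "\<forall>\<^sub>F x in at_right 0. flat ([:0, 1:] * p) x = (flat p (0 + x) - flat p 0) / x"
          unfolding eventually_at_filter by (auto simp: flat_def)
      qed
      moreover have "((\<lambda>h. (flat p (0 + h) - flat p 0) / h) \<longlongrightarrow> 0) (at_left 0)"
      proof (rule tendsto_cong[THEN iffD1, OF _ tendsto_const])
        show "\<forall>\<^sub>F x in at_left 0. 0 = (flat p (0 + x) - flat p 0) / x"
          unfolding eventually_at_filter by (auto simp: flat_def)
      qed
      ultimately show ?thesis by (simp only: filterlim_at_split)
    qed
    then show ?thesis using 3 by (simp add: DERIV_def flat_def)
  qed
qed

lemma smooth_upto_flat: "smooth_upto k (flat p)"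
proof (induction k arbitrary: p)
  case 0
  show ?case using flat_deriv by (auto intro: DERIV_continuous_on)
next
  case (Suc k)
  then show ?case using flat_deriv by fastforce
qed

text \<open>\<open>b\<close> is a bump on the unit interval and \<open>B\<close> its primitive, a
  smooth step of height \<kappa>. The bump is normalized by \<open>b \<le> 1\<close> and not by its
  integral, so \<kappa> appears in the later constants.\<close>

locale smooth_step =
  fixes b B :: "real \<Rightarrow> real" and \<kappa> :: real
  assumes kappa: "0 < \<kappa>"
    and b01: "\<And>x. 0 \<le> b x" "\<And>x. b x \<le> 1"
    and b_out: "\<And>x. x \<le> 0 \<Longrightarrow> b x = 0" "\<And>x. 1 \<le> x \<Longrightarrow> b x = 0"
    and deriv_B: "\<And>x. (B has_real_derivative b x) (at x)"
    and B_left: "\<And>x. x \<le> 0 \<Longrightarrow> B x = 0" and B_right: "\<And>x. 1 \<le> x \<Longrightarrow> B x = \<kappa>"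
    and smooth_b: "\<And>k. smooth_upto k b"

lemma smooth_step_exists: "\<exists>b B \<kappa>. smooth_step b B \<kappa>"
proof -
  define b where "b x = flat 1 x * flat 1 ((-1) * x + 1)" for x
  have smooth: "smooth_upto k b" for k
    unfolding b_def by (intro smooth_upto_mult smooth_upto_affine smooth_upto_flat)
  have f01: "0 \<le> flat 1 x" "flat 1 x \<le> 1" for x by (auto simp: flat_def)
  have b01: "0 \<le> b x" "b x \<le> 1" for x
    using f01[of x] f01[of "(-1) * x + 1"] by (auto simp: b_def mult_le_one)
  have b_out: "b x = 0" if "x \<le> 0 \<or> 1 \<le> x" for x using that by (auto simp: b_def flat_def)
  have "continuous_on UNIV b" using smooth smooth_upto_continuous by blast
  then have "isCont b x" for x by (simp add: continuous_on_eq_continuous_at)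
  then have "\<exists>F. \<forall>x :: real. -\<infinity> < ereal x \<longrightarrow> ereal x < \<infinity> \<longrightarrow> (F has_vector_derivative b x) (at x)"
    by (intro einterval_antiderivative) auto
  then obtain F where F: "\<And>x. (F has_real_derivative b x) (at x)"
    by (auto simp: has_real_derivative_iff_has_vector_derivative)
  define B where "B x = F x - F 0" for x
  have B: "(B has_real_derivative b x) (at x)" for x
    unfolding B_def using F by (auto intro!: derivative_eq_intros)
  have B0: "B 0 = 0" by (simp add: B_def)
  have zero: "B x = B y" if "x \<le> y" "\<And>z. x \<le> z \<Longrightarrow> z \<le> y \<Longrightarrow> b z = 0" for x y
  proof (cases "x = y")
    case False
    then have "x < y" using that by simp
    from MVT2[OF this, of B b] B obtain z where "z > x" "z < y" "B y - B x = (y - x) * b z"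
      by blast
    then show ?thesis using that by auto
  qed auto
  have "smooth_step b B (B 1)"
  proof
    show "B x = 0" if "x \<le> 0" for x using zero[of x 0] b_out B0 that by auto
    show "B x = B 1" if "1 \<le> x" for x using zero[of 1 x] b_out that by auto
    have "b (1/2) > 0" by (simp add: b_def flat_def)
    \<comment> \<open>Otherwise the monotone \<open>B\<close> would be constant on the unit
      interval, against \<open>b (1/2) > 0\<close>.\<close>
    show "0 < B 1"
    proof (rule ccontr)
      have mono: "B x \<le> B y" if "x \<le> y" for x y
        using that B b01(1) DERIV_nonneg_imp_nondecreasing[of x y B] by blast
      assume "\<not> 0 < B 1"
      then have "B x = 0" if "x \<in> {0<..<1}" for x using mono[of 0 x] mono[of x 1] B0 that by auto
      then have "(B has_real_derivative 0) (at (1/2))"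
        by (intro has_field_derivative_transform_within_open[OF DERIV_const, of "{0<..<1}"]) auto
      then show False using B[of "1/2"] DERIV_unique \<open>b (1/2) > 0\<close> by fastforce
    qed
  qed (use b01 b_out B smooth in auto)
  then show ?thesis by blast
qed

section \<open>Iterated integrals in complex coordinates and product test functions\<close>

lemma lborel_complex: "distr (lborel \<Otimes>\<^sub>M lborel) borel (\<lambda>(x, y). Complex x y) = lborel"
proof (rule lborel_eqI[symmetric])
  have [measurable]: "(\<lambda>(x, y). Complex x y) \<in> borel \<rightarrow>\<^sub>M borel"
    by (intro borel_measurable_continuous_onI) (auto simp: case_prod_beta' intro!: continuous_intros)
  fix l u :: complex assume le: "\<And>b. b \<in> Basis \<Longrightarrow> l \<bullet> b \<le> u \<bullet> b"
  then have "Re l \<le> Re u" "Im l \<le> Im u" using le[of 1] le[of \<i>] by (auto simp: Basis_complex_def inner_complex_def)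
  have "(\<lambda>(x, y). Complex x y) -` box l u = {Re l<..<Re u} \<times> {Im l<..<Im u}"
    by (auto simp: in_box_complex_iff)
  then have "emeasure (distr (lborel \<Otimes>\<^sub>M lborel) borel (\<lambda>(x, y). Complex x y)) (box l u) =
      emeasure (lborel \<Otimes>\<^sub>M lborel) ({Re l<..<Re u} \<times> {Im l<..<Im u})"
    by (subst emeasure_distr) (auto simp: space_pair_measure lborel_prod)
  also have "\<dots> = ennreal ((Re u - Re l) * (Im u - Im l))"
    using \<open>Re l \<le> Re u\<close> \<open>Im l \<le> Im u\<close>
    by (subst lborel.emeasure_pair_measure_Times) (auto simp: ennreal_mult)
  also have "(Re u - Re l) * (Im u - Im l) = (\<Prod>b\<in>Basis. (u - l) \<bullet> b)"
    by (simp add: Basis_complex_def inner_complex_def)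
  finally show "emeasure (distr (lborel \<Otimes>\<^sub>M lborel) borel (\<lambda>(x, y). Complex x y)) (box l u) = ennreal (\<Prod>b\<in>Basis. (u - l) \<bullet> b)" .
qed simp

lemma nn_integral_complex:
  assumes [measurable]: "f \<in> borel_measurable borel"
  shows "(\<integral>\<^sup>+z. f z \<partial>lborel) = (\<integral>\<^sup>+x. \<integral>\<^sup>+y. f (Complex x y) \<partial>lborel \<partial>lborel)"
proof -
  have [measurable]: "(\<lambda>(x, y). Complex x y) \<in> borel \<Otimes>\<^sub>M borel \<rightarrow>\<^sub>M borel"
    unfolding borel_prod
    by (intro borel_measurable_continuous_onI) (auto simp: case_prod_beta' intro!: continuous_intros)
  have "(\<integral>\<^sup>+z. f z \<partial>lborel) = (\<integral>\<^sup>+p. f (case p of (x, y) \<Rightarrow> Complex x y) \<partial>(lborel \<Otimes>\<^sub>M lborel))"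
    by (subst lborel_complex[symmetric], subst nn_integral_distr) auto
  also have "\<dots> = (\<integral>\<^sup>+x. \<integral>\<^sup>+y. f (Complex x y) \<partial>lborel \<partial>lborel)"
    by (subst lborel.nn_integral_fst[symmetric]) auto
  finally show ?thesis .
qed

text \<open>Both partial derivatives of a product are again products of the same kind, with one
  factor differentiated. The induction on \<open>k\<close> therefore runs over all pairs of factors
  at once and uses the derivative formula at every step.\<close>

lemma Ck_function_product:
  "smooth_upto k \<alpha> \<Longrightarrow> smooth_upto k \<beta> \<Longrightarrow> Ck_function k (\<lambda>z. \<alpha> (Re z) * \<beta> (Im z))"
  and product_has_derivative:
  "(\<And>x. (\<alpha> has_real_derivative \<alpha>' x) (at x)) \<Longrightarrow> (\<And>x. (\<beta> has_real_derivative \<beta>' x) (at x)) \<Longrightarrow>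
   ((\<lambda>z. \<alpha> (Re z) * \<beta> (Im z)) has_derivative (\<lambda>h. \<alpha>' (Re z) * \<beta> (Im z) * Re h + \<alpha> (Re z) * \<beta>' (Im z) * Im h)) (at z)"
proof -
  show *: "((\<lambda>z. \<alpha> (Re z) * \<beta> (Im z)) has_derivative (\<lambda>h. \<alpha>' (Re z) * \<beta> (Im z) * Re h + \<alpha> (Re z) * \<beta>' (Im z) * Im h)) (at z)"
    if "\<And>x. (\<alpha> has_real_derivative \<alpha>' x) (at x)" "\<And>x. (\<beta> has_real_derivative \<beta>' x) (at x)" for \<alpha> \<beta> \<alpha>' \<beta>' :: "real \<Rightarrow> real" and z
  proof -
    have "((\<lambda>z. \<alpha> (Re z)) has_derivative (\<lambda>h. \<alpha>' (Re z) * Re h)) (at z)"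
      using has_derivative_compose[of Re Re z UNIV \<alpha> "(*) (\<alpha>' (Re z))"] that(1)[of "Re z"]
      by (simp add: has_field_derivative_def bounded_linear_imp_has_derivative bounded_linear_Re)
    moreover have "((\<lambda>z. \<beta> (Im z)) has_derivative (\<lambda>h. \<beta>' (Im z) * Im h)) (at z)"
      using has_derivative_compose[of Im Im z UNIV \<beta> "(*) (\<beta>' (Im z))"] that(2)[of "Im z"]
      by (simp add: has_field_derivative_def bounded_linear_imp_has_derivative bounded_linear_Im)
    ultimately show ?thesis by (rule has_derivative_eq_rhs[OF has_derivative_mult]) (auto simp: algebra_simps)
  qed
  show "smooth_upto k \<alpha> \<Longrightarrow> smooth_upto k \<beta> \<Longrightarrow> Ck_function k (\<lambda>z. \<alpha> (Re z) * \<beta> (Im z))"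
  proof (induction k arbitrary: \<alpha> \<beta>)
    case 0
    then show ?case by (auto intro!: continuous_intros continuous_on_compose2[of UNIV \<alpha>] continuous_on_compose2[of UNIV \<beta>])
  next
    case (Suc k)
    then obtain \<alpha>' \<beta>' where d: "\<And>x. (\<alpha> has_real_derivative \<alpha>' x) (at x)" "smooth_upto k \<alpha>'"
      "\<And>x. (\<beta> has_real_derivative \<beta>' x) (at x)" "smooth_upto k \<beta>'" by auto
    note D = *[OF d(1,3)]
    have "smooth_upto k \<alpha>" "smooth_upto k \<beta>" using Suc.prems smooth_upto_Suc_D by blast+
    then have "Ck_function k (\<lambda>z. \<alpha>' (Re z) * \<beta> (Im z))" "Ck_function k (\<lambda>z. \<alpha> (Re z) * \<beta>' (Im z))"
      using Suc.IH d by auto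
    moreover have "frechet_derivative (\<lambda>z. \<alpha> (Re z) * \<beta> (Im z)) (at z) = (\<lambda>h. \<alpha>' (Re z) * \<beta> (Im z) * Re h + \<alpha> (Re z) * \<beta>' (Im z) * Im h)" for z
      using D by (rule frechet_derivative_at[symmetric])
    ultimately show ?case
      using D by (auto simp: differentiable_def Basis_complex_def)
  qed
qed

section \<open>Weak derivatives and variation on vertical chords\<close>

text \<open>\<open>f\<close> is controlled only on the open set \<open>U\<close> and may misbehave
  at its boundary; the compact support of \<open>g\<close> confines the product to a set where
  \<open>f\<close> is bounded.\<close>

lemma set_integrable_cutoff:
  fixes f :: "complex \<Rightarrow> 'b::euclidean_space" and g :: "complex \<Rightarrow> real"
  assumes "continuous_on U f" "continuous_on UNIV g" "compact K" "K \<subseteq> U" "open U"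
    and zero: "\<And>z. z \<notin> K \<Longrightarrow> g z = 0"
  shows "set_integrable lebesgue U (\<lambda>z. g z *\<^sub>R f z)"
proof -
  have "continuous_on K (\<lambda>z. g z *\<^sub>R f z)"
    using assms by (intro continuous_intros) (auto intro: continuous_on_subset)
  then have "integrable lborel (\<lambda>z. indicator K z *\<^sub>R g z *\<^sub>R f z)"
    using assms borel_integrable_compact[of K "\<lambda>z. g z *\<^sub>R f z"]
    by (simp add: indicator_def if_distrib[where f = "\<lambda>x. x *\<^sub>R _"] cong: if_cong)
  moreover have "(\<lambda>z. indicator K z *\<^sub>R g z *\<^sub>R f z) = (\<lambda>z. indicator U z *\<^sub>R g z *\<^sub>R f z)"
    using assms by (auto simp: indicator_def fun_eq_iff)
  ultimately show ?thesis unfolding set_integrable_def by (simp add: integrable_completion borel_measurable_integrable)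
qed

context smooth_step
begin

lemma smooth_B: "smooth_upto k B"
proof (cases k)
  case 0 then show ?thesis using deriv_B by (auto intro: DERIV_continuous_on)
next
  case (Suc j) then show ?thesis using deriv_B smooth_b smooth_upto_SucI by blast
qed

lemma B_mono: "x \<le> y \<Longrightarrow> B x \<le> B y"
  using deriv_B b01(1) DERIV_nonneg_imp_nondecreasing[of x y B] by blast

lemma B_bounds: "0 \<le> B x" "B x \<le> \<kappa>"
  using B_mono[of "min x 0" x] B_mono[of x "max x 1"] B_left[of "min x 0"] B_right[of "max x 1"] by auto

lemma smooth_rescaled:
  assumes "smooth_upto k f" shows "smooth_upto k (\<lambda>x. f ((x - c) / \<delta>))"
  using smooth_upto_affine[OF assms, of "1 / \<delta>" "- c / \<delta>"] by (simp add: diff_divide_distrib)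

lemma continuous_b [continuous_intros]: "continuous_on A f \<Longrightarrow> continuous_on A (\<lambda>x. b (f x))"
  using smooth_upto_continuous[OF smooth_b] continuous_on_compose2[of UNIV b A f] by auto

lemma borel_b [measurable]: "b \<in> borel_measurable borel"
  using smooth_upto_continuous[OF smooth_b] by (rule borel_measurable_continuous_onI)

lemma b_rescaled_out:
  assumes "0 < \<delta>" "x \<le> c \<or> c + \<delta> \<le> x" shows "b ((x - c) / \<delta>) = 0"
proof -
  have "(x - c) / \<delta> \<le> 0 \<or> 1 \<le> (x - c) / \<delta>" using assms by (auto simp: field_simps)
  then show ?thesis using b_out by blast
qed

lemma deriv_rescaled_B:
  assumes "0 < \<delta>"
  shows "((\<lambda>x. B ((x - c) / \<delta>)) has_real_derivative b ((x - c) / \<delta>) / \<delta>) (at x)"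
proof -
  have "((\<lambda>x. (x - c) / \<delta>) has_real_derivative 1 / \<delta>) (at x)"
    using assms by (auto intro!: derivative_eq_intros)
  from DERIV_chain2[OF deriv_B this] show ?thesis by simp
qed

lemma nn_integral_rescaled_b:
  assumes "0 < \<delta>"
  shows "(\<integral>\<^sup>+x. ennreal (b ((x - c) / \<delta>)) \<partial>lborel) = ennreal (\<delta> * \<kappa>)"
proof -
  have "(\<integral>\<^sup>+x. ennreal (b ((x - c) / \<delta>)) \<partial>lborel) = (\<integral>\<^sup>+x. ennreal (b ((x - c) / \<delta>)) * indicator {c..c + \<delta>} x \<partial>lborel)"
  proof (rule nn_integral_cong)
    fix x
    have "b ((x - c) / \<delta>) = 0" if "x \<notin> {c..c + \<delta>}"
      using that assms by (intro b_rescaled_out) auto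
    then show "ennreal (b ((x - c) / \<delta>)) = ennreal (b ((x - c) / \<delta>)) * indicator {c..c + \<delta>} x"
      by (auto simp: indicator_def)
  qed
  also have "\<dots> = ennreal (\<delta> * B ((c + \<delta> - c) / \<delta>) - \<delta> * B ((c - c) / \<delta>))"
  proof (rule nn_integral_FTC_Icc)
    show "((\<lambda>x. \<delta> * B ((x - c) / \<delta>)) has_real_derivative b ((x - c) / \<delta>)) (at x)" for x
      using DERIV_cmult[OF deriv_rescaled_B[OF assms, of c x], of \<delta>] assms by simp
  qed (use assms b01 in auto)
  finally show ?thesis using assms B_left[of 0] B_right[of 1] by simp
qed

lemma integral_rescaled_b2:
  assumes "0 < \<delta>"
  shows "has_bochner_integral lebesgue (\<lambda>z. b ((Re z - a) / \<delta>) * b ((Im z - c) / \<delta>)) ((\<delta> * \<kappa>)\<^sup>2)"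
proof -
  have [measurable]: "(\<lambda>z. b ((Re z - a) / \<delta>) * b ((Im z - c) / \<delta>)) \<in> borel_measurable borel"
    by measurable
  have "(\<integral>\<^sup>+z. ennreal (b ((Re z - a) / \<delta>) * b ((Im z - c) / \<delta>)) \<partial>lborel) =
    (\<integral>\<^sup>+x. \<integral>\<^sup>+y. ennreal (b ((x - a) / \<delta>)) * ennreal (b ((y - c) / \<delta>)) \<partial>lborel \<partial>lborel)"
    by (subst nn_integral_complex) (simp_all add: ennreal_mult b01)
  also have "\<dots> = ennreal (\<delta> * \<kappa>) * ennreal (\<delta> * \<kappa>)"
    by (simp add: nn_integral_cmult nn_integral_multc nn_integral_rescaled_b[OF assms])
  also have "\<dots> = ennreal ((\<delta> * \<kappa>)\<^sup>2)"
    using assms kappa by (simp add: power2_eq_square ennreal_mult)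
  finally show ?thesis
    using kappa assms b01
    by (intro has_bochner_integral_nn_integral measurable_completion) (auto simp: nn_integral_completion)
qed

text \<open>The test function is \<open>b((x - a)/\<delta>) \<beta>(y)\<close>, where \<open>\<beta>'\<close> is a combination of narrow bumps at the points
  \<open>y k\<close> whose signs reproduce the variation of \<open>Im u\<close>.  As \<open>\<beta>\<close> is a signed telescoping sum,
  \<open>\<bar>\<beta>\<bar> \<le> \<kappa>\<close> however many points there are.\<close>

lemma vertical_variation_le:
  fixes u w :: "complex \<Rightarrow> complex"
  assumes w: "set_integrable lebesgue (ball 0 1) w" and weak: "weak_partial_derivative (ball 0 1) \<i> u w"
    and cont: "continuous_on (ball 0 1) u"
    and y: "\<And>k. k < n \<Longrightarrow> y k \<le> y (Suc k)" and inball: "\<And>k. k \<le> n \<Longrightarrow> Complex a (y k) \<in> ball 0 1"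
    and "0 < \<epsilon>"
  shows "\<exists>\<delta>0>0. \<forall>\<delta>. 0 < \<delta> \<and> \<delta> \<le> \<delta>0 \<longrightarrow>
     \<kappa> * \<delta> * ((\<Sum>k<n. \<bar>Im (u (Complex a (y (Suc k)))) - Im (u (Complex a (y k)))\<bar>) - \<epsilon>)
       \<le> (LINT z:{z \<in> ball 0 1. a < Re z \<and> Re z < a + \<delta>}|lebesgue. cmod (w z))"
proof -
  define p where "p k = Complex a (y k)" for k
  \<comment> \<open>Each difference \<open>V k\<close> involves two values of \<open>u\<close>, each
    known up to \<open>e\<close>, so \<open>n\<close> terms lose \<open>2 * n * e\<close>. The
    \<open>+ 1\<close> covers \<open>n = 0\<close>.\<close>
  define e where "e = \<epsilon> / (2 * real n + 1)"
  have e: "0 < e" "2 * real n * e \<le> \<epsilon>" using \<open>0 < \<epsilon>\<close> by (auto simp: e_def field_simps)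
  have "\<forall>k\<in>{..n}. \<exists>d>0. \<forall>q. dist q (p k) < d \<longrightarrow> q \<in> ball 0 1 \<and> dist (u q) (u (p k)) < e"
  proof
    fix k assume "k \<in> {..n}"
    then have pk: "p k \<in> ball 0 1" using inball by (auto simp: p_def)
    obtain d1 where d1: "d1 > 0" "ball (p k) d1 \<subseteq> ball 0 1" using pk open_ball open_contains_ball by blast
    obtain d2 where d2: "d2 > 0" "\<forall>q\<in>ball 0 1. dist q (p k) < d2 \<longrightarrow> dist (u q) (u (p k)) < e"
      using cont pk e(1) unfolding continuous_on_iff by blast
    show "\<exists>d>0. \<forall>q. dist q (p k) < d \<longrightarrow> q \<in> ball 0 1 \<and> dist (u q) (u (p k)) < e"
      using d1 d2 by (intro exI[of _ "min d1 d2"]) (auto simp: dist_commute subset_iff)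
  qed
  then obtain d where d: "\<And>k. k \<le> n \<Longrightarrow> d k > 0"
    "\<And>k q. k \<le> n \<Longrightarrow> dist q (p k) < d k \<Longrightarrow> q \<in> ball 0 1 \<and> dist (u q) (u (p k)) < e"
    unfolding bchoice_iff by (auto simp: Ball_def)
  \<comment> \<open>A point of the square of side \<delta> at \<open>p k\<close> is within
    \<open>2 * \<delta>\<close> of \<open>p k\<close>, strictly less than
    \<open>3 * \<delta>0 \<le> d k\<close>.\<close>
  define \<delta>0 where "\<delta>0 = Min (d ` {..n}) / 3"
  have \<delta>0: "0 < \<delta>0" "\<And>k. k \<le> n \<Longrightarrow> 3 * \<delta>0 \<le> d k" using d(1) by (auto simp: \<delta>0_def)
  have main: "\<kappa> * \<delta> * ((\<Sum>k<n. \<bar>Im (u (Complex a (y (Suc k)))) - Im (u (Complex a (y k)))\<bar>) - \<epsilon>)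
       \<le> (LINT z:{z \<in> ball 0 1. a < Re z \<and> Re z < a + \<delta>}|lebesgue. cmod (w z))" if \<delta>: "0 < \<delta>" "\<delta> \<le> \<delta>0" for \<delta>
  proof -
    have near: "q \<in> ball 0 1" "dist (u q) (u (p k)) < e"
      if "k \<le> n" "a \<le> Re q" "Re q \<le> a + \<delta>" "y k \<le> Im q" "Im q \<le> y k + \<delta>" for q k
    proof -
      have "dist q (p k) \<le> \<bar>Re q - a\<bar> + \<bar>Im q - y k\<bar>"
        using cmod_le[of "q - p k"] by (simp add: p_def dist_norm)
      also have "\<dots> < d k" using that \<delta> \<delta>0(2)[OF that(1)] by linarith
      finally show "q \<in> ball 0 1" "dist (u q) (u (p k)) < e" using d(2)[OF that(1)] by auto
    qed
    have y_le: "y i \<le> y j" if "i \<le> j" "j \<le> n" for i j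
      using that(2) by (induct rule: dec_induct[OF that(1)]) (use y in \<open>auto intro: order_trans\<close>)
    define R where "R = {z. a \<le> Re z \<and> Re z \<le> a + \<delta> \<and> y 0 \<le> Im z \<and> Im z \<le> y n + \<delta>}"
    have R_eq: "R = cbox (Complex a (y 0)) (Complex (a + \<delta>) (y n + \<delta>))"
      by (auto simp: R_def in_cbox_complex_iff)
    then have "compact R" by simp
    have R_sub: "R \<subseteq> ball 0 1"
    proof
      fix q assume q: "q \<in> R"
      \<comment> \<open>On an interval a square is largest at an endpoint, so a point of
        \<open>R\<close> is no farther from 0 than some corner, and the corners lie in the small
        squares at \<open>p 0\<close> and \<open>p n\<close>.\<close>
      have sq: "t\<^sup>2 \<le> max (l\<^sup>2) (r\<^sup>2)" if "l \<le> t" "t \<le> r" for l t r :: real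
      proof (cases "0 \<le> t")
        case True then show ?thesis using that power_mono[of t r 2] by (simp add: le_max_iff_disj)
      next
        case False then show ?thesis using that power_mono[of "-t" "-l" 2] by (simp add: le_max_iff_disj)
      qed
      have corner: "x\<^sup>2 + t\<^sup>2 < 1" if "x = a \<or> x = a + \<delta>" "t = y 0 \<or> t = y n + \<delta>" for x t
      proof -
        have "Complex x t \<in> ball 0 1"
          using that near(1)[of 0 "Complex x t"] near(1)[of n "Complex x t"] \<delta> by auto
        then show ?thesis by (simp add: cmod_def)
      qed
      have "(Re q)\<^sup>2 \<le> max (a\<^sup>2) ((a + \<delta>)\<^sup>2)" "(Im q)\<^sup>2 \<le> max ((y 0)\<^sup>2) ((y n + \<delta>)\<^sup>2)"
        using q by (auto simp: R_def intro!: sq)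
      then have "(Re q)\<^sup>2 + (Im q)\<^sup>2 < 1"
        using corner[of a "y 0"] corner[of a "y n + \<delta>"] corner[of "a + \<delta>" "y 0"] corner[of "a + \<delta>" "y n + \<delta>"]
        by (auto simp: max_def split: if_splits)
      then show "q \<in> ball 0 1" by (simp add: cmod_def)
    qed
    define V where "V k = Im (u (p (Suc k))) - Im (u (p k))" for k
    define Bk where "Bk k t = B ((t - y k) / \<delta>)" for k t
    define bk where "bk k t = b ((t - y k) / \<delta>)" for k t
    define \<alpha> where "\<alpha> x = b ((x - a) / \<delta>)" for x
    define \<beta> where "\<beta> t = (\<Sum>k<n. sgn (V k) * (Bk k t + (-1) * Bk (Suc k) t))" for t
    define \<beta>' where "\<beta>' t = (\<Sum>k<n. sgn (V k) * (bk k t / \<delta> - bk (Suc k) t / \<delta>))" for t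
    define \<psi> where "\<psi> z = \<alpha> (Re z) * \<beta> (Im z)" for z
    have \<alpha>01: "0 \<le> \<alpha> x" "\<alpha> x \<le> 1" for x using b01 by (auto simp: \<alpha>_def)
    have \<alpha>_out: "\<alpha> x = 0" if "x \<le> a \<or> a + \<delta> \<le> x" for x
      unfolding \<alpha>_def using \<delta>(1) that by (rule b_rescaled_out)
    have bk_out: "bk k t = 0" if "t \<le> y k \<or> y k + \<delta> \<le> t" for k t
      unfolding bk_def using \<delta>(1) that by (rule b_rescaled_out)
    have Bk_decr: "Bk (Suc k) t \<le> Bk k t" if "k < n" for k t
      unfolding Bk_def using y[OF that] \<delta> by (intro B_mono divide_right_mono) auto
    have \<beta>_le: "\<bar>\<beta> t\<bar> \<le> \<kappa>" for t
    proof -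
      have "\<bar>\<beta> t\<bar> \<le> (\<Sum>k<n. \<bar>sgn (V k) * (Bk k t + (-1) * Bk (Suc k) t)\<bar>)" unfolding \<beta>_def by (rule sum_abs)
      also have "\<dots> \<le> (\<Sum>k<n. Bk k t - Bk (Suc k) t)"
        using Bk_decr by (intro sum_mono) (auto simp: abs_mult abs_sgn_eq)
      also have "\<dots> = Bk 0 t - Bk n t" by (rule sum_lessThan_telescope')
      also have "\<dots> \<le> \<kappa>" using B_bounds[of "(t - y 0) / \<delta>"] B_bounds[of "(t - y n) / \<delta>"] by (simp add: Bk_def)
      finally show ?thesis .
    qed
    \<comment> \<open>Below \<open>y 0\<close> all the steps \<open>Bk\<close> are 0, above
      \<open>y n + \<delta>\<close> they all equal \<kappa>; in both cases the differences
      cancel.\<close>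
    have \<beta>_out: "\<beta> t = 0" if "t < y 0 \<or> y n + \<delta> < t" for t
    proof -
      have "Bk k t = Bk (Suc k) t" if "k < n" for k
      proof -
        have "y 0 \<le> y k" "y k \<le> y (Suc k)" "y (Suc k) \<le> y n" using y_le that by auto
        with \<open>t < y 0 \<or> y n + \<delta> < t\<close> consider "t \<le> y k" "t \<le> y (Suc k)" | "y k + \<delta> \<le> t" "y (Suc k) + \<delta> \<le> t"
          by linarith
        then show ?thesis
        proof cases
          case 1
          then have "(t - y k) / \<delta> \<le> 0" "(t - y (Suc k)) / \<delta> \<le> 0" using \<delta> by (auto simp: divide_le_0_iff)
          then show ?thesis by (simp add: Bk_def B_left)
        next
          case 2
          then have "1 \<le> (t - y k) / \<delta>" "1 \<le> (t - y (Suc k)) / \<delta>" using \<delta> by auto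
          then show ?thesis by (simp add: Bk_def B_right)
        qed
      qed
      then show ?thesis unfolding \<beta>_def by (intro sum.neutral) auto
    qed
    have deriv_\<beta>: "(\<beta> has_real_derivative \<beta>' t) (at t)" for t
      unfolding \<beta>_def[abs_def] \<beta>'_def
    proof (intro DERIV_sum)
      have "(Bk k has_real_derivative bk k t / \<delta>) (at t)" for k
        unfolding Bk_def[abs_def] bk_def using \<delta> by (intro deriv_rescaled_B)
      then show "((\<lambda>t. sgn (V k) * (Bk k t + (-1) * Bk (Suc k) t)) has_real_derivative sgn (V k) * (bk k t / \<delta> - bk (Suc k) t / \<delta>)) (at t)" for k
        by (auto intro!: derivative_eq_intros)
    qed
    have smooth_\<alpha>: "smooth_upto k \<alpha>" and smooth_\<beta>: "smooth_upto k \<beta>" for k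
      unfolding \<alpha>_def[abs_def] \<beta>_def[abs_def] Bk_def
      by (intro smooth_upto_sum smooth_upto_mult smooth_upto_add smooth_upto_const smooth_rescaled smooth_b smooth_B)+
    have \<psi>_out: "\<psi> z = 0" if "z \<notin> R" for z
      using that \<alpha>_out[of "Re z"] \<beta>_out[of "Im z"] by (force simp: \<psi>_def R_def)
    have test: "test_function (ball 0 1) \<psi>"
    proof -
      have "{z. \<psi> z \<noteq> 0} \<subseteq> R" using \<psi>_out by blast
      then have sub: "closure {z. \<psi> z \<noteq> 0} \<subseteq> R" using \<open>compact R\<close> by (simp add: closure_minimal compact_imp_closed)
      then have "compact (closure {z. \<psi> z \<noteq> 0})"
        using bounded_subset[OF compact_imp_bounded[OF \<open>compact R\<close>] \<open>{z. \<psi> z \<noteq> 0} \<subseteq> R\<close>] by (simp only: compact_closure)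
      then show ?thesis unfolding test_function_def
        using sub R_sub Ck_function_product[OF smooth_\<alpha> smooth_\<beta>] by (auto simp: \<psi>_def[abs_def])
    qed
    obtain \<alpha>' where deriv_\<alpha>: "\<And>x. (\<alpha> has_real_derivative \<alpha>' x) (at x)"
      using smooth_\<alpha>[of "Suc 0"] by auto
    have fd: "frechet_derivative \<psi> (at z) \<i> = \<alpha> (Re z) * \<beta>' (Im z)" for z
      unfolding \<psi>_def[abs_def]
      using fun_cong[OF frechet_derivative_at[OF product_has_derivative[OF deriv_\<alpha> deriv_\<beta>, of z]], of \<i>]
      by simp
    define I where "I k = (LINT z:ball 0 1|lebesgue. (\<alpha> (Re z) * bk k (Im z)) *\<^sub>R u z)" for k
    define Sq where "Sq k = cbox (Complex a (y k)) (Complex (a + \<delta>) (y k + \<delta>))" for k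
    have Sq: "z \<in> Sq k \<longleftrightarrow> a \<le> Re z \<and> Re z \<le> a + \<delta> \<and> y k \<le> Im z \<and> Im z \<le> y k + \<delta>" for z k
      by (auto simp: Sq_def in_cbox_complex_iff)
    have g_out: "\<alpha> (Re z) * bk k (Im z) = 0" if "z \<notin> Sq k" for z k
      using that \<alpha>_out[of "Re z"] bk_out[of "Im z" k] by (force simp: Sq)
    have cont_g: "continuous_on UNIV (\<lambda>z. \<alpha> (Re z) * bk k (Im z))" for k
      unfolding \<alpha>_def bk_def using \<delta> by (intro continuous_intros) auto
    have int_I: "set_integrable lebesgue (ball 0 1) (\<lambda>z. (\<alpha> (Re z) * bk k (Im z)) *\<^sub>R f z)"
      if "k \<le> n" "continuous_on (ball 0 1) f" for k and f :: "complex \<Rightarrow> complex"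
      using that near(1)[OF that(1)] g_out
      by (intro set_integrable_cutoff[where K = "Sq k"] cont_g) (auto simp: Sq, auto simp: Sq_def)
    define m where "m = (\<delta> * \<kappa>)\<^sup>2"
    have m: "has_bochner_integral lebesgue (\<lambda>z. \<alpha> (Re z) * bk k (Im z)) m" for k
      unfolding \<alpha>_def bk_def m_def using \<delta> by (intro integral_rescaled_b2) auto
    have I_near: "cmod (I k - m *\<^sub>R u (p k)) \<le> m * e" if "k \<le> n" for k
    proof -
      have "I k - m *\<^sub>R u (p k) = (LINT z:ball 0 1|lebesgue. (\<alpha> (Re z) * bk k (Im z)) *\<^sub>R (u z - u (p k)))"
      proof -
        have "(LINT z:ball 0 1|lebesgue. (\<alpha> (Re z) * bk k (Im z)) *\<^sub>R u (p k))
           = (LINT z|lebesgue. (\<alpha> (Re z) * bk k (Im z)) *\<^sub>R u (p k))"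
          unfolding set_lebesgue_integral_def
          using g_out near(1)[OF that] by (intro Bochner_Integration.integral_cong) (auto simp: indicator_def Sq)
        also have "\<dots> = m *\<^sub>R u (p k)"
          using m[of k] by (simp add: has_bochner_integral_iff)
        finally show ?thesis unfolding I_def
          using set_integral_diff(2)[OF int_I[OF that cont] int_I[OF that continuous_on_const[of _ "u (p k)"]]]
          by (simp add: scaleR_diff_right)
      qed
      also have "cmod \<dots> \<le> (LINT z|lebesgue. \<alpha> (Re z) * bk k (Im z) * e)"
        unfolding set_lebesgue_integral_def
      proof (rule Bochner_Integration.integral_norm_bound_integral)
        show "integrable lebesgue (\<lambda>z. indicat_real (ball 0 1) z *\<^sub>R (\<alpha> (Re z) * bk k (Im z)) *\<^sub>R (u z - u (p k)))"
          using int_I[OF that continuous_on_diff[OF cont continuous_on_const]] unfolding set_integrable_def .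
        show "integrable lebesgue (\<lambda>z. \<alpha> (Re z) * bk k (Im z) * e)"
          using m[of k] by (simp add: has_bochner_integral_iff)
        fix z
        have nn: "0 \<le> \<alpha> (Re z) * bk k (Im z)" using b01 by (simp add: \<alpha>_def bk_def)
        show "cmod (indicat_real (ball 0 1) z *\<^sub>R (\<alpha> (Re z) * bk k (Im z)) *\<^sub>R (u z - u (p k))) \<le> \<alpha> (Re z) * bk k (Im z) * e"
        proof (cases "z \<in> Sq k")
          case True
          then have "cmod (u z - u (p k)) \<le> e" using near(2)[OF that, of z] by (auto simp: Sq dist_norm)
          moreover have "z \<in> ball 0 1" using True near(1)[OF that, of z] by (auto simp: Sq)
          ultimately show ?thesis using nn mult_left_mono[OF _ nn] by (simp add: abs_of_nonneg[OF nn] del: mem_ball abs_mult)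
        next
          case False then show ?thesis by (simp add: g_out[OF False] del: mult_eq_0_iff)
        qed
      qed
      also have "\<dots> = m * e" using m[of k] by (simp add: has_bochner_integral_iff)
      finally show ?thesis .
    qed
    define J where "J = (LINT z:ball 0 1|lebesgue. frechet_derivative \<psi> (at z) \<i> *\<^sub>R u z)"
    have J_eq: "J = (\<Sum>k<n. (sgn (V k) / \<delta>) *\<^sub>R (I k - I (Suc k)))"
    proof -
      define G where "G k z = indicat_real (ball 0 1) z *\<^sub>R (\<alpha> (Re z) * bk k (Im z)) *\<^sub>R u z" for k z
      have hb: "has_bochner_integral lebesgue (G k) (I k)" if "k \<le> n" for k
        using int_I[OF that cont] unfolding I_def set_lebesgue_integral_def set_integrable_def G_def[abs_def]
        by (rule has_bochner_integral_integrable)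
      have "has_bochner_integral lebesgue (\<lambda>z. \<Sum>k<n. (sgn (V k) / \<delta>) *\<^sub>R (G k z - G (Suc k) z))
         (\<Sum>k<n. (sgn (V k) / \<delta>) *\<^sub>R (I k - I (Suc k)))"
        using hb by (intro has_bochner_integral_sum has_bochner_integral_scaleR_right has_bochner_integral_diff) auto
      moreover have "(\<Sum>k<n. (sgn (V k) / \<delta>) *\<^sub>R (G k z - G (Suc k) z)) =
         indicat_real (ball 0 1) z *\<^sub>R frechet_derivative \<psi> (at z) \<i> *\<^sub>R u z" for z
        unfolding fd \<beta>'_def sum_distrib_left scaleR_sum_left scaleR_sum_right
      proof (rule sum.cong[OF refl])
        fix k
        have "indicat_real (ball 0 1) z * (\<alpha> (Re z) * (sgn (V k) * (bk k (Im z) / \<delta> - bk (Suc k) (Im z) / \<delta>)))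
           = sgn (V k) / \<delta> * (indicat_real (ball 0 1) z * (\<alpha> (Re z) * bk k (Im z)) - indicat_real (ball 0 1) z * (\<alpha> (Re z) * bk (Suc k) (Im z)))"
          by (simp add: algebra_simps diff_divide_distrib)
        then show "(sgn (V k) / \<delta>) *\<^sub>R (G k z - G (Suc k) z) =
          indicat_real (ball 0 1) z *\<^sub>R (\<alpha> (Re z) * (sgn (V k) * (bk k (Im z) / \<delta> - bk (Suc k) (Im z) / \<delta>))) *\<^sub>R u z"
          by (simp only: G_def scaleR_diff_left[symmetric] scaleR_scaleR)
      qed
      ultimately show ?thesis
        unfolding J_def set_lebesgue_integral_def by (simp only: has_bochner_integral_integral_eq)
    qed
    \<comment> \<open>\<open>I k\<close> is \<open>m * u (p k)\<close> up to \<open>m * e\<close>,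
      where \<open>m\<close> is the mass of the bump on one square. The signs
      \<open>sgn (V k)\<close> turn the differences into absolute values, each with an error of at
      most \<open>2 * e\<close>.\<close>
    have "(\<Sum>k<n. m / \<delta> * (\<bar>V k\<bar> - 2 * e)) \<le> - Im J"
      unfolding J_eq Im_sum sum_negf[symmetric]
    proof (rule sum_mono)
      fix k assume "k \<in> {..<n}"
      then have k: "k \<le> n" "Suc k \<le> n" by auto
      have i: "\<bar>Im (I k) - m * Im (u (p k))\<bar> \<le> m * e" "\<bar>Im (I (Suc k)) - m * Im (u (p (Suc k)))\<bar> \<le> m * e"
        using I_near[OF k(1)] I_near[OF k(2)] abs_Im_le_cmod[of "I k - m *\<^sub>R u (p k)"]
          abs_Im_le_cmod[of "I (Suc k) - m *\<^sub>R u (p (Suc k))"] by auto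
      have "m * (\<bar>V k\<bar> - 2 * e) \<le> sgn (V k) * (Im (I (Suc k)) - Im (I k))"
      proof -
        have mV: "m * V k = m * Im (u (p (Suc k))) - m * Im (u (p k))" by (simp only: V_def right_diff_distrib)
        have me: "m * (x - 2 * e) = m * x - 2 * (m * e)" for x by (simp only: right_diff_distrib mult.left_commute)
        consider "V k = 0" | "0 < V k" | "V k < 0" by linarith
        then show ?thesis
        proof cases
          case 1
          have "0 \<le> m * e" using e by (simp add: m_def)
          then show ?thesis unfolding me using 1 by simp
        next
          case 2
          then have "sgn (V k) = 1" "\<bar>V k\<bar> = V k" by auto
          then show ?thesis unfolding me using i mV by simp
        next
          case 3
          then have s: "sgn (V k) = -1" "\<bar>V k\<bar> = - V k" by auto
          have "m * (- V k) = - (m * V k)" by simp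
          then show ?thesis unfolding me s using i mV by simp
        qed
      qed
      then have "m * (\<bar>V k\<bar> - 2 * e) / \<delta> \<le> sgn (V k) * (Im (I (Suc k)) - Im (I k)) / \<delta>"
        using \<delta> by (intro divide_right_mono) auto
      also have "\<dots> = - Im ((sgn (V k) / \<delta>) *\<^sub>R (I k - I (Suc k)))"
        by (simp add: algebra_simps diff_divide_distrib)
      finally show "m / \<delta> * (\<bar>V k\<bar> - 2 * e) \<le> - Im ((sgn (V k) / \<delta>) *\<^sub>R (I k - I (Suc k)))" by simp
    qed
    moreover have "(\<Sum>k<n. m / \<delta> * (\<bar>V k\<bar> - 2 * e)) = m / \<delta> * ((\<Sum>k<n. \<bar>V k\<bar>) - 2 * real n * e)"
      by (simp only: sum_distrib_left[symmetric] sum_subtractf) simp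
    moreover have "m / \<delta> * ((\<Sum>k<n. \<bar>V k\<bar>) - \<epsilon>) \<le> m / \<delta> * ((\<Sum>k<n. \<bar>V k\<bar>) - 2 * real n * e)"
      using e \<delta> by (intro mult_left_mono) (auto simp: m_def)
    ultimately have lower: "m / \<delta> * ((\<Sum>k<n. \<bar>V k\<bar>) - \<epsilon>) \<le> - Im J" by linarith
    define S where "S = {z \<in> ball 0 1. a < Re z \<and> Re z < a + \<delta>}"
    have "S = ball 0 1 \<inter> {z. a < Re z} \<inter> {z. Re z < a + \<delta>}" by (auto simp: S_def)
    then have "open S" by (auto intro!: open_Int open_halfspace_Re_gt open_halfspace_Re_lt)
    then have S_meas: "S \<in> sets lebesgue" by auto
    have "S \<subseteq> ball 0 1" by (auto simp: S_def)
    have w_S: "set_integrable lebesgue S w" using w S_meas \<open>S \<subseteq> ball 0 1\<close> by (rule set_integrable_subset)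
    have "J = - (LINT z:ball 0 1|lebesgue. \<psi> z *\<^sub>R w z)"
      using weak test unfolding weak_partial_derivative_def J_def by blast
    then have "- Im J \<le> cmod (LINT z:ball 0 1|lebesgue. \<psi> z *\<^sub>R w z)"
      using abs_Im_le_cmod[of "(LINT z:ball 0 1|lebesgue. \<psi> z *\<^sub>R w z)"] by simp
    also have "\<dots> \<le> (LINT z|lebesgue. \<kappa> * (indicator S z * cmod (w z)))"
      unfolding set_lebesgue_integral_def
    proof (rule Bochner_Integration.integral_norm_bound_integral)
      show "integrable lebesgue (\<lambda>z. \<kappa> * (indicator S z * cmod (w z)))"
        using set_integrable_norm[OF w_S] unfolding set_integrable_def by simp
      have [measurable]: "\<psi> \<in> borel_measurable lebesgue"
        using Ck_function_product[OF smooth_\<alpha> smooth_\<beta>, of 0]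
        by (auto simp: \<psi>_def[abs_def] intro!: measurable_completion borel_measurable_continuous_onI)
      have bound: "cmod (indicat_real (ball 0 1) z *\<^sub>R \<psi> z *\<^sub>R w z) \<le> \<kappa> * (indicator S z * cmod (w z))" for z
      proof (cases "z \<in> S")
        case True
        have "\<bar>\<psi> z\<bar> \<le> \<kappa>"
          unfolding \<psi>_def abs_mult using \<alpha>01[of "Re z"] \<beta>_le[of "Im z"] kappa mult_mono[of "\<bar>\<alpha> (Re z)\<bar>" 1 "\<bar>\<beta> (Im z)\<bar>" \<kappa>] by auto
        then show ?thesis using True \<open>S \<subseteq> ball 0 1\<close> by (simp add: mult_right_mono del: mem_ball add: indicator_def)
      next
        case False
        then have "indicat_real (ball 0 1) z *\<^sub>R \<psi> z = 0"
          using \<alpha>_out[of "Re z"] by (cases "z \<in> ball 0 1") (auto simp: S_def \<psi>_def not_less)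
        then have "indicat_real (ball 0 1) z *\<^sub>R \<psi> z *\<^sub>R w z = 0"
          by (metis scaleR_scaleR scaleR_zero_left real_scaleR_def)
        then show ?thesis using False by (simp only: norm_zero) simp
      qed
      then show "\<And>z. cmod (indicat_real (ball 0 1) z *\<^sub>R \<psi> z *\<^sub>R w z) \<le> \<kappa> * (indicator S z * cmod (w z))" .
      show "integrable lebesgue (\<lambda>z. indicat_real (ball 0 1) z *\<^sub>R \<psi> z *\<^sub>R w z)"
      proof (rule Bochner_Integration.integrable_bound)
        show "integrable lebesgue (\<lambda>z. \<kappa> * (indicator S z * cmod (w z)))"
          using set_integrable_norm[OF w_S] unfolding set_integrable_def by simp
        have "(\<lambda>z. indicat_real (ball 0 1) z *\<^sub>R w z) \<in> borel_measurable lebesgue"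
          using w unfolding set_integrable_def by (rule borel_measurable_integrable)
        then have "(\<lambda>z. \<psi> z *\<^sub>R (indicat_real (ball 0 1) z *\<^sub>R w z)) \<in> borel_measurable lebesgue"
          by measurable
        then show "(\<lambda>z. indicat_real (ball 0 1) z *\<^sub>R \<psi> z *\<^sub>R w z) \<in> borel_measurable lebesgue"
          by (simp only: scaleR_left_commute)
        show "AE z in lebesgue. norm (indicat_real (ball 0 1) z *\<^sub>R \<psi> z *\<^sub>R w z) \<le> norm (\<kappa> * (indicator S z * cmod (w z)))"
          using bound by (intro AE_I2) (simp only: real_norm_def, blast intro: order_trans abs_ge_self)
      qed
    qed
    also have "\<dots> = \<kappa> * (LINT z:S|lebesgue. cmod (w z))"
      by (simp add: set_lebesgue_integral_def)
    finally have "m / \<delta> * ((\<Sum>k<n. \<bar>V k\<bar>) - \<epsilon>) \<le> \<kappa> * (LINT z:S|lebesgue. cmod (w z))"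
      using lower by linarith
    \<comment> \<open>One factor \<kappa> of the mass pays for the bound \<kappa> on the test
      function; the other remains in the conclusion.\<close>
    moreover have "m / \<delta> = \<kappa> * (\<kappa> * \<delta>)" using \<delta> by (simp add: m_def power2_eq_square)
    ultimately have "\<kappa> * (\<kappa> * \<delta> * ((\<Sum>k<n. \<bar>V k\<bar>) - \<epsilon>)) \<le> \<kappa> * (LINT z:S|lebesgue. cmod (w z))"
      by (simp add: mult.assoc)
    then show ?thesis using kappa by (simp add: V_def p_def S_def)
  qed
  then show ?thesis using \<delta>0(1) by blast
qed

end

text \<open>A continuation argument for an \<open>F\<close> that is merely monotone: upward jumps of
  \<open>F\<close> only help. The set of points where the inequality holds contains its supremum, by
  continuity of \<open>G\<close> and monotonicity of \<open>F\<close>, and the local step excludes a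
  supremum below \<open>b\<close>.\<close>

lemma increment_le_from_local:
  fixes F G :: "real \<Rightarrow> real"
  assumes mono: "\<And>x y. a \<le> x \<Longrightarrow> x \<le> y \<Longrightarrow> y \<le> b \<Longrightarrow> F x \<le> F y"
    and cont: "continuous_on {a..b} G" and "a \<le> b"
    and step: "\<And>x. a \<le> x \<Longrightarrow> x < b \<Longrightarrow> \<exists>d>0. x + d \<le> b \<and> G (x + d) - G x \<le> F (x + d) - F x"
  shows "G b - G a \<le> F b - F a"
proof -
  define S where "S = {x \<in> {a..b}. G x - G a \<le> F x - F a}"
  define s where "s = Sup S"
  have S: "a \<in> S" "bdd_above S" using \<open>a \<le> b\<close> by (auto simp: S_def)
  have "a \<le> s" unfolding s_def by (rule cSup_upper[OF S])
  moreover have "s \<le> b" unfolding s_def using S(1) by (intro cSup_least) (auto simp: S_def)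
  ultimately have s: "a \<le> s" "s \<le> b" by auto
  have "s \<in> S"
  proof (rule ccontr)
    assume "s \<notin> S"
    then have lt: "F s - F a < G s - G a" using s by (auto simp: S_def)
    obtain d where d: "d > 0" "\<And>x. x \<in> {a..b} \<Longrightarrow> dist x s < d \<Longrightarrow> dist (G x) (G s) < (G s - G a) - (F s - F a)"
    proof -
      have "s \<in> {a..b}" "0 < (G s - G a) - (F s - F a)" using s lt by auto
      then show ?thesis using cont that unfolding continuous_on_iff by blast
    qed
    obtain x where x: "x \<in> S" "s - d < x" using less_cSup_iff[of S "s - d"] S d by (auto simp: s_def)
    have "x \<le> s" using x S cSup_upper by (auto simp: s_def)
    then have "G x > F s - F a + G a" "F x \<le> F s"
      using d(2)[of x] x mono[of x s] s by (auto simp: S_def dist_real_def)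
    then show False using x by (auto simp: S_def)
  qed
  moreover have "s = b"
  proof (rule ccontr)
    assume "s \<noteq> b"
    then obtain d where d: "d > 0" "s + d \<le> b" "G (s + d) - G s \<le> F (s + d) - F s"
      using step[of s] s by auto
    then have "s + d \<in> S" using \<open>s \<in> S\<close> s by (auto simp: S_def)
    then show False using cSup_upper[of "s + d" S] S d by (auto simp: s_def)
  qed
  ultimately show ?thesis by (simp add: S_def)
qed

text \<open>The integral of \<open>\<bar>w\<bar>\<close> over the strip \<open>a0 < Re z < x\<close> would grow at least as fast as a multiple of
  \<open>- ln (1 - x)\<close>.\<close>

lemma not_sobolev_W11_if_oscillating:
  fixes u :: "complex \<Rightarrow> complex"
  assumes cont: "continuous_on (ball 0 1) u" and "0 \<le> a0" "a0 < 1"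
    and osc: "\<And>a. a0 \<le> a \<Longrightarrow> a < 1 \<Longrightarrow> \<exists>n y. (\<forall>k<n. y k \<le> y (Suc k)) \<and> (\<forall>k\<le>n. Complex a (y k) \<in> ball 0 1) \<and>
      1 / (1 - a) \<le> (\<Sum>k<n. \<bar>Im (u (Complex a (y (Suc k)))) - Im (u (Complex a (y k)))\<bar>)"
  shows "\<not> sobolev_W11 (ball 0 1) u"
proof
  assume "sobolev_W11 (ball 0 1) u"
  then obtain w where w: "set_integrable lebesgue (ball 0 1) w" "weak_partial_derivative (ball 0 1) \<i> u w"
    unfolding sobolev_W11_def by (auto simp: Basis_complex_def)
  obtain b B \<kappa> where "smooth_step b B \<kappa>" using smooth_step_exists by blast
  then interpret smooth_step b B \<kappa> .
  define S where "S p q = {z \<in> ball 0 1. p < Re z \<and> Re z < q}" for p q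
  have "open (S p q)" for p q
  proof -
    have "S p q = ball 0 1 \<inter> {z. p < Re z} \<inter> {z. Re z < q}" by (auto simp: S_def)
    then show ?thesis by (auto intro!: open_Int open_halfspace_Re_gt open_halfspace_Re_lt)
  qed
  then have S_meas: "S p q \<in> sets lebesgue" for p q by auto
  have w_S: "set_integrable lebesgue (S p q) (\<lambda>z. cmod (w z))" for p q
    by (rule set_integrable_subset[OF set_integrable_norm[OF w(1)] S_meas]) (auto simp: S_def)
  have mono: "(LINT z:P|lebesgue. cmod (w z)) \<le> (LINT z:Q|lebesgue. cmod (w z))"
    if "P \<subseteq> Q" "set_integrable lebesgue P (\<lambda>z. cmod (w z))" "set_integrable lebesgue Q (\<lambda>z. cmod (w z))" for P Q
    using that unfolding set_lebesgue_integral_def set_integrable_def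
    by (intro integral_mono) (auto simp: indicator_def)
  define F where "F x = (LINT z:S a0 x|lebesgue. cmod (w z))" for x
  have F_step: "F x + (LINT z:S x y|lebesgue. cmod (w z)) \<le> F y" if "a0 \<le> x" "x \<le> y" for x y
  proof -
    have "F x + (LINT z:S x y|lebesgue. cmod (w z)) = (LINT z:S a0 x \<union> S x y|lebesgue. cmod (w z))"
      unfolding F_def by (rule set_integral_Un[symmetric]) (use w_S in \<open>auto simp: S_def\<close>)
    also have "\<dots> \<le> F y"
      unfolding F_def by (rule mono) (use w_S that S_meas in \<open>auto simp: S_def intro!: set_integrable_Un\<close>)
    finally show ?thesis .
  qed
  have nonneg: "0 \<le> (LINT z:S x y|lebesgue. cmod (w z))" for x y
    unfolding set_lebesgue_integral_def by (intro integral_nonneg_AE) auto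
  define W where "W = (LINT z:ball 0 1|lebesgue. cmod (w z))"
  have F_le: "F x \<le> W" for x
    unfolding F_def W_def by (rule mono[OF _ w_S set_integrable_norm[OF w(1)]]) (auto simp: S_def)
  \<comment> \<open>The derivative of \<open>G\<close> is \<open>\<kappa> / (4 * (1 - x))\<close>.
    Compared with the variation \<open>1 / (1 - x)\<close>, one factor 2 is given up through
    \<epsilon>, the other in the logarithm estimate, where
    \<open>\<delta> \<le> (1 - x) / 2\<close>.\<close>
  define G where "G x = - (\<kappa> / 4) * ln (1 - x)" for x
  have incr: "G c - G a0 \<le> F c - F a0" if c: "a0 \<le> c" "c < 1" for c
  proof (rule increment_le_from_local[OF _ _ \<open>a0 \<le> c\<close>])
    show "F x \<le> F y" if "a0 \<le> x" "x \<le> y" for x y using F_step[OF that] nonneg[of x y] by linarith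
    show "continuous_on {a0..c} G" unfolding G_def using c by (intro continuous_intros) auto
    fix x assume x: "a0 \<le> x" "x < c"
    obtain n y where ny: "\<forall>k<n. y k \<le> y (Suc k)" "\<forall>k\<le>n. Complex x (y k) \<in> ball 0 1"
       "1 / (1 - x) \<le> (\<Sum>k<n. \<bar>Im (u (Complex x (y (Suc k)))) - Im (u (Complex x (y k)))\<bar>)"
      using osc[of x] x c by auto
    define \<epsilon> where "\<epsilon> = 1 / (2 * (1 - x))"
    have "0 < \<epsilon>" using x c by (simp add: \<epsilon>_def)
    obtain \<delta>0 where \<delta>0: "\<delta>0 > 0" "\<And>\<delta>. 0 < \<delta> \<Longrightarrow> \<delta> \<le> \<delta>0 \<Longrightarrow>
      \<kappa> * \<delta> * ((\<Sum>k<n. \<bar>Im (u (Complex x (y (Suc k)))) - Im (u (Complex x (y k)))\<bar>) - \<epsilon>) \<le> (LINT z:S x (x + \<delta>)|lebesgue. cmod (w z))"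
      using vertical_variation_le[OF w cont, of n y x \<epsilon>] ny \<open>0 < \<epsilon>\<close> unfolding S_def by blast
    define \<delta> where "\<delta> = min \<delta>0 (min (c - x) ((1 - x) / 2))"
    have "0 < \<delta> \<and> \<delta> \<le> \<delta>0 \<and> x + \<delta> \<le> c \<and> \<delta> \<le> (1 - x) / 2"
      using \<delta>0(1) x c unfolding \<delta>_def by (auto simp: min_def field_simps)
    then have \<delta>: "0 < \<delta>" "\<delta> \<le> \<delta>0" "x + \<delta> \<le> c" "\<delta> \<le> (1 - x) / 2" by auto
    define h where "h = 1 - x"
    have h: "0 < h" "\<delta> \<le> h / 2" "1 - (x + \<delta>) = h - \<delta>" "0 < h - \<delta>" using x c \<delta> by (auto simp: h_def)
    have "ln (h / (h - \<delta>)) = ln h - ln (h - \<delta>)" using h by (simp add: ln_div)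
    then have "G (x + \<delta>) - G x = \<kappa> / 4 * ln (h / (h - \<delta>))"
      unfolding G_def h(3) by (simp add: h_def[symmetric] right_diff_distrib)
    also have "\<dots> \<le> \<kappa> / 4 * (h / (h - \<delta>) - 1)"
      using kappa h by (intro mult_left_mono ln_le_minus_one) auto
    also have "h / (h - \<delta>) - 1 = \<delta> / (h - \<delta>)" using h by (simp add: field_simps)
    also have "\<kappa> / 4 * (\<delta> / (h - \<delta>)) \<le> \<kappa> / 4 * (\<delta> / (h / 2))"
      using kappa h \<delta> by (intro mult_left_mono divide_left_mono mult_pos_pos) auto
    also have "\<dots> = \<kappa> * \<delta> * (1 / (1 - x) - \<epsilon>)" using h by (simp add: \<epsilon>_def h_def[symmetric])
    also have "\<dots> \<le> \<kappa> * \<delta> * ((\<Sum>k<n. \<bar>Im (u (Complex x (y (Suc k)))) - Im (u (Complex x (y k)))\<bar>) - \<epsilon>)"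
      using ny(3) kappa \<delta> by (intro mult_left_mono) auto
    also have "\<dots> \<le> F (x + \<delta>) - F x"
      using \<delta>0(2)[OF \<delta>(1,2)] F_step[of x "x + \<delta>"] x \<delta> by auto
    finally show "\<exists>d>0. x + d \<le> c \<and> G (x + d) - G x \<le> F (x + d) - F x" using \<delta> by blast
  qed
  \<comment> \<open>Chosen so that \<open>G c - G a0\<close> equals
    \<open>\<bar>W - F a0\<bar> + 1\<close>, more than \<open>F\<close>, which stays below
    \<open>W\<close>, can grow.\<close>
  define c where "c = 1 - (1 - a0) * exp (- (4 / \<kappa>) * (\<bar>W - F a0\<bar> + 1))"
  define E where "E = exp (- (4 / \<kappa>) * (\<bar>W - F a0\<bar> + 1))"
  have "E \<le> 1" "0 < E" using kappa by (simp_all add: E_def)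
  moreover have "c = 1 - (1 - a0) * E" by (simp add: c_def E_def)
  ultimately have c: "a0 \<le> c" "c < 1" using \<open>a0 < 1\<close> mult_left_le[of E "1 - a0"] mult_pos_pos[of "1 - a0" E] by linarith+
  have lnc: "ln (1 - c) = ln (1 - a0) - (4 / \<kappa>) * (\<bar>W - F a0\<bar> + 1)"
    using \<open>a0 < 1\<close> by (simp add: c_def ln_mult)
  have "G c - G a0 = (\<kappa> / 4) * ((4 / \<kappa>) * (\<bar>W - F a0\<bar> + 1))"
  proof -
    have "- (k / 4) * (p - q) - - (k / 4) * p = k / 4 * q" for k p q :: real by (simp add: algebra_simps diff_divide_distrib)
    then show ?thesis unfolding G_def by (simp only: lnc)
  qed
  then have "G c - G a0 = \<bar>W - F a0\<bar> + 1" using kappa by simp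
  then show False using incr[OF c] F_le[of c] by linarith
qed

section \<open>Oscillating corridors\<close>

text \<open>The image of the open disc is open by invariance of domain, and its frontier lies in the
  image \<open>J\<close> of the circle. A component of the complement of \<open>J\<close> that meets
  the image cannot leave it, so the image lies inside \<open>J\<close>; conversely the inside of
  \<open>J\<close> is connected and does not meet that frontier, so it cannot leave the
  image.\<close>

lemma inside_image_sphere:
  fixes \<Psi> :: "complex \<Rightarrow> complex"
  assumes cont: "continuous_on (cball 0 1) \<Psi>" and inj: "inj_on \<Psi> (cball 0 1)"
  shows "inside (\<Psi> ` sphere 0 1) = \<Psi> ` ball 0 1" "frontier (\<Psi> ` ball 0 1) = \<Psi> ` sphere 0 1"
    "closure (\<Psi> ` ball 0 1) = \<Psi> ` cball 0 1" "open (\<Psi> ` ball 0 1)"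
proof -
  let ?J = "\<Psi> ` sphere 0 1" and ?O = "\<Psi> ` ball 0 1"
  have cont': "continuous_on (ball 0 1) \<Psi>" "continuous_on (sphere 0 1) \<Psi>"
    using cont by (auto intro: continuous_on_subset)
  have inj': "inj_on \<Psi> (ball 0 1)" "inj_on \<Psi> (sphere 0 1)"
    using inj by (auto intro: inj_on_subset)
  show "open ?O" using cont'(1) inj'(1) by (intro invariance_of_domain) auto
  have disj: "?O \<inter> ?J = {}"
  proof -
    have "?O \<inter> ?J = \<Psi> ` (ball 0 1 \<inter> sphere 0 1)"
      by (intro inj_on_image_Int[symmetric, OF inj]) auto
    also have "ball 0 1 \<inter> sphere 0 1 = ({} :: complex set)" by auto
    finally show ?thesis by simp
  qed
  have cl: "compact (\<Psi> ` cball 0 1)" using cont by (intro compact_continuous_image) auto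
  have sub: "closure ?O \<subseteq> \<Psi> ` cball 0 1" using cl by (intro closure_minimal) (auto simp: compact_imp_closed)
  have fr: "frontier ?O \<subseteq> ?J"
  proof -
    have "cball 0 1 = ball 0 1 \<union> sphere (0::complex) 1" by auto
    then show ?thesis using sub \<open>open ?O\<close> by (auto simp: frontier_def interior_open image_Un)
  qed
  have bdd: "bounded ?O" using compact_imp_bounded[OF cl] by (rule bounded_subset) auto
  have conn: "connected ?O" using cont'(1) by (intro connected_continuous_image) auto
  have "simple_path (\<Psi> \<circ> circlepath 0 1)"
    using cont' inj' by (intro simple_path_continuous_image) (auto simp: simple_path_circlepath)
  moreover have "pathfinish (\<Psi> \<circ> circlepath 0 1) = pathstart (\<Psi> \<circ> circlepath 0 1)"
    by (simp add: pathfinish_compose pathstart_compose)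
  ultimately have J: "connected (inside ?J)" "frontier (inside ?J) = ?J"
    using Jordan_inside_outside[of "\<Psi> \<circ> circlepath 0 1"] by (simp_all add: path_image_compose)
  have 1: "?O \<subseteq> inside ?J"
  proof
    fix x assume x: "x \<in> ?O"
    let ?C = "connected_component_set (- ?J) x"
    have xJ: "x \<in> - ?J" using x disj by auto
    have "?C \<subseteq> ?O"
    proof (rule ccontr)
      assume "\<not> ?C \<subseteq> ?O"
      moreover have "x \<in> ?C" using xJ by (simp add: connected_component_refl)
      ultimately have "?C \<inter> frontier ?O \<noteq> {}"
        using x by (intro connected_Int_frontier connected_connected_component) blast+
      moreover have "?C \<subseteq> - ?J" by (rule connected_component_subset)
      ultimately show False using fr by auto
    qed
    then show "x \<in> inside ?J" unfolding inside_def using xJ bdd bounded_subset by auto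
  qed
  have 2: "inside ?J \<subseteq> ?O"
  proof (rule ccontr)
    assume "\<not> inside ?J \<subseteq> ?O"
    moreover have "\<Psi> 0 \<in> ?O" by simp
    then have "inside ?J \<inter> ?O \<noteq> {}" using 1 by blast
    ultimately have "inside ?J \<inter> frontier ?O \<noteq> {}" using J(1) by (intro connected_Int_frontier) blast+
    then show False using fr inside_no_overlap[of ?J] by blast
  qed
  show "inside ?J = ?O" using 1 2 by auto
  then show "frontier ?O = ?J" using J(2) by simp
  then show "closure ?O = \<Psi> ` cball 0 1"
  proof -
    have "cball 0 1 = ball 0 1 \<union> sphere (0::complex) 1" by auto
    then show ?thesis using \<open>frontier ?O = ?J\<close> closure_Un_frontier[of ?O] by (simp add: image_Un)
  qed
qed

text \<open>\<open>g\<close> need not be monotone: each level is sought by the intermediate value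
  theorem after the time of the previous one. The strict inequalities at the ends keep all times in
  the open interval.\<close>

lemma increasing_crossing_times:
  fixes g :: "real \<Rightarrow> real"
  assumes cont: "continuous_on {y1..y2} g" and "y1 \<le> y2" and le: "\<And>k. k < n \<Longrightarrow> c k \<le> c (Suc k)"
    and rng: "\<And>k. k \<le> n \<Longrightarrow> g y1 < c k" "\<And>k. k \<le> n \<Longrightarrow> c k < g y2"
  shows "\<exists>y. (\<forall>k<n. y k \<le> y (Suc k)) \<and> (\<forall>k\<le>n. y1 < y k \<and> y k < y2 \<and> g (y k) = c k)"
  using le rng
proof (induction n)
  case 0
  obtain t where t: "y1 \<le> t" "t \<le> y2" "g t = c 0"
    using IVT'[of g y1 "c 0" y2] cont \<open>y1 \<le> y2\<close> "0.prems" by force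
  then have "y1 < t" "t < y2" using "0.prems"(2,3)[of 0] by (auto simp: less_le)
  then show ?case using t by (intro exI[of _ "\<lambda>_. t"]) auto
next
  case (Suc n)
  then obtain y where y: "\<forall>k<n. y k \<le> y (Suc k)" "\<forall>k\<le>n. y1 < y k \<and> y k < y2 \<and> g (y k) = c k"
    by (metis le_SucI less_SucI)
  have "y1 < y n" using y(2) by blast
  then have "continuous_on {y n..y2} g" using cont by (elim continuous_on_subset) auto
  moreover have "g (y n) \<le> c (Suc n)" using y Suc.prems(1)[of n] by auto
  moreover have "c (Suc n) < g y2" using Suc.prems by auto
  moreover have "y n < y2" using y by auto
  ultimately obtain t where t: "y n \<le> t" "t \<le> y2" "g t = c (Suc n)"
    using IVT'[of g "y n" "c (Suc n)" y2] by force
  then have "y1 < t" using \<open>y1 < y n\<close> by linarith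
  moreover have "t \<noteq> y2" using t(3) \<open>c (Suc n) < g y2\<close> by auto
  ultimately have "y1 < t" "t < y2" using t(2) by auto
  then show ?case using t y
    by (intro exI[of _ "y(Suc n := t)"]) (auto simp: less_Suc_eq le_Suc_eq)
qed

text \<open>At \<open>s = 0\<close> the convention \<open>1 / 0 = 0\<close> gives the continuous extension.\<close>

definition oscillation :: "real \<Rightarrow> real" where
  "oscillation s = s * sin (1 / s)"

lemma oscillation_le: "\<bar>oscillation s\<bar> \<le> \<bar>s\<bar>"
  using mult_left_le[of "\<bar>sin (1 / s)\<bar>" "\<bar>s\<bar>"] by (simp add: oscillation_def abs_mult)

lemma continuous_oscillation: "continuous_on UNIV oscillation"
  unfolding continuous_on_eq_continuous_at[OF open_UNIV]
proof
  fix s :: real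
  show "isCont oscillation s"
  proof (cases "s = 0")
    case True
    have "(oscillation \<longlongrightarrow> 0) (at 0)"
      by (rule Lim_null_comparison[of _ "\<lambda>s. \<bar>s\<bar>"])
         (use oscillation_le in \<open>auto intro!: tendsto_eq_intros\<close>)
    then show ?thesis using True by (simp add: isCont_def oscillation_def)
  next
    case False
    then show ?thesis unfolding oscillation_def[abs_def] by (intro continuous_intros) auto
  qed
qed

text \<open>The bound \<open>s / 4\<close> keeps the corridor thin compared with the amplitude
  \<open>s\<close> of its centre line, so that a curve inside has to follow the oscillations; with
  \<open>v 0 = 0\<close> each end closes up to a single point.\<close>

locale corridor =
  fixes v :: "real \<Rightarrow> real"
  assumes cont_v: "continuous_on {0..1} v"
    and v_pos: "\<And>s. 0 < s \<Longrightarrow> s \<le> 1 \<Longrightarrow> 0 < v s"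
    and v_le: "\<And>s. 0 \<le> s \<Longrightarrow> s \<le> 1 \<Longrightarrow> v s \<le> s / 4"
    and v_0: "v 0 = 0"
begin

definition domain :: "complex set" where
  "domain = {z. \<bar>Re z\<bar> < 1 \<and> \<bar>Im z - oscillation (1 - \<bar>Re z\<bar>)\<bar> < v (1 - \<bar>Re z\<bar>)}"

text \<open>At \<open>Re z = \<plusminus>1\<close> the quotient is \<open>0 / 0 = 0\<close>, and the width \<open>v 0\<close> vanishes there anyway.\<close>

definition chart :: "complex \<Rightarrow> complex" where
  "chart z = Complex (Re z) (oscillation (1 - \<bar>Re z\<bar>) + v (1 - \<bar>Re z\<bar>) * (Im z / sqrt (1 - (Re z)\<^sup>2)))"

lemma Re_chart [simp]: "Re (chart z) = Re z" by (simp add: chart_def)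

lemma disc_coords:
  assumes "z \<in> cball 0 1"
  shows "\<bar>Re z\<bar> \<le> 1" "\<bar>Im z\<bar> \<le> sqrt (1 - (Re z)\<^sup>2)"
proof -
  have "(cmod z)\<^sup>2 \<le> 1" using assms by (simp add: power_le_one)
  then have *: "(Im z)\<^sup>2 \<le> 1 - (Re z)\<^sup>2" by (simp add: cmod_power2)
  then show "\<bar>Im z\<bar> \<le> sqrt (1 - (Re z)\<^sup>2)" by (rule real_le_rsqrt[of "\<bar>Im z\<bar>", simplified])
  have "(Re z)\<^sup>2 \<le> 1" using * zero_le_power2[of "Im z"] by linarith
  then show "\<bar>Re z\<bar> \<le> 1" by (simp add: abs_square_le_1)
qed

lemma sqrt_pos_iff: "0 < sqrt (1 - x\<^sup>2) \<longleftrightarrow> \<bar>x\<bar> < 1"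
  by (simp add: abs_square_less_1)

lemma abs_ratio_le: "z \<in> cball 0 1 \<Longrightarrow> \<bar>Im z / sqrt (1 - (Re z)\<^sup>2)\<bar> \<le> 1"
  using divide_right_mono[OF disc_coords(2)[of z], of "\<bar>sqrt (1 - (Re z)\<^sup>2)\<bar>"] disc_coords(2)[of z]
  by (cases "sqrt (1 - (Re z)\<^sup>2) = 0") (simp_all del: mem_cball)

lemma continuous_v_abs: "continuous_on {z. \<bar>Re z\<bar> \<le> 1} (\<lambda>z. v (1 - \<bar>Re z\<bar>))"
  by (rule continuous_on_compose2[OF cont_v]) (auto intro!: continuous_intros)

text \<open>Only the points with \<open>\<bar>Re z\<bar> = 1\<close> are delicate: the quotient has
  no limit there, but it is bounded by 1 on the disc and multiplied by a width that tends to
  0.\<close>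

lemma continuous_chart: "continuous_on (cball 0 1) chart"
proof -
  define h where "h z = v (1 - \<bar>Re z\<bar>) * (Im z / sqrt (1 - (Re z)\<^sup>2))" for z
  have "continuous_on (cball 0 1) h"
    unfolding continuous_on_eq_continuous_within
  proof
    fix z :: complex assume z: "z \<in> cball 0 1"
    show "continuous (at z within cball 0 1) h"
    proof (cases "\<bar>Re z\<bar> < 1")
      case True
      have "continuous_on (cball 0 1 \<inter> {z. \<bar>Re z\<bar> < 1}) h"
        unfolding h_def by (intro continuous_intros continuous_on_subset[OF continuous_v_abs])
           (auto simp: abs_square_eq_1)
      then have "continuous (at z within (cball 0 1 \<inter> {z. \<bar>Re z\<bar> < 1})) h"
        using z True by (simp add: continuous_on_eq_continuous_within)
      moreover have "open {z. \<bar>Re z\<bar> < 1}" by (intro open_Collect_less continuous_intros)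
      then have "at z within (cball 0 1 \<inter> {z. \<bar>Re z\<bar> < 1}) = at z within cball 0 1"
        using True by (intro at_within_nhd[of z "{z. \<bar>Re z\<bar> < 1}"]) auto
      ultimately show ?thesis by simp
    next
      case False
      then have v0: "v (1 - \<bar>Re z\<bar>) = 0" using disc_coords(1)[OF z] v_0 by auto
      have "((\<lambda>w. v (1 - \<bar>Re w\<bar>)) \<longlongrightarrow> 0) (at z within cball 0 1)"
      proof -
        have "cball 0 1 \<subseteq> {z. \<bar>Re z\<bar> \<le> 1}" using disc_coords(1) by blast
        then have "continuous_on (cball 0 1) (\<lambda>w. v (1 - \<bar>Re w\<bar>))"
          by (rule continuous_on_subset[OF continuous_v_abs])
        then have "((\<lambda>w. v (1 - \<bar>Re w\<bar>)) \<longlongrightarrow> v (1 - \<bar>Re z\<bar>)) (at z within cball 0 1)"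
          using z unfolding continuous_on_def by blast
        then show ?thesis by (simp only: v0)
      qed
      then have "(h \<longlongrightarrow> 0) (at z within cball 0 1)"
      proof (rule Lim_null_comparison[rotated])
        show "\<forall>\<^sub>F w in at z within cball 0 1. norm (h w) \<le> v (1 - \<bar>Re w\<bar>)"
          unfolding eventually_at_filter
        proof (intro always_eventually allI impI)
          fix w :: complex assume w: "w \<noteq> z" "w \<in> cball 0 1"
          have "0 \<le> v (1 - \<bar>Re w\<bar>)"
            using v_pos[of "1 - \<bar>Re w\<bar>"] disc_coords(1)[OF w(2)] v_0 by (cases "\<bar>Re w\<bar> = 1") auto
          then show "norm (h w) \<le> v (1 - \<bar>Re w\<bar>)"
            using abs_ratio_le[OF w(2)] mult_left_le[of "\<bar>Im w / sqrt (1 - (Re w)\<^sup>2)\<bar>" "v (1 - \<bar>Re w\<bar>)"]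
            unfolding h_def real_norm_def abs_mult by simp
        qed
      qed
      then show ?thesis using v0 by (simp add: continuous_within h_def)
    qed
  qed
  then show ?thesis
    unfolding chart_def h_def[symmetric]
    by (intro continuous_intros continuous_on_compose2[OF continuous_oscillation]) auto
qed

lemma inj_chart: "inj_on chart (cball 0 1)"
proof (rule inj_onI)
  fix z w assume z: "z \<in> cball 0 1" and w: "w \<in> cball 0 1" and eq: "chart z = chart w"
  have re: "Re z = Re w" using arg_cong[OF eq, of Re] by simp
  show "z = w"
  proof (cases "\<bar>Re z\<bar> < 1")
    case True
    have "v (1 - \<bar>Re z\<bar>) \<noteq> 0" using v_pos[of "1 - \<bar>Re z\<bar>"] True by auto
    moreover have "sqrt (1 - (Re z)\<^sup>2) \<noteq> 0" using sqrt_pos_iff True by (metis less_irrefl)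
    ultimately have "Im z = Im w" using arg_cong[OF eq, of Im] re by (simp add: chart_def)
    then show ?thesis using re by (simp add: complex_eq_iff)
  next
    case False
    then have "\<bar>Re z\<bar> = 1" using disc_coords(1)[OF z] by simp
    then have "(Re z)\<^sup>2 = 1" by (simp add: abs_square_eq_1)
    then have "Im z = 0" "Im w = 0" using disc_coords(2)[OF z] disc_coords(2)[OF w] re by auto
    then show ?thesis using re by (simp add: complex_eq_iff)
  qed
qed

lemma chart_ball: "chart ` ball 0 1 = domain"
proof
  show "chart ` ball 0 1 \<subseteq> domain"
  proof clarify
    fix z :: complex assume z: "z \<in> ball 0 1"
    then have "(cmod z)\<^sup>2 < 1" by (simp add: abs_square_less_1)
    then have *: "(Im z)\<^sup>2 < 1 - (Re z)\<^sup>2" by (simp add: cmod_power2)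
    then have "(Re z)\<^sup>2 < 1" using zero_le_power2[of "Im z"] by linarith
    then have re: "\<bar>Re z\<bar> < 1" by (simp add: abs_square_less_1)
    have "\<bar>Im z\<bar> < sqrt (1 - (Re z)\<^sup>2)" using * by (metis real_less_rsqrt power2_abs)
    then have "\<bar>Im z / sqrt (1 - (Re z)\<^sup>2)\<bar> < 1" by (auto simp: divide_less_eq)
    moreover have "0 < v (1 - \<bar>Re z\<bar>)" using re by (intro v_pos) auto
    ultimately have "\<bar>v (1 - \<bar>Re z\<bar>)\<bar> * \<bar>Im z / sqrt (1 - (Re z)\<^sup>2)\<bar> < v (1 - \<bar>Re z\<bar>)"
      by (simp del: abs_divide)
    then have "\<bar>v (1 - \<bar>Re z\<bar>) * (Im z / sqrt (1 - (Re z)\<^sup>2))\<bar> < v (1 - \<bar>Re z\<bar>)"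
      by (simp only: abs_mult)
    then show "chart z \<in> domain" using re by (simp add: domain_def chart_def)
  qed
  show "domain \<subseteq> chart ` ball 0 1"
  proof
    fix z assume "z \<in> domain"
    then have z: "\<bar>Re z\<bar> < 1" "\<bar>Im z - oscillation (1 - \<bar>Re z\<bar>)\<bar> < v (1 - \<bar>Re z\<bar>)" by (auto simp: domain_def)
    define q where "q = sqrt (1 - (Re z)\<^sup>2)"
    have q: "q > 0" unfolding q_def using z(1) by (simp only: sqrt_pos_iff)
    define t where "t = (Im z - oscillation (1 - \<bar>Re z\<bar>)) / v (1 - \<bar>Re z\<bar>)"
    have v: "0 < v (1 - \<bar>Re z\<bar>)" using z by (intro v_pos) auto
    have t: "\<bar>t\<bar> < 1" using z v by (simp add: t_def)
    define w where "w = Complex (Re z) (t * q)"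
    have "(t * q)\<^sup>2 < q\<^sup>2" using t q by (simp add: power_mult_distrib abs_square_less_1)
    also have "q\<^sup>2 = 1 - (Re z)\<^sup>2" using z by (simp add: q_def abs_square_le_1)
    finally have "(cmod w)\<^sup>2 < 1" by (simp add: w_def cmod_power2)
    then have "w \<in> ball 0 1" by (simp add: abs_square_less_1)
    moreover have "chart w = z"
    proof -
      have "t * q / q = t" using q by simp
      moreover have "v (1 - \<bar>Re z\<bar>) * t = Im z - oscillation (1 - \<bar>Re z\<bar>)" using v by (simp add: t_def)
      ultimately show ?thesis by (simp add: chart_def w_def q_def[symmetric] del: times_divide_eq_left)
    qed
    ultimately show "z \<in> chart ` ball 0 1" by blast
  qed
qed

lemma Jordan_domain_domain: "Jordan_domain domain"
  unfolding Jordan_domain_def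
proof (intro exI conjI)
  show "sphere (0::complex) 1 homeomorphic chart ` sphere 0 1"
    by (rule homeomorphic_compact[OF compact_sphere continuous_on_subset[OF continuous_chart] refl inj_on_subset[OF inj_chart]])
       auto
  show "domain = inside (chart ` sphere 0 1)"
    using inside_image_sphere(1)[OF continuous_chart inj_chart] chart_ball by simp
qed

lemma open_domain: "open domain" and frontier_domain: "frontier domain = chart ` sphere 0 1"
  and closure_domain: "closure domain = chart ` cball 0 1"
  using inside_image_sphere[OF continuous_chart inj_chart] by (simp_all add: chart_ball)

lemma simply_connected_domain: "simply_connected domain"
proof -
  have "ball (0::complex) 1 homeomorphic domain"
    using invariance_of_domain_homeomorphic[of "ball 0 1" chart]
      continuous_on_subset[OF continuous_chart ball_subset_cball] inj_on_subset[OF inj_chart ball_subset_cball]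
    by (simp add: chart_ball)
  then show ?thesis
    using homeomorphic_simply_connected_eq convex_imp_simply_connected[OF convex_ball] by blast
qed

lemma domain_neq_UNIV: "domain \<noteq> UNIV"
proof
  assume "domain = UNIV"
  then have "2 \<in> domain" by blast
  then show False by (simp add: domain_def)
qed

lemma zero_level_in_domain: "Complex 0 (oscillation 1) \<in> domain"
  using v_pos[of 1] by (simp add: domain_def)

lemma closure_domain_bound:
  assumes "z \<in> closure domain"
  shows "\<bar>Im z - oscillation (1 - \<bar>Re z\<bar>)\<bar> \<le> (1 - \<bar>Re z\<bar>) / 4"
proof -
  obtain w where w: "w \<in> cball 0 1" "z = chart w" using assms closure_domain by auto
  have "v (1 - \<bar>Re w\<bar>) * \<bar>Im w / sqrt (1 - (Re w)\<^sup>2)\<bar> \<le> (1 - \<bar>Re w\<bar>) / 4 * 1"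
    using v_le[of "1 - \<bar>Re w\<bar>"] disc_coords(1)[OF w(1)] abs_ratio_le[OF w(1)] by (intro mult_mono) auto
  moreover have "0 \<le> v (1 - \<bar>Re w\<bar>)"
    using v_pos[of "1 - \<bar>Re w\<bar>"] disc_coords(1)[OF w(1)] v_0 by (cases "\<bar>Re w\<bar> = 1") auto
  ultimately show ?thesis unfolding w(2) chart_def by (simp add: abs_mult)
qed

end

section \<open>A boundary parametrization without extension\<close>

text \<open>The upper boundary arc is reparametrized so that the vertical chord at \<open>Re z = a\<close> joins the levels
  \<open>s = 1 - a\<close> and \<open>squeeze s\<close>; crossing the oscillations between them costs about
  \<open>ln (s / squeeze s)\<close>, which is a large multiple of \<open>1 / s\<close>.\<close>

definition squeeze :: "real \<Rightarrow> real" where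
  "squeeze s = s * exp (- 20 * (1 / s - 1))"

lemma squeeze_bounds: "0 < s \<Longrightarrow> 0 < squeeze s" "0 \<le> s \<Longrightarrow> s \<le> 1 \<Longrightarrow> 0 \<le> squeeze s \<and> squeeze s \<le> s"
proof -
  show "0 < s \<Longrightarrow> 0 < squeeze s" by (simp add: squeeze_def)
  show "0 \<le> squeeze s \<and> squeeze s \<le> s" if "0 \<le> s" "s \<le> 1"
  proof (cases "s = 0")
    case False
    then have "1 \<le> 1 / s" using that by auto
    then show ?thesis using that by (auto simp: squeeze_def intro!: mult_left_le)
  qed (simp add: squeeze_def)
qed

lemma squeeze_strict_mono:
  assumes "0 \<le> s" "s < t" shows "squeeze s < squeeze t"
proof (cases "s = 0")
  case True then show ?thesis using assms squeeze_bounds(1)[of t] by (simp add: squeeze_def)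
next
  case False
  then have "1 / t < 1 / s" using assms by (intro divide_strict_left_mono) auto
  then have "exp (- 20 * (1 / s - 1)) < exp (- 20 * (1 / t - 1))" by simp
  then show ?thesis unfolding squeeze_def using assms by (intro mult_strict_mono) auto
qed

lemma continuous_squeeze: "continuous_on {0..1} squeeze"
  unfolding continuous_on_eq_continuous_within
proof
  fix s :: real assume s: "s \<in> {0..1}"
  show "continuous (at s within {0..1}) squeeze"
  proof (cases "s = 0")
    case True
    have "(squeeze \<longlongrightarrow> 0) (at s within {0..1})"
    proof (rule Lim_null_comparison[of _ "\<lambda>x. x"])
      show "\<forall>\<^sub>F x in at s within {0..1}. norm (squeeze x) \<le> x"
        unfolding eventually_at_filter using squeeze_bounds(2) by (intro always_eventually) (auto simp: abs_le_iff intro: order_trans)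
      show "((\<lambda>x. x) \<longlongrightarrow> 0) (at s within {0..1})" using True tendsto_ident_at[of s] by simp
    qed
    then show ?thesis using True by (simp add: continuous_within squeeze_def)
  next
    case False
    have "isCont squeeze s" unfolding squeeze_def[abs_def] using False by (intro continuous_intros) auto
    then show ?thesis by (rule continuous_at_imp_continuous_at_within)
  qed
qed

text \<open>Only the end \<open>a = 1\<close> is distorted, through the level \<open>1 - a\<close>;
  the two pieces agree at 0 because \<open>squeeze 1 = 1\<close>.\<close>

definition stretch :: "real \<Rightarrow> real" where
  "stretch a = (if a \<le> 0 then a else 1 - squeeze (1 - a))"

lemma squeeze_0_1 [simp]: "squeeze 0 = 0" "squeeze 1 = 1" by (simp_all add: squeeze_def)

lemma continuous_stretch: "continuous_on {-1..1} stretch"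
proof -
  have "continuous_on {0..1} (\<lambda>a. 1 - squeeze (1 - a))"
    by (intro continuous_intros continuous_on_compose2[OF continuous_squeeze]) auto
  then have "continuous_on ({-1..0} \<union> {0..1}) stretch"
    unfolding stretch_def[abs_def] by (intro continuous_on_cases) (auto intro!: continuous_intros)
  moreover have "{-1..0} \<union> {0..1} = {-1..1::real}" by auto
  ultimately show ?thesis by simp
qed

lemma stretch_strict_mono:
  assumes "a < b" "b \<le> 1" shows "stretch a < stretch b"
proof -
  consider "b \<le> 0" | "a \<le> 0" "0 < b" | "0 < a" using assms by linarith
  then show ?thesis
  proof cases
    case 2
    have "squeeze (1 - b) < squeeze 1" using 2 assms by (intro squeeze_strict_mono) auto
    then show ?thesis using 2 by (simp add: stretch_def)
  next
    case 3
    have "squeeze (1 - b) < squeeze (1 - a)" using 3 assms by (intro squeeze_strict_mono) auto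
    then show ?thesis using 3 assms by (simp add: stretch_def)
  qed (use assms in \<open>auto simp: stretch_def\<close>)
qed

lemma stretch_ends [simp]: "stretch (-1) = -1" "stretch 1 = 1" by (simp_all add: stretch_def)

lemma stretch_abs_le:
  assumes "\<bar>a\<bar> \<le> 1" shows "\<bar>stretch a\<bar> \<le> 1"
proof (cases "a = 1 \<or> a = -1")
  case False
  then have "-1 < a" "a < 1" using assms by linarith+
  then have "-1 < stretch a" "stretch a < 1"
    using stretch_strict_mono[of "-1" a] stretch_strict_mono[of a 1] by auto
  then show ?thesis by linarith
qed auto

text \<open>\<open>chart\<close> preserves real parts, so under \<open>chart\<close> after
  \<open>twist\<close> the lower end of the chord over \<open>a\<close> keeps the real part
  \<open>a\<close>, while the upper end receives \<open>stretch a\<close>. The halves agree at the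
  two real points, which \<open>stretch\<close> fixes.\<close>

definition twist :: "complex \<Rightarrow> complex" where
  "twist z = (if 0 \<le> Im z then Complex (stretch (Re z)) (sqrt (1 - (stretch (Re z))\<^sup>2)) else z)"

lemma sphere_coords: "z \<in> sphere 0 1 \<longleftrightarrow> (Re z)\<^sup>2 + (Im z)\<^sup>2 = 1"
  by (simp add: cmod_def)

lemma sphere_abs_Re: "z \<in> sphere 0 1 \<Longrightarrow> \<bar>Re z\<bar> \<le> 1"
  using abs_Re_le_cmod[of z] by simp

lemma twist_sphere: "twist ` sphere 0 1 = sphere 0 1"
proof
  have "Complex (stretch a) (sqrt (1 - (stretch a)\<^sup>2)) \<in> sphere 0 1" if "\<bar>a\<bar> \<le> 1" for a
    using stretch_abs_le[OF that] by (simp only: sphere_coords) (simp add: abs_square_le_1)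
  then show "twist ` sphere 0 1 \<subseteq> sphere 0 1" using sphere_abs_Re unfolding twist_def by (auto simp del: mem_sphere_0)
  show "sphere 0 1 \<subseteq> twist ` sphere 0 1"
  proof
    fix z :: complex assume z: "z \<in> sphere 0 1"
    show "z \<in> twist ` sphere 0 1"
    proof (cases "0 \<le> Im z")
      case True
      obtain a where a: "-1 \<le> a" "a \<le> 1" "stretch a = Re z"
      proof -
        have "-1 \<le> Re z" "Re z \<le> 1" using sphere_abs_Re[OF z] by linarith+
        then show ?thesis using IVT'[of stretch "-1" "Re z" 1] continuous_stretch that by auto
      qed
      define w where "w = Complex a (sqrt (1 - a\<^sup>2))"
      have a2: "a\<^sup>2 \<le> 1" using a by (simp add: abs_square_le_1)
      then have "w \<in> sphere 0 1" unfolding sphere_coords by (simp add: w_def)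
      moreover have "1 - (Re z)\<^sup>2 = (Im z)\<^sup>2" using z unfolding sphere_coords by linarith
      then have "twist w = z" using a True a2 by (simp add: twist_def w_def complex_eq_iff)
      ultimately show ?thesis by blast
    next
      case False
      then have "twist z = z" by (simp add: twist_def)
      then show ?thesis using z by (metis imageI)
    qed
  qed
qed

lemma inj_twist: "inj_on twist (sphere 0 1)"
proof (rule inj_onI)
  fix z w assume z: "z \<in> sphere 0 1" and w: "w \<in> sphere 0 1" and eq: "twist z = twist w"
  have nn: "0 \<le> sqrt (1 - (stretch (Re z))\<^sup>2)" if "z \<in> sphere 0 1" for z
    using stretch_abs_le[OF sphere_abs_Re[OF that]] by (simp add: abs_square_le_1)
  consider "0 \<le> Im z" "0 \<le> Im w" | "0 \<le> Im z" "Im w < 0" | "Im z < 0" "0 \<le> Im w" | "Im z < 0" "Im w < 0" by linarith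
  then show "z = w"
  proof cases
    case 1
    then have "stretch (Re z) = stretch (Re w)" using arg_cong[OF eq, of Re] by (simp add: twist_def)
    then have "Re z = Re w"
      using stretch_strict_mono[of "Re z" "Re w"] stretch_strict_mono[of "Re w" "Re z"] sphere_abs_Re[OF z] sphere_abs_Re[OF w]
      by (metis abs_le_D1 less_irrefl linorder_neqE_linordered_idom)
    moreover have "(Im z)\<^sup>2 = (Im w)\<^sup>2" using z w \<open>Re z = Re w\<close> unfolding sphere_coords by simp
    then have "Im z = Im w" using 1 by simp
    ultimately show ?thesis by (rule complex_eqI)
  next
    case 2 then show ?thesis using arg_cong[OF eq, of Im] nn[OF z] by (simp add: twist_def)
  next
    case 3 then show ?thesis using arg_cong[OF eq, of Im] nn[OF w] by (simp add: twist_def)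
  next
    case 4 then show ?thesis using eq by (simp add: twist_def)
  qed
qed

lemma continuous_twist: "continuous_on (sphere 0 1) twist"
proof -
  let ?S = "sphere 0 1 \<inter> {z. 0 \<le> Im z}" and ?T = "sphere 0 1 \<inter> {z. Im z \<le> 0}"
  have "continuous_on ?S (\<lambda>z. stretch (Re z))"
    by (rule continuous_on_compose2[OF continuous_stretch])
       (use sphere_abs_Re in \<open>force intro!: continuous_intros simp del: mem_sphere_0 simp: abs_le_iff\<close>)+
  then have S: "continuous_on ?S (\<lambda>z. Complex (stretch (Re z)) (sqrt (1 - (stretch (Re z))\<^sup>2)))"
    by (intro continuous_intros)
  have "continuous_on (?S \<union> ?T) twist"
    unfolding twist_def[abs_def]
  proof (rule continuous_on_cases[OF _ _ S])
    show "closed ?S" "closed ?T"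
      by (auto intro!: closed_Int closed_Collect_le continuous_intros)
    show "continuous_on ?T (\<lambda>z. z)" by (intro continuous_intros)
    show "\<forall>z. z \<in> ?S \<and> \<not> 0 \<le> Im z \<or> z \<in> ?T \<and> 0 \<le> Im z \<longrightarrow>
        Complex (stretch (Re z)) (sqrt (1 - (stretch (Re z))\<^sup>2)) = z"
    proof (intro allI impI)
      fix z :: complex assume "z \<in> ?S \<and> \<not> 0 \<le> Im z \<or> z \<in> ?T \<and> 0 \<le> Im z"
      then have z: "z \<in> sphere 0 1" "Im z = 0" by auto
      then have "(Re z)\<^sup>2 = 1" unfolding sphere_coords by simp
      then have "Re z = 1 \<or> Re z = -1" by (simp add: power2_eq_1_iff)
      then show "Complex (stretch (Re z)) (sqrt (1 - (stretch (Re z))\<^sup>2)) = z"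
        using z(2) by (auto simp: complex_eq_iff)
    qed
  qed
  moreover have "?S \<union> ?T = sphere 0 1" by auto
  ultimately show ?thesis by simp
qed

section \<open>Chords that have to cross the oscillations\<close>

lemma sin_half_odd: "sin (pi * (real k + 1/2)) = (-1) ^ k"
proof -
  have "pi * (real k + 1/2) = pi / 2 + real k * pi" by (simp add: algebra_simps)
  then show ?thesis by (simp add: sin_add)
qed

text \<open>The unperturbed heights \<open>p * e\<close> and \<open>- q * e\<close> have opposite
  signs and differ by \<open>p + q\<close>; the errors remove at most a quarter of this, and three
  quarters of \<open>p + q\<close> exceed \<open>q\<close>.\<close>

lemma alternating_gap:
  fixes p q h h' e :: real
  assumes "\<bar>h - p * e\<bar> \<le> p / 4" "\<bar>h' + q * e\<bar> \<le> q / 4" "q \<le> p" "0 < q" "e = 1 \<or> e = -1"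
  shows "q \<le> \<bar>h' - h\<bar>"
  using assms(5)
proof
  assume "e = 1"
  then have "h - p \<ge> - (p / 4)" "h' + q \<le> q / 4" using assms(1,2) unfolding abs_le_iff by auto
  then have "q \<le> h - h'" using assms by linarith
  then show ?thesis by linarith
next
  assume "e = -1"
  then have "h + p \<le> p / 4" "h' - q \<ge> - (q / 4)" using assms(1,2) unfolding abs_le_iff by auto
  then have "q \<le> h' - h" using assms by linarith
  then show ?thesis by linarith
qed

lemma ln_ratio_le_sum:
  assumes "0 < x"
  shows "ln ((x + real n) / x) \<le> (\<Sum>k<n. 1 / (x + real k))"
proof (induction n)
  case 0 then show ?case using assms by simp
next
  case (Suc n)
  have "ln ((x + real (Suc n)) / x) = ln ((x + real n) / x * (1 + 1 / (x + real n)))"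
  proof -
    have "(N + 1) / x = N / x * (1 + 1 / N)" if "0 < N" for N using that assms by (simp add: field_simps)
    from this[of "x + real n"] show ?thesis using assms by (simp add: add_ac)
  qed
  also have "\<dots> = ln ((x + real n) / x) + ln (1 + 1 / (x + real n))"
    using assms by (intro ln_mult_pos) (auto intro!: add_pos_nonneg)
  also have "ln (1 + 1 / (x + real n)) \<le> 1 / (x + real n)"
    using assms by (intro ln_add_one_self_le_self) auto
  finally show ?case using Suc by simp
qed

context corridor
begin

text \<open>The ends of the chord go to the levels \<open>1 / A\<close> and \<open>1 / A'\<close>.
  In between lie the levels \<open>s k\<close> at which \<open>sin (1 / s)\<close> is alternately 1
  and -1; the real part of \<Phi> meets them in order, and the thin corridor then forces the
  imaginary part to alternate. The jumps form a harmonic sum of size about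
  \<open>ln (A' / A) / pi\<close>.\<close>

lemma oscillating_chord:
  fixes \<Phi> :: "complex \<Rightarrow> complex"
  assumes cont: "continuous_on (cball 0 1) \<Phi>" and im: "\<Phi> ` cball 0 1 \<subseteq> closure domain"
    and bd: "\<And>z. z \<in> sphere 0 1 \<Longrightarrow> \<Phi> z = chart (twist z)" and a: "1/2 \<le> a" "a < 1"
  shows "\<exists>n y. (\<forall>k<n. y k \<le> y (Suc k)) \<and> (\<forall>k\<le>n. Complex a (y k) \<in> ball 0 1) \<and>
      1 / (1 - a) \<le> (\<Sum>k<n. \<bar>Im (\<Phi> (Complex a (y (Suc k)))) - Im (\<Phi> (Complex a (y k)))\<bar>)"
proof -
  define A where "A = 1 / (1 - a)"
  have A: "2 \<le> A" "1 - a = 1 / A" using a by (auto simp: A_def field_simps)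
  define A' where "A' = A * exp (20 * (A - 1))"
  have A': "0 < A'" "1 - stretch a = 1 / A'"
  proof -
    show "0 < A'" using A by (simp add: A'_def)
    have "1 - stretch a = squeeze (1 / A)" using a A(2) by (simp add: stretch_def)
    also have "\<dots> = 1 / A'" by (simp add: squeeze_def A'_def exp_minus right_diff_distrib divide_inverse exp_diff)
    finally show "1 - stretch a = 1 / A'" .
  qed
  have expA: "20 * A - 19 \<le> exp (20 * (A - 1))" using exp_ge_add_one_self[of "20 * (A - 1)"] by simp
  have AA': "21 * A \<le> A'"
    unfolding A'_def using A expA mult_left_mono[of 21 "exp (20 * (A - 1))" A] by simp
  \<comment> \<open>\<open>m\<close> and \<open>M\<close> index the outermost extremal levels used:
    \<open>A < pi * (m + 1/2)\<close> and \<open>pi * (M + 1/2) < A'\<close>. The subtraction in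
    \<open>M\<close> leaves the room for the second inequality and is genuine because
    \<open>A' / pi \<ge> 1\<close>.\<close>
  define m where "m = nat \<lceil>A / pi\<rceil>"
  define M where "M = nat \<lfloor>A' / pi\<rfloor> - 1"
  have m: "A \<le> pi * real m" "pi * (real m + 3/2) \<le> A + 10"
  proof -
    have "A / pi \<le> real m" "real m \<le> A / pi + 1" using A by (auto simp: m_def)
    then show "A \<le> pi * real m" "pi * (real m + 3/2) \<le> A + 10"
      using pi_less_4 by (auto simp: field_simps)
  qed
  have M: "pi * (real M + 1) \<le> A'" "A' \<le> pi * (real M + 2)"
  proof -
    have "pi \<le> A'" using AA' A pi_less_4 by linarith
    then have "1 \<le> A' / pi" by simp
    then have "real M + 1 \<le> A' / pi" "A' / pi \<le> real M + 2" unfolding M_def by linarith+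
    then show "pi * (real M + 1) \<le> A'" "A' \<le> pi * (real M + 2)" by (simp_all add: field_simps)
  qed
  have "pi * (real M + 3/2) \<ge> A' / 2"
  proof -
    have "A' / 2 \<ge> pi / 2" using AA' A pi_less_4 by linarith
    then show ?thesis using M(2) by (simp add: algebra_simps)
  qed
  have "A' / 2 / (A + 10) \<le> (pi * (real M + 3/2)) / (pi * (real m + 3/2))"
    using \<open>pi * (real M + 3/2) \<ge> A' / 2\<close> m(2) A A'(1) by (intro frac_le) auto
  then have ratio: "A' / 2 / (A + 10) \<le> (real M + 3/2) / (real m + 3/2)" by simp
  \<comment> \<open>The 12 arises from \<open>A + 10 \<le> 6 * A\<close>, valid since
    \<open>A \<ge> 2\<close>.\<close>
  have "exp (20 * (A - 1)) / 12 \<le> A' / 2 / (A + 10)"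
    using A by (simp add: A'_def field_simps)
  with ratio have ratio': "exp (20 * (A - 1)) / 12 \<le> (real M + 3/2) / (real m + 3/2)" by linarith
  have "1 < exp (20 * (A - 1)) / 12" using expA A by simp
  then have "1 < (real M + 3/2) / (real m + 3/2)" using ratio' by linarith
  then have "real m + 3/2 < real M + 3/2" by (subst (asm) less_divide_eq_1_pos) auto
  then have "m \<le> M" by simp
  define n where "n = M - m"
  define s where "s k = 1 / (pi * (real (m + k) + 1/2))" for k
  have s_pos: "0 < s k" for k by (auto simp: s_def intro!: mult_pos_pos add_nonneg_pos)
  have s_decr: "s (Suc k) \<le> s k" for k
    unfolding s_def by (intro divide_left_mono mult_left_mono mult_pos_pos add_nonneg_pos) auto
  have s_lt: "s k < 1 - a" for k
  proof -
    have "A < pi * (real (m + k) + 1/2)"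
    proof -
      have "pi * real m < pi * (real (m + k) + 1/2)" by (intro mult_strict_left_mono) auto
      then show ?thesis using m(1) by linarith
    qed
    then show ?thesis unfolding A s_def using A by (intro divide_strict_left_mono mult_pos_pos) auto
  qed
  have s_gt: "1 - stretch a < s k" if "k \<le> n" for k
  proof -
    have "pi * (real (m + k) + 1/2) < pi * (real M + 1)"
      using that \<open>m \<le> M\<close> by (intro mult_strict_left_mono) (auto simp: n_def)
    then have "pi * (real (m + k) + 1/2) < A'" using M(1) by linarith
    then show ?thesis unfolding A' s_def
      by (intro divide_strict_left_mono mult_pos_pos A'(1)) (auto intro!: add_nonneg_pos)
  qed
  define c0 where "c0 = sqrt (1 - a\<^sup>2)"
  have a2: "a\<^sup>2 < 1" using a by (simp add: abs_square_less_1)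
  have c0: "0 < c0" "c0\<^sup>2 = 1 - a\<^sup>2" using a2 by (auto simp: c0_def)
  have chord_ball: "Complex a t \<in> ball 0 1" if "-c0 < t" "t < c0" for t
  proof -
    have "t\<^sup>2 < c0\<^sup>2" using that power_strict_mono[of "\<bar>t\<bar>" c0 2] by simp
    then have "(cmod (Complex a t))\<^sup>2 < 1" using c0 by (simp add: cmod_power2)
    then show ?thesis by (simp add: abs_square_less_1)
  qed
  have ends: "Complex a c0 \<in> sphere 0 1" "Complex a (- c0) \<in> sphere 0 1"
    unfolding sphere_coords using c0 by auto
  define g where "g t = Re (\<Phi> (Complex a t))" for t
  have "continuous_on {-c0..c0} g"
    unfolding g_def
  proof (intro continuous_intros continuous_on_compose2[OF cont])
    show "Complex a ` {- c0..c0} \<subseteq> cball 0 1"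
    proof clarify
      fix t assume "t \<in> {-c0..c0}"
      then consider "t = c0" | "t = - c0" | "-c0 < t" "t < c0" by force
      then show "Complex a t \<in> cball 0 1" using ends chord_ball by cases (auto simp: less_imp_le)
    qed
  qed
  moreover have "g (-c0) = a" "g c0 = stretch a"
    unfolding g_def using bd ends c0(1) by (auto simp: twist_def)
  ultimately have "\<exists>y. (\<forall>k<n. y k \<le> y (Suc k)) \<and> (\<forall>k\<le>n. - c0 < y k \<and> y k < c0 \<and> g (y k) = 1 - s k)"
    using c0(1) s_decr s_lt s_gt by (intro increasing_crossing_times) (auto simp: algebra_simps)
  then obtain y where y: "\<forall>k<n. y k \<le> y (Suc k)" "\<And>k. k \<le> n \<Longrightarrow> - c0 < y k \<and> y k < c0 \<and> g (y k) = 1 - s k"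
    by blast
  define h where "h k = Im (\<Phi> (Complex a (y k)))" for k
  have h: "\<bar>h k - s k * (-1) ^ (m + k)\<bar> \<le> s k / 4" if "k \<le> n" for k
  proof -
    have "Complex a (y k) \<in> cball 0 1" using chord_ball y(2)[OF that] by (auto intro: less_imp_le)
    then have "\<Phi> (Complex a (y k)) \<in> closure domain" using im by blast
    moreover have "Re (\<Phi> (Complex a (y k))) = 1 - s k" using y(2)[OF that] by (simp add: g_def)
    moreover have "1 - \<bar>1 - s k\<bar> = s k" using s_lt[of k] s_pos[of k] a by auto
    moreover have "oscillation (s k) = s k * (-1) ^ (m + k)"
      unfolding oscillation_def by (simp add: s_def sin_half_odd del: of_nat_add)
    ultimately show ?thesis using closure_domain_bound[of "\<Phi> (Complex a (y k))"] by (simp add: h_def)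
  qed
  have step: "s (Suc k) \<le> \<bar>h (Suc k) - h k\<bar>" if "k < n" for k
  proof -
    have "\<bar>h k - s k * (-1) ^ (m + k)\<bar> \<le> s k / 4" "\<bar>h (Suc k) + s (Suc k) * (-1) ^ (m + k)\<bar> \<le> s (Suc k) / 4"
      using h[of k] h[of "Suc k"] that by auto
    moreover obtain e :: real where "e = (-1) ^ (m + k)" "e = 1 \<or> e = -1"
      by (metis power_minus1_even power_minus1_odd neg_one_even_power neg_one_odd_power)
    ultimately have *: "\<bar>h k - s k * e\<bar> \<le> s k / 4" "\<bar>h (Suc k) + s (Suc k) * e\<bar> \<le> s (Suc k) / 4" by simp_all
    then show ?thesis using alternating_gap[OF _ _ s_decr s_pos \<open>e = 1 \<or> e = -1\<close>] by blast
  qed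
  have "A \<le> (\<Sum>k<n. s (Suc k))"
  proof -
    \<comment> \<open>Here the constant 20 in \<open>squeeze\<close> is spent:
      \<open>20 * (A - 1)\<close> must cover \<open>pi * A\<close> and the loss
      \<open>ln 12 \<le> 11\<close> for all \<open>A \<ge> 2\<close>.\<close>
    have "pi * A \<le> 4 * A" using pi_less_4 A by (intro mult_right_mono) auto
    also have "\<dots> \<le> 20 * (A - 1) - 11" using A by simp
    also have "\<dots> \<le> 20 * (A - 1) - ln 12" using ln_le_minus_one[of "12::real"] by simp
    also have "\<dots> = ln (exp (20 * (A - 1)) / 12)" by (simp add: ln_div)
    also have "\<dots> \<le> ln ((real M + 3/2) / (real m + 3/2))"
      using ratio' by (intro ln_mono) auto
    also have "(real M + 3/2) / (real m + 3/2) = ((real m + 3/2) + real n) / (real m + 3/2)"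
      using \<open>m \<le> M\<close> by (simp add: n_def)
    also have "ln \<dots> \<le> (\<Sum>k<n. 1 / ((real m + 3/2) + real k))" by (rule ln_ratio_le_sum) auto
    also have "\<dots> = (\<Sum>k<n. pi * s (Suc k))"
      by (intro sum.cong refl) (simp add: s_def add_ac)
    finally have "pi * A \<le> pi * (\<Sum>k<n. s (Suc k))" by (simp add: sum_distrib_left)
    then show ?thesis by simp
  qed
  also have "\<dots> \<le> (\<Sum>k<n. \<bar>h (Suc k) - h k\<bar>)" using step by (intro sum_mono) auto
  finally have "1 / (1 - a) \<le> (\<Sum>k<n. \<bar>h (Suc k) - h k\<bar>)" by (simp add: A_def)
  moreover have "\<forall>k\<le>n. Complex a (y k) \<in> ball 0 1" using y(2) chord_ball by blast
  ultimately show ?thesis using y(1) unfolding h_def by (intro exI[of _ n] exI[of _ y]) blast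
qed

theorem parametrization_without_extension:
  "\<exists>\<psi>. homeomorphic_parametrization domain \<psi> \<and> \<not> (\<exists>\<Psi>. homeomorphic_W11_extension domain \<psi> \<Psi>)"
proof (intro exI conjI)
  have cont: "continuous_on (sphere 0 1) (chart \<circ> twist)"
    using continuous_twist twist_sphere
    by (intro continuous_on_compose continuous_on_subset[OF continuous_chart]) auto
  have inj: "inj_on (chart \<circ> twist) (sphere 0 1)"
    using inj_twist twist_sphere by (intro comp_inj_on inj_on_subset[OF inj_chart]) auto
  show "homeomorphic_parametrization domain (chart \<circ> twist)"
    unfolding homeomorphic_parametrization_def frontier_domain
    by (rule homeomorphism_compact[OF compact_sphere cont _ inj])
       (simp only: image_comp[symmetric] twist_sphere)
  show "\<not> (\<exists>\<Psi>. homeomorphic_W11_extension domain (chart \<circ> twist) \<Psi>)"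
  proof
    assume "\<exists>\<Psi>. homeomorphic_W11_extension domain (chart \<circ> twist) \<Psi>"
    then obtain \<Psi> \<Psi>' where \<Psi>: "homeomorphism (cball 0 1) (closure domain) \<Psi> \<Psi>'"
      "\<And>z. z \<in> sphere 0 1 \<Longrightarrow> \<Psi> z = chart (twist z)" "sobolev_W11 (ball 0 1) \<Psi>"
      unfolding homeomorphic_W11_extension_def by auto
    have c: "continuous_on (cball 0 1) \<Psi>" "\<Psi> ` cball 0 1 \<subseteq> closure domain"
      using \<Psi>(1) by (auto simp: homeomorphism_def)
    have "\<not> sobolev_W11 (ball 0 1) \<Psi>"
    proof (rule not_sobolev_W11_if_oscillating[of _ "1/2"])
      show "continuous_on (ball 0 1) \<Psi>" using c(1) by (rule continuous_on_subset) auto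
    qed (use oscillating_chord[OF c \<Psi>(2)] in auto)
    then show False using \<Psi>(3) by blast
  qed
qed

end

section \<open>The width of the corridor\<close>

lemma bounded_mono_tendsto_at_top:
  fixes f :: "real \<Rightarrow> real"
  assumes mono: "\<And>s t. 0 \<le> s \<Longrightarrow> s \<le> t \<Longrightarrow> f s \<le> f t" and bdd: "\<And>t. 0 \<le> t \<Longrightarrow> f t \<le> C"
  shows "\<exists>l. (f \<longlongrightarrow> l) at_top"
proof
  have bdd: "bdd_above (f ` {0..})" using bdd by (auto intro!: bdd_aboveI)
  show "(f \<longlongrightarrow> (SUP t\<in>{0..}. f t)) at_top"
  proof (rule order_tendstoI)
    fix y assume "y < (SUP t\<in>{0..}. f t)"
    then obtain t where "0 \<le> t" "y < f t" using bdd by (auto simp: less_cSUP_iff)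
    then show "\<forall>\<^sub>F x in at_top. y < f x"
      using mono[of t] by (auto simp: eventually_at_top_linorder intro!: exI[of _ t] intro: less_le_trans)
  next
    fix y assume y: "(SUP t\<in>{0..}. f t) < y"
    have "f t < y" if "0 \<le> t" for t using that bdd y cSUP_upper[of t "{0..}" f] by auto
    then show "\<forall>\<^sub>F x in at_top. f x < y"
      by (auto simp: eventually_at_top_linorder)
  qed
qed

text \<open>Rounding \<open>c\<close> up to a power \<open>2 ^ k \<le> 2 * c\<close> costs
  \<open>k\<close> doublings. With the doubling constant written as \<open>2 ^ p\<close>, their
  product is \<open>(2 ^ k) ^ p\<close>, a power of the scale.\<close>

lemma doubling_power_bound:
  fixes \<phi> :: "real \<Rightarrow> real"
  assumes nonneg: "\<And>t. 0 \<le> t \<Longrightarrow> 0 \<le> \<phi> t" and mono: "\<And>s t. 0 \<le> s \<Longrightarrow> s \<le> t \<Longrightarrow> \<phi> s \<le> \<phi> t"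
    and doubling: "\<And>t. 0 \<le> t \<Longrightarrow> \<phi> (2 * t) \<le> 2 ^ p * \<phi> t" and "1 \<le> c" "0 \<le> x"
  shows "\<phi> (c * x) \<le> (2 * c) ^ p * \<phi> x"
proof -
  have pow: "\<phi> (2 ^ k * x) \<le> (2 ^ k) ^ p * \<phi> x" for k
  proof (induction k)
    case (Suc k)
    have "\<phi> (2 ^ Suc k * x) \<le> 2 ^ p * \<phi> (2 ^ k * x)"
      using doubling[of "2 ^ k * x"] \<open>0 \<le> x\<close> by (simp add: mult.assoc)
    also have "\<dots> \<le> 2 ^ p * ((2 ^ k) ^ p * \<phi> x)" using Suc by (intro mult_left_mono) auto
    finally show ?case by (simp add: power_mult_distrib mult.assoc)
  qed simp
  obtain n where n: "c < 2 ^ n" using real_arch_pow[of 2 c] by auto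
  define k where "k = (LEAST n. c < 2 ^ n)"
  have k: "c < 2 ^ k" unfolding k_def using n by (rule LeastI)
  then have "k \<noteq> 0" using \<open>1 \<le> c\<close> by (intro notI) auto
  then have "\<not> c < 2 ^ (k - 1)" using not_less_Least[of "k - 1" "\<lambda>n. c < 2 ^ n"] by (auto simp: k_def)
  then have k': "2 ^ k \<le> 2 * c" using \<open>k \<noteq> 0\<close> by (cases k) auto
  have "\<phi> (c * x) \<le> \<phi> (2 ^ k * x)" using k \<open>1 \<le> c\<close> \<open>0 \<le> x\<close> by (intro mono mult_right_mono) auto
  also have "\<dots> \<le> (2 ^ k) ^ p * \<phi> x" by (rule pow)
  also have "\<dots> \<le> (2 * c) ^ p * \<phi> x" using k' nonneg[OF \<open>0 \<le> x\<close>] by (intro mult_right_mono power_mono) auto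
  finally show ?thesis .
qed

text \<open>\<open>\<Phi> t\<close> is the mean of \<open>4 (\<phi> u + 1 + u)\<close> over \<open>t \<le> u \<le> 2 t + 1\<close>.  Adding the linear term keeps
  \<open>\<integral>1/\<Phi>\<close> divergent: either \<open>\<phi> u \<ge> u\<close> eventually, or \<open>\<phi> t < t\<close> for arbitrarily large \<open>t\<close>, and then each
  \<open>[t/2, t]\<close> contributes a fixed amount.\<close>

lemma regular_majorant:
  fixes \<phi> :: "real \<Rightarrow> real"
  assumes nonneg: "\<And>t. t \<ge> 0 \<Longrightarrow> \<phi> t \<ge> 0"
    and cont: "continuous_on {0..} \<phi>"
    and smono: "strict_mono_on {0..} \<phi>"
    and M: "M > 0" "\<And>s t. s \<ge> 0 \<Longrightarrow> t \<ge> 0 \<Longrightarrow> \<phi> (s + t) \<le> M * (\<phi> s + \<phi> t)"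
    and diverges: "(\<integral>\<^sup>+s\<in>{1..}. ennreal (1 / \<phi> s) \<partial>lebesgue) = \<infinity>"
  obtains \<Phi> \<Phi>' L K where
    "\<And>t. 0 \<le> t \<Longrightarrow> (\<Phi> has_real_derivative \<Phi>' t) (at t)"
    "\<And>t. 0 \<le> t \<Longrightarrow> \<phi> t \<le> \<Phi> t" "\<And>t. 0 \<le> t \<Longrightarrow> 4 * (1 + t) \<le> \<Phi> t"
    "\<And>t. 0 \<le> t \<Longrightarrow> \<bar>\<Phi>' t\<bar> \<le> K * \<Phi> t / (1 + t)"
    "L 0 = 1" "\<And>t. 0 \<le> t \<Longrightarrow> (L has_real_derivative 1 / \<Phi> t) (at t)" "filterlim L at_top at_top"
proof -
  have mono: "\<phi> s \<le> \<phi> t" if "0 \<le> s" "s \<le> t" for s t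
    using smono that by (cases "s = t") (auto simp: strict_mono_on_def intro: less_imp_le)
  have pos1: "0 < \<phi> t" if "0 < t" for t
  proof -
    have "\<phi> 0 < \<phi> t" using smono that by (simp add: strict_mono_on_def)
    then show ?thesis using nonneg[of 0] by simp
  qed
  \<comment> \<open>The factor 4 is what later makes the width at most \<open>s / 4\<close>;
    \<open>max 0\<close> extends the function to the whole line.\<close>
  define \<psi> where "\<psi> t = 4 * (\<phi> (max 0 t) + 1 + max 0 t)" for t
  have cont_\<psi>: "continuous_on UNIV \<psi>"
    unfolding \<psi>_def by (intro continuous_intros continuous_on_compose2[OF cont]) auto
  then have isCont_\<psi>: "isCont \<psi> t" for t by (simp add: continuous_on_eq_continuous_at)
  have \<psi>_mono: "\<psi> s \<le> \<psi> t" if "s \<le> t" for s t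
  proof -
    have "max 0 s \<le> max 0 t" using that by auto
    moreover from this have "\<phi> (max 0 s) \<le> \<phi> (max 0 t)" by (intro mono) auto
    ultimately show ?thesis unfolding \<psi>_def by (intro mult_left_mono add_mono) auto
  qed
  have \<psi>_ge: "4 \<le> \<psi> t" for t using nonneg[of "max 0 t"] by (simp add: \<psi>_def)
  have antideriv: "\<exists>F. \<forall>x. (F has_real_derivative f x) (at x)" if "\<And>x. isCont f x" for f :: "real \<Rightarrow> real"
    using einterval_antiderivative[of "-\<infinity>" "\<infinity>" f] that
    by (auto simp: has_real_derivative_iff_has_vector_derivative)
  obtain P where P: "\<And>t. (P has_real_derivative \<psi> t) (at t)" using antideriv[of \<psi>, OF isCont_\<psi>] by blast
  \<comment> \<open>Averaging makes the weight differentiable although \<phi> is only continuous.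
    The window has length \<open>1 + t\<close>, so the derivative consists of values of \<psi> and
    \<Phi> divided by \<open>1 + t\<close>, which the doubling property bounds by a multiple of
    \<open>\<Phi> t / (1 + t)\<close>.\<close>
  define \<Phi> where "\<Phi> t = (P (2 * t + 1) - P t) / (1 + t)" for t
  define \<Phi>' where "\<Phi>' t = (2 * \<psi> (2 * t + 1) - \<psi> t - \<Phi> t) / (1 + t)" for t
  have deriv: "(\<Phi> has_real_derivative \<Phi>' t) (at t)" if "0 \<le> t" for t
  proof -
    have "((\<lambda>t. P (2 * t + 1)) has_real_derivative \<psi> (2 * t + 1) * 2) (at t)"
      by (rule DERIV_chain2[OF P]) (auto intro!: derivative_eq_intros)
    then have "(\<Phi> has_real_derivative ((\<psi> (2 * t + 1) * 2 - \<psi> t) * (1 + t) - (P (2 * t + 1) - P t) * 1) / ((1 + t) * (1 + t))) (at t)"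
      unfolding \<Phi>_def[abs_def] using that P
      by (intro DERIV_divide DERIV_diff) (auto intro!: derivative_eq_intros)
    moreover have "((\<psi> (2 * t + 1) * 2 - \<psi> t) * (1 + t) - (P (2 * t + 1) - P t) * 1) / ((1 + t) * (1 + t)) = \<Phi>' t"
    proof -
      have "P (2 * t + 1) - P t = \<Phi> t * (1 + t)" using that by (simp add: \<Phi>_def)
      then have "(\<psi> (2 * t + 1) * 2 - \<psi> t) * (1 + t) - (P (2 * t + 1) - P t) * 1 = (2 * \<psi> (2 * t + 1) - \<psi> t - \<Phi> t) * (1 + t)"
        by (simp add: left_diff_distrib)
      then show ?thesis using that by (simp add: \<Phi>'_def)
    qed
    ultimately show ?thesis by simp
  qed
  have between: "\<psi> t \<le> \<Phi> t" "\<Phi> t \<le> \<psi> (2 * t + 1)" if "0 \<le> t" for t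
  proof -
    have "t < 2 * t + 1" using that by simp
    from MVT2[OF this, of P \<psi>] P obtain z where z: "t < z" "z < 2 * t + 1" "P (2 * t + 1) - P t = (2 * t + 1 - t) * \<psi> z"
      by blast
    have eq: "2 * t + 1 - t = 1 + t" by simp
    have "\<Phi> t = \<psi> z" unfolding \<Phi>_def z(3) eq by (rule nonzero_mult_div_cancel_left) (use that in simp)
    then show "\<psi> t \<le> \<Phi> t" "\<Phi> t \<le> \<psi> (2 * t + 1)" using z \<psi>_mono by auto
  qed
  \<comment> \<open>Two uses of quasi-additivity give \<open>\<phi> (2 * t + 1) \<le> 2 * M\<^sup>2
    * \<phi> t + M * \<phi> 1\<close>; the last 2 serves the linear part.\<close>
  define K where "K = 2 * M\<^sup>2 + M * \<phi> 1 + 2"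
  have K: "0 < K" using M(1) nonneg[of 1] by (auto simp: K_def intro!: add_nonneg_pos)
  have \<psi>_doubling: "\<psi> (2 * t + 1) \<le> K * \<psi> t" if "0 \<le> t" for t
  proof -
    have "\<phi> (2 * t) \<le> 2 * M * \<phi> t" using M(2)[of t t] that by simp
    then have "M * (\<phi> (2 * t) + \<phi> 1) \<le> M * (2 * M * \<phi> t + \<phi> 1)" using M(1) by (intro mult_left_mono) auto
    then have "\<phi> (2 * t + 1) \<le> M * (2 * M * \<phi> t + \<phi> 1)" using M(2)[of "2 * t" 1] that by linarith
    also have "\<dots> = 2 * M\<^sup>2 * \<phi> t + M * \<phi> 1" by (simp add: power2_eq_square algebra_simps)
    finally have 1: "\<phi> (2 * t + 1) + 2 * (1 + t) \<le> 2 * M\<^sup>2 * \<phi> t + M * \<phi> 1 * 1 + 2 * (1 + t)" by simp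
    have "2 * M\<^sup>2 * \<phi> t \<le> 2 * M\<^sup>2 * (\<phi> t + 1 + t)" "M * \<phi> 1 * 1 \<le> M * \<phi> 1 * (\<phi> t + 1 + t)"
      "2 * (1 + t) \<le> 2 * (\<phi> t + 1 + t)"
      using that nonneg[of t] nonneg[of 1] M(1) by (intro mult_left_mono; simp)+
    then have "\<phi> (2 * t + 1) + 2 * (1 + t) \<le> K * (\<phi> t + 1 + t)"
      using 1 unfolding K_def distrib_right[of _ _ "\<phi> t + 1 + t"] by linarith
    then have "4 * (\<phi> (2 * t + 1) + 2 * (1 + t)) \<le> 4 * (K * (\<phi> t + 1 + t))" by (rule mult_left_mono) simp
    moreover have "\<psi> (2 * t + 1) = 4 * (\<phi> (2 * t + 1) + 2 * (1 + t))" "K * \<psi> t = 4 * (K * (\<phi> t + 1 + t))"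
      using that by (simp_all add: \<psi>_def mult.left_commute)
    ultimately show ?thesis by (simp only:)
  qed
  have \<Phi>_pos: "4 \<le> \<Phi> t" if "0 \<le> t" for t using between(1)[OF that] \<psi>_ge[of t] by linarith
  have d_bound: "\<bar>\<Phi>' t\<bar> \<le> 2 * K * \<Phi> t / (1 + t)" if "0 \<le> t" for t
  proof -
    have "\<psi> t \<le> \<psi> (2 * t + 1)" using that by (intro \<psi>_mono) auto
    then have "0 \<le> 2 * \<psi> (2 * t + 1) - \<psi> t - \<Phi> t" using between(2)[OF that] by linarith
    moreover have "2 * \<psi> (2 * t + 1) - \<psi> t - \<Phi> t \<le> 2 * K * \<Phi> t"
    proof -
      have "K * \<psi> t \<le> K * \<Phi> t" using between(1)[OF that] K by (intro mult_left_mono) auto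
      then show ?thesis using \<psi>_doubling[OF that] \<psi>_ge[of t] \<Phi>_pos[OF that] by linarith
    qed
    ultimately show ?thesis using that unfolding \<Phi>'_def by (simp add: divide_right_mono)
  qed
  have "isCont (\<lambda>t. 1 / \<Phi> (max 0 t)) x" for x
  proof -
    have "continuous_on {0..} \<Phi>" using deriv by (intro DERIV_continuous_on) (auto intro: has_field_derivative_at_within)
    then have "continuous_on UNIV (\<lambda>t. \<Phi> (max 0 t))"
      by (rule continuous_on_compose2) (auto intro!: continuous_intros)
    moreover have "\<Phi> (max 0 t) \<noteq> 0" for t using \<Phi>_pos[of "max 0 t"] by auto
    ultimately have "continuous_on UNIV (\<lambda>t. 1 / \<Phi> (max 0 t))" by (intro continuous_intros) auto
    then show ?thesis by (simp add: continuous_on_eq_continuous_at)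
  qed
  from antideriv[OF this] obtain L0 where L0: "\<And>t. (L0 has_real_derivative 1 / \<Phi> (max 0 t)) (at t)" by blast
  define L where "L t = L0 t - L0 0 + 1" for t
  have L: "(L has_real_derivative 1 / \<Phi> t) (at t)" if "0 \<le> t" for t
    unfolding L_def[abs_def] using that L0[of t] by (auto intro!: derivative_eq_intros)
  have L_mono: "L s \<le> L t" if "0 \<le> s" "s \<le> t" for s t
  proof (rule DERIV_nonneg_imp_nondecreasing[OF that(2)])
    fix x assume "s \<le> x"
    then have "0 \<le> x" using that by simp
    then show "\<exists>y. (L has_real_derivative y) (at x) \<and> 0 \<le> y"
      using L[of x] \<Phi>_pos[of x] by (intro exI[of _ "1 / \<Phi> x"]) auto
  qed
  have L_lim: "filterlim L at_top at_top"
  proof (rule ccontr)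
    assume "\<not> filterlim L at_top at_top"
    then obtain C where C: "\<And>N. \<exists>t\<ge>N. L t < C"
      unfolding filterlim_at_top eventually_at_top_linorder by (meson not_le)
    have L_bdd: "L t \<le> C" if "0 \<le> t" for t
      using C[of t] L_mono[OF that] by (meson less_imp_le order_trans)
    have "isCont (\<lambda>t. 1 / \<psi> t) x" for x using isCont_\<psi> \<psi>_ge[of x] by (intro continuous_intros) auto
    from antideriv[OF this] obtain Q where Q: "\<And>t. (Q has_real_derivative 1 / \<psi> t) (at t)" by blast
    have Q_mono: "Q s \<le> Q t" if "s \<le> t" for s t
    proof (rule DERIV_nonneg_imp_nondecreasing[OF that])
      fix x show "\<exists>y. (Q has_real_derivative y) (at x) \<and> 0 \<le> y" using Q[of x] \<psi>_ge[of x] by (intro exI[of _ "1 / \<psi> x"]) auto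
    qed
    \<comment> \<open>Since \<open>\<Phi> \<le> K * \<psi>\<close>, the primitive \<open>Q\<close>
      of \<open>1 / \<psi>\<close> grows at most \<open>K\<close> times as fast as \<open>L\<close>
      and inherits its boundedness.\<close>
    have Q_bdd: "Q t \<le> K * C + Q 0 - K * L 0" if "0 \<le> t" for t
    proof -
      have "K * L 0 - Q 0 \<le> K * L t - Q t"
      proof (rule DERIV_nonneg_imp_nondecreasing[OF that])
        fix x :: real assume x: "0 \<le> x"
        have "1 / \<psi> x \<le> K / \<Phi> x"
        proof -
          have "\<Phi> x \<le> K * \<psi> x" using between(2)[OF x] \<psi>_doubling[OF x] by linarith
          then show ?thesis using \<Phi>_pos[OF x] \<psi>_ge[of x] by (simp add: field_simps)
        qed
        moreover have "((\<lambda>t. K * L t - Q t) has_real_derivative K * (1 / \<Phi> x) - 1 / \<psi> x) (at x)"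
          using L[OF x] Q by (intro DERIV_diff DERIV_cmult)
        ultimately show "\<exists>y. ((\<lambda>t. K * L t - Q t) has_real_derivative y) (at x) \<and> 0 \<le> y" by auto
      qed
      moreover have "K * L t \<le> K * C" using L_bdd[OF that] K by (intro mult_left_mono) auto
      ultimately show ?thesis by linarith
    qed
    obtain l where l: "(Q \<longlongrightarrow> l) at_top"
      using bounded_mono_tendsto_at_top[of Q] Q_mono Q_bdd by blast
    \<comment> \<open>If \<open>\<phi> t < t\<close> then \<open>\<psi> \<le> 12 * t\<close> on
      \<open>{t/2..t}\<close>, so \<open>Q\<close> gains at least \<open>1 / 24\<close> there;
      convergence of \<open>Q\<close> allows less than \<open>1/48 + 1/48\<close>.\<close>
    have ev: "\<exists>t0. \<forall>t\<ge>t0. t \<le> \<phi> t"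
    proof (rule ccontr)
      assume neg: "\<not> (\<exists>t0. \<forall>t\<ge>t0. t \<le> \<phi> t)"
      have "\<forall>\<^sub>F t in at_top. \<bar>Q t - l\<bar> < 1 / 48"
        using l[unfolded tendsto_iff, rule_format, of "1/48"] by (simp add: dist_real_def)
      then obtain N where N: "\<And>t. N \<le> t \<Longrightarrow> \<bar>Q t - l\<bar> < 1 / 48"
        unfolding eventually_at_top_linorder by blast
      from neg have "\<exists>t\<ge>max 2 (2 * N). \<phi> t < t" unfolding not_ex not_all not_imp not_le by blast
      then obtain t where t: "2 \<le> t" "2 * N \<le> t" "\<phi> t < t" by auto
      have "t / 2 < t" using t by simp
      from MVT2[OF this, of Q "\<lambda>t. 1 / \<psi> t"] Q obtain z where z: "t / 2 < z" "z < t" "Q t - Q (t / 2) = (t - t / 2) * (1 / \<psi> z)"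
        by blast
      have "\<psi> z \<le> \<psi> t" using z by (intro \<psi>_mono) auto
      also have "\<psi> t \<le> 4 * (3 * t)" using t by (simp add: \<psi>_def)
      finally have "1 / (4 * (3 * t)) \<le> 1 / \<psi> z" using \<psi>_ge[of z] t by (intro divide_left_mono) auto
      then have "(t / 2) * (1 / (4 * (3 * t))) \<le> (t / 2) * (1 / \<psi> z)" using t by (intro mult_left_mono) auto
      moreover have "(t / 2) * (1 / (4 * (3 * t))) = 1 / 24" using t by (simp add: field_simps)
      ultimately have "1 / 24 \<le> Q t - Q (t / 2)" using z by simp
      moreover have "\<bar>Q t - l\<bar> < 1 / 48" "\<bar>Q (t / 2) - l\<bar> < 1 / 48" using t N[of t] N[of "t / 2"] by auto
      ultimately show False by linarith
    qed
    then obtain t0 where t0: "\<And>t. t \<ge> t0 \<Longrightarrow> t \<le> \<phi> t" by blast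
    define t1 where "t1 = max 1 t0"
    have t1: "1 \<le> t1" "t0 \<le> t1" by (auto simp: t1_def)
    have [measurable]: "\<psi> \<in> borel_measurable borel" using cont_\<psi> by (rule borel_measurable_continuous_onI)
    have "(\<integral>\<^sup>+s\<in>{1..}. ennreal (1 / \<phi> s) \<partial>lebesgue)
        \<le> (\<integral>\<^sup>+s. ennreal (1 / \<phi> 1) * indicator {1..t1} s + 12 * (ennreal (1 / \<psi> s) * indicator {t1..} s) \<partial>lebesgue)"
    proof (rule nn_integral_mono)
      fix s :: real
      show "ennreal (1 / \<phi> s) * indicator {1..} s \<le> ennreal (1 / \<phi> 1) * indicator {1..t1} s + 12 * (ennreal (1 / \<psi> s) * indicator {t1..} s)"
      proof (cases "1 \<le> s")
        case True
        show ?thesis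
        proof (cases "s \<le> t1")
          case le: True
          have "ennreal (1 / \<phi> s) \<le> ennreal (1 / \<phi> 1)"
            using pos1[of 1] pos1[of s] mono[of 1 s] True by (intro ennreal_leI divide_left_mono) auto
          then show ?thesis using True le by (auto intro: add_increasing2)
        next
          case False
          then have s: "t0 \<le> s" "1 \<le> s" using t1 by auto
          have "\<psi> s \<le> 12 * \<phi> s" using t0[OF s(1)] s(2) by (simp add: \<psi>_def)
          then have "1 / \<phi> s \<le> 12 * (1 / \<psi> s)"
            using pos1[of s] s \<psi>_ge[of s] by (simp add: field_simps)
          then have "ennreal (1 / \<phi> s) \<le> ennreal (12 * (1 / \<psi> s))" by (rule ennreal_leI)
          also have "\<dots> = 12 * ennreal (1 / \<psi> s)" using \<psi>_ge[of s] by (subst ennreal_mult) auto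
          finally show ?thesis using False s by simp
        qed
      qed simp
    qed
    also have "\<dots> = (\<integral>\<^sup>+s. ennreal (1 / \<phi> 1) * indicator {1..t1} s + 12 * (ennreal (1 / \<psi> s) * indicator {t1..} s) \<partial>lborel)"
      by (rule nn_integral_completion) measurable
    also have "\<dots> = ennreal (1 / \<phi> 1) * ennreal (t1 - 1) + 12 * ennreal (l - Q t1)"
    proof -
      have "(\<integral>\<^sup>+s. ennreal (1 / \<psi> s) * indicator {t1..} s \<partial>lborel) = ennreal (l - Q t1)"
      proof (rule nn_integral_FTC_atLeast[OF _ _ _ l])
        show "(\<lambda>s. 1 / \<psi> s) \<in> borel_measurable borel" by measurable
        show "(Q has_real_derivative 1 / \<psi> x) (at x)" for x by (rule Q)
        show "0 \<le> 1 / \<psi> x" for x using \<psi>_ge[of x] by simp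
      qed
      then show ?thesis using t1 by (simp add: nn_integral_add nn_integral_cmult)
    qed
    also have "\<dots> < \<infinity>" by (simp add: ennreal_mult_less_top)
    finally show False using diverges by simp
  qed
  show ?thesis
  proof (rule that[of \<Phi> \<Phi>' "2 * K" L])
    show "\<phi> t \<le> \<Phi> t" "4 * (1 + t) \<le> \<Phi> t" if "0 \<le> t" for t
      using between(1)[OF that] nonneg[OF that] that by (auto simp: \<psi>_def)
    show "L 0 = 1" by (simp add: L_def)
  qed (rule deriv d_bound L L_lim; assumption)+
qed

lemma oscillation_Lipschitz:
  assumes "0 < m" "m \<le> s" "s \<le> 1" "m \<le> s'" "s' \<le> 1"
  shows "\<bar>oscillation s - oscillation s'\<bar> \<le> 2 / m * \<bar>s - s'\<bar>"
proof -
  have "norm (oscillation s - oscillation s') \<le> 2 / m * norm (s - s')"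
  proof (rule field_differentiable_bound[of "{m..1}" oscillation "\<lambda>s. sin (1 / s) - cos (1 / s) / s"])
    fix x assume x: "x \<in> {m..1}"
    then have "x \<noteq> 0" using assms by auto
    then show "(oscillation has_field_derivative sin (1 / x) - cos (1 / x) / x) (at x within {m..1})"
      unfolding oscillation_def[abs_def]
      by (auto intro!: derivative_eq_intros simp: power2_eq_square)
    have "\<bar>cos (1 / x)\<bar> / x \<le> 1 / m" using x assms by (intro frac_le) auto
    moreover have "1 \<le> 1 / m" using assms by simp
    moreover have "\<bar>sin (1 / x)\<bar> \<le> 1" by simp
    moreover have "\<bar>sin (1 / x) - cos (1 / x) / x\<bar> \<le> \<bar>sin (1 / x)\<bar> + \<bar>cos (1 / x)\<bar> / x"
      using x assms abs_triangle_ineq4[of "sin (1 / x)" "cos (1 / x) / x"] by (simp add: abs_divide)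
    ultimately have "\<bar>sin (1 / x) - cos (1 / x) / x\<bar> \<le> 1 / m + 1 / m" by linarith
    then show "norm (sin (1 / x) - cos (1 / x) / x) \<le> 2 / m" by simp
  qed (use assms in auto)
  then show ?thesis by simp
qed

section \<open>The corridor of a regular weight and its hyperbolic metric\<close>

locale regular_weight =
  fixes \<Phi> \<Phi>' L :: "real \<Rightarrow> real" and K :: real
  assumes deriv_\<Phi>: "\<And>t. 0 \<le> t \<Longrightarrow> (\<Phi> has_real_derivative \<Phi>' t) (at t)"
    and \<Phi>_ge: "\<And>t. 0 \<le> t \<Longrightarrow> 4 * (1 + t) \<le> \<Phi> t"
    and \<Phi>'_le: "\<And>t. 0 \<le> t \<Longrightarrow> \<bar>\<Phi>' t\<bar> \<le> K * \<Phi> t / (1 + t)"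
    and L_0: "L 0 = 1"
    and deriv_L: "\<And>t. 0 \<le> t \<Longrightarrow> (L has_real_derivative 1 / \<Phi> t) (at t)"
    and L_lim: "filterlim L at_top at_top"
begin

lemma \<Phi>_pos:
  assumes "0 \<le> t" shows "0 < \<Phi> t"
  using \<Phi>_ge[OF assms] assms by (simp add: distrib_left)

lemma K_nonneg: "0 \<le> K"
proof -
  have "0 \<le> K * \<Phi> 0" using \<Phi>'_le[of 0] by simp
  then show ?thesis using \<Phi>_pos[of 0] by (simp add: zero_le_mult_iff)
qed

lemma L_strict_mono:
  assumes "0 \<le> s" "s < t" shows "L s < L t"
proof (rule DERIV_pos_imp_increasing[OF assms(2)])
  fix x assume "s \<le> x"
  then have "0 \<le> x" using assms by simp
  then show "\<exists>y. (L has_real_derivative y) (at x) \<and> 0 < y"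
    using deriv_L[of x] \<Phi>_pos[of x] by (intro exI[of _ "1 / \<Phi> x"]) auto
qed

lemma L_mono: "0 \<le> s \<Longrightarrow> s \<le> t \<Longrightarrow> L s \<le> L t"
  using L_strict_mono[of s t] by (cases "s = t") auto

lemma L_ge_1: "0 \<le> t \<Longrightarrow> 1 \<le> L t"
  using L_mono[of 0 t] L_0 by simp

lemma L_le:
  assumes "0 \<le> t" shows "L t \<le> 1 + t"
proof -
  have "0 - L 0 \<le> t - L t"
  proof (rule DERIV_nonneg_imp_nondecreasing[OF assms])
    fix x :: real assume x: "0 \<le> x"
    have "((\<lambda>t. t - L t) has_real_derivative 1 - 1 / \<Phi> x) (at x)"
      using deriv_L[OF x] by (intro DERIV_diff DERIV_ident)
    moreover have "0 \<le> 1 - 1 / \<Phi> x" using \<Phi>_ge[OF x] x by simp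
    ultimately show "\<exists>y. ((\<lambda>t. t - L t) has_real_derivative y) (at x) \<and> 0 \<le> y" by blast
  qed
  then show ?thesis using L_0 by simp
qed

lemma continuous_L: "continuous_on {0..} L"
  using deriv_L by (intro DERIV_continuous_on) (auto intro: has_field_derivative_at_within)

lemma continuous_\<Phi>: "continuous_on {0..} \<Phi>"
  using deriv_\<Phi> by (intro DERIV_continuous_on) (auto intro: has_field_derivative_at_within)

lemma L_surj:
  assumes "1 \<le> \<theta>" shows "\<exists>t\<ge>0. L t = \<theta>"
proof -
  have "\<forall>\<^sub>F t in at_top. \<theta> \<le> L t" using L_lim by (simp add: filterlim_at_top)
  then obtain N where N: "\<And>t. N \<le> t \<Longrightarrow> \<theta> \<le> L t" unfolding eventually_at_top_linorder by blast
  have "\<exists>t. 0 \<le> t \<and> t \<le> max 0 N \<and> L t = \<theta>"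
    using N[of "max 0 N"] L_0 assms continuous_on_subset[OF continuous_L, of "{0..max 0 N}"]
    by (intro IVT') auto
  then show ?thesis by blast
qed

text \<open>The width at the level \<open>s = 1 / L t\<close> is \<open>1 / \<Phi> t\<close>.  The centre line has speed about \<open>s / \<Phi> t\<close> in \<open>t\<close>,
  and the steep corridor has thickness about \<open>s / \<Phi> t\<close>, so \<open>t\<close> measures hyperbolic length.\<close>

definition width :: "real \<Rightarrow> real" where
  "width s = (if s \<le> 0 then 0 else 1 / \<Phi> (THE t. 0 \<le> t \<and> L t = 1 / s))"

lemma width_L: "0 \<le> t \<Longrightarrow> width (1 / L t) = 1 / \<Phi> t"
proof -
  assume t: "0 \<le> t"
  have "(THE t'. 0 \<le> t' \<and> L t' = 1 / (1 / L t)) = t"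
  proof (rule the_equality)
    show "0 \<le> t \<and> L t = 1 / (1 / L t)" using t by simp
    fix t' assume "0 \<le> t' \<and> L t' = 1 / (1 / L t)"
    then show "t' = t" using L_strict_mono[of t t'] L_strict_mono[of t' t] t by (cases t t' rule: linorder_cases) auto
  qed
  moreover have "0 < 1 / L t" using L_ge_1[OF t] by simp
  ultimately show ?thesis unfolding width_def by simp
qed

lemma level_cases:
  assumes "0 < s" "s \<le> 1" obtains t where "0 \<le> t" "s = 1 / L t" "width s = 1 / \<Phi> t"
proof -
  have "1 \<le> 1 / s" using assms by simp
  then obtain t where "0 \<le> t" "L t = 1 / s" using L_surj by blast
  then show ?thesis using that[of t] width_L[of t] by simp
qed

text \<open>In the parameter \<open>t\<close> both the level \<open>1 / L\<close> and the width
  \<open>1 / \<Phi>\<close> are explicit, so Cauchy's mean value theorem applies: the ratio of their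
  derivatives is \<open>\<Phi>' * L\<^sup>2 / \<Phi>\<close> at some \<open>c\<close>, at most
  \<open>K * L c\<close> because \<open>L c \<le> 1 + c\<close>, and \<open>L c\<close> is at most
  \<open>1 / s\<close>.\<close>

lemma width_Lipschitz':
  assumes "0 < s" "s \<le> s'" "s' \<le> 1"
  shows "\<bar>width s' - width s\<bar> \<le> K / s * (s' - s)"
proof -
  obtain t where t: "0 \<le> t" "s = 1 / L t" "width s = 1 / \<Phi> t" using level_cases[of s] assms by auto
  obtain t' where t': "0 \<le> t'" "s' = 1 / L t'" "width s' = 1 / \<Phi> t'" using level_cases[of s'] assms by auto
  consider "t' = t" | "t' < t" | "t < t'" by linarith
  then show ?thesis
  proof cases
    case 1 then show ?thesis using t t' by simp
  next
    case 2
    have L1: "1 \<le> L x" if "t' \<le> x" for x using L_ge_1 that t'(1) by auto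
    have "\<exists>c. t' < c \<and> c < t \<and> (1 / \<Phi> t - 1 / \<Phi> t') * (- (1 / (\<Phi> c * (L c)\<^sup>2))) = (1 / L t - 1 / L t') * (- (\<Phi>' c / (\<Phi> c)\<^sup>2))"
    proof (rule GMVT'[OF 2, of "\<lambda>x. 1 / \<Phi> x" "\<lambda>x. 1 / L x"])
      fix x assume x: "t' \<le> x"
      then have x0: "0 \<le> x" using t'(1) by simp
      show "isCont (\<lambda>x. 1 / \<Phi> x) x" "isCont (\<lambda>x. 1 / L x) x"
        using DERIV_isCont[OF deriv_\<Phi>[OF x0]] DERIV_isCont[OF deriv_L[OF x0]] \<Phi>_pos[OF x0] L1[OF x]
        by (auto intro!: continuous_intros)
    next
      fix x assume x: "t' < x"
      then have x0: "0 \<le> x" "t' \<le> x" using t'(1) by auto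
      show "((\<lambda>x. 1 / L x) has_real_derivative - (1 / (\<Phi> x * (L x)\<^sup>2))) (at x)"
        using L1[OF x0(2)] by (auto intro!: derivative_eq_intros deriv_L[OF x0(1)] simp: power2_eq_square)
      show "((\<lambda>x. 1 / \<Phi> x) has_real_derivative - (\<Phi>' x / (\<Phi> x)\<^sup>2)) (at x)"
        using \<Phi>_pos[OF x0(1)] by (auto intro!: derivative_eq_intros deriv_\<Phi>[OF x0(1)] simp: power2_eq_square)
    qed
    then obtain c where c: "t' < c" "c < t"
      "(1 / \<Phi> t - 1 / \<Phi> t') * (- (1 / (\<Phi> c * (L c)\<^sup>2))) = (1 / L t - 1 / L t') * (- (\<Phi>' c / (\<Phi> c)\<^sup>2))" by blast
    have c0: "0 \<le> c" "t' \<le> c" using c t' by auto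
    have pos: "0 < \<Phi> c" "0 < L c" using \<Phi>_pos[OF c0(1)] L1[OF c0(2)] by auto
    define q where "q = \<Phi>' c * (L c)\<^sup>2 / \<Phi> c"
    have "(width s - width s') / (\<Phi> c * (L c)\<^sup>2) = (s - s') * (\<Phi>' c / (\<Phi> c)\<^sup>2)"
      using c(3) t t' by simp
    then have "width s - width s' = (s - s') * (\<Phi>' c / (\<Phi> c)\<^sup>2) * (\<Phi> c * (L c)\<^sup>2)"
      using pos by (simp add: divide_eq_eq)
    then have eq: "width s - width s' = (s - s') * q"
      using pos by (simp add: q_def power2_eq_square)
    have "\<bar>q\<bar> = \<bar>\<Phi>' c\<bar> * (L c)\<^sup>2 / \<Phi> c" using pos by (simp add: q_def abs_mult)
    also have "\<dots> \<le> (K * \<Phi> c / (1 + c)) * (L c)\<^sup>2 / \<Phi> c"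
      using \<Phi>'_le[OF c0(1)] pos by (intro divide_right_mono mult_right_mono) auto
    also have "\<dots> = K * (L c * (L c / (1 + c)))" using pos by (simp add: power2_eq_square)
    also have "\<dots> \<le> K * (L c * 1)"
      using L_le[OF c0(1)] c0 pos K_nonneg by (intro mult_left_mono) auto
    also have "\<dots> \<le> K * L t" using L_mono[of c t] c0 c K_nonneg by (intro mult_left_mono) auto
    also have "\<dots> = K / s" using t by simp
    finally have q: "\<bar>q\<bar> \<le> K / s" .
    have "\<bar>width s' - width s\<bar> = (s' - s) * \<bar>q\<bar>" using eq assms by (simp add: abs_minus_commute abs_mult)
    also have "\<dots> \<le> (s' - s) * (K / s)" using q assms by (intro mult_left_mono) auto
    finally show ?thesis by (simp add: mult.commute)
  next
    case 3
    then have "1 / L t' < 1 / L t" using L_strict_mono[of t t'] L_ge_1[of t] t(1) by (intro divide_strict_left_mono) auto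
    then show ?thesis using assms t t' by simp
  qed
qed

lemma width_Lipschitz:
  assumes "0 < m" "m \<le> s" "s \<le> 1" "m \<le> s'" "s' \<le> 1"
  shows "\<bar>width s - width s'\<bar> \<le> K / m * \<bar>s - s'\<bar>"
proof -
  have *: "\<bar>width y - width x\<bar> \<le> K / m * (y - x)" if "m \<le> x" "x \<le> y" "y \<le> 1" for x y
  proof -
    have "\<bar>width y - width x\<bar> \<le> K / x * (y - x)" using that assms by (intro width_Lipschitz') auto
    also have "\<dots> \<le> K / m * (y - x)" using that assms K_nonneg by (intro mult_right_mono divide_left_mono) auto
    finally show ?thesis .
  qed
  show ?thesis using *[of s s'] *[of s' s] assms by (cases "s \<le> s'") (auto simp: abs_minus_commute)
qed

sublocale corridor width
proof
  have le: "0 < width s" "width s \<le> s / 4" if s: "0 < s" "s \<le> 1" for s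
  proof -
    obtain t where t: "0 \<le> t" "s = 1 / L t" "width s = 1 / \<Phi> t" by (rule level_cases[OF s])
    show "0 < width s" using t \<Phi>_pos[of t] by simp
    have "4 * L t \<le> 4 * (1 + t)" using L_le[OF t(1)] by simp
    then have "4 * L t \<le> \<Phi> t" using \<Phi>_ge[OF t(1)] by (rule order_trans)
    then have "1 / \<Phi> t \<le> 1 / (4 * L t)" using L_ge_1[of t] t by (intro divide_left_mono mult_pos_pos \<Phi>_pos) auto
    then show "width s \<le> s / 4" using t by simp
  qed
  show "width 0 = 0" by (simp add: width_def)
  then show "width s \<le> s / 4" if "0 \<le> s" "s \<le> 1" for s using le[of s] that by (cases "s = 0") auto
  show "0 < width s" if "0 < s" "s \<le> 1" for s using le that by blast
  show "continuous_on {0..1} width"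
    unfolding continuous_on_eq_continuous_within continuous_within
  proof
    fix s :: real assume s: "s \<in> {0..1}"
    show "(width \<longlongrightarrow> width s) (at s within {0..1})"
    proof (cases "s = 0")
      case True
      have "\<forall>\<^sub>F x in at s within {0..1}. norm (width x) \<le> x"
        unfolding eventually_at_filter
      proof (intro always_eventually allI impI)
        fix x assume "x \<noteq> s" "x \<in> {0..1}"
        then show "norm (width x) \<le> x" using le[of x] True by auto
      qed
      moreover have "((\<lambda>x. x) \<longlongrightarrow> 0) (at s within {0..1})" using tendsto_ident_at[of s] True by simp
      ultimately have "(width \<longlongrightarrow> 0) (at s within {0..1})" by (rule Lim_null_comparison)
      then show ?thesis using True \<open>width 0 = 0\<close> by simp
    next
      case nz: False
      have "((\<lambda>x. width x - width s) \<longlongrightarrow> 0) (at s within {0..1})"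
      proof (rule Lim_null_comparison)
        show "((\<lambda>x. K / (s / 2) * \<bar>x - s\<bar>) \<longlongrightarrow> 0) (at s within {0..1})"
          using nz by (auto intro!: tendsto_eq_intros)
        have "0 < s" using nz s by (simp add: less_le)
        then have "s / 2 < s" by simp
        then have "\<forall>\<^sub>F x in at s within {0..1}. s / 2 < x"
          using order_tendstoD(1)[OF tendsto_ident_at[of s "{0..1}"]] by blast
        moreover have "\<forall>\<^sub>F x in at s within {0..1}. x \<in> {0..1}" by (simp add: eventually_at_filter)
        ultimately show "\<forall>\<^sub>F x in at s within {0..1}. norm (width x - width s) \<le> K / (s / 2) * \<bar>x - s\<bar>"
        proof eventually_elim
          case (elim x)
          then show ?case using width_Lipschitz[of "s / 2" x s] s \<open>0 < s\<close> by simp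
        qed
      qed
      then show ?thesis by (simp add: LIM_zero_iff)
    qed
  qed
qed

text \<open>A displacement by \<rho> changes the height by less than \<open>\<rho> / s\<close>, the
  centre line by at most \<open>4 * \<rho> / s\<close> and the width by at most
  \<open>2 * K * \<rho> / s\<close>; the Lipschitz constants are taken at \<open>s / 2\<close>,
  below which the level cannot fall. The total stays below \<open>(6 + 2 * K) * \<rho> / s\<close>,
  the available margin.\<close>

lemma ball_subset_domain:
  assumes s: "s = 1 - \<bar>Re z\<bar>" "0 < s" and \<mu>: "0 \<le> \<mu>" "\<mu> < 1" "\<bar>Im z - oscillation s\<bar> \<le> \<mu> * width s"
  shows "ball z (s * width s * (1 - \<mu>) / (6 + 2 * K)) \<subseteq> domain"
proof
  fix w assume w: "w \<in> ball z (s * width s * (1 - \<mu>) / (6 + 2 * K))"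
  define \<rho> where "\<rho> = s * width s * (1 - \<mu>) / (6 + 2 * K)"
  define s' where "s' = 1 - \<bar>Re w\<bar>"
  have s1: "s \<le> 1" using s by simp
  have v: "0 < width s" "width s \<le> 1 / 4" using v_pos[of s] v_le[of s] s s1 by auto
  have "cmod (w - z) < \<rho>" using w by (simp add: \<rho>_def dist_norm norm_minus_commute)
  then have dw: "\<bar>Re w - Re z\<bar> < \<rho>" "\<bar>Im w - Im z\<bar> < \<rho>"
    using abs_Re_le_cmod[of "w - z"] abs_Im_le_cmod[of "w - z"] by auto
  have d: "\<bar>s - s'\<bar> \<le> \<rho>" using dw by (simp add: s s'_def)
  have \<rho>_eq: "(6 + 2 * K) * (\<rho> / s) = width s * (1 - \<mu>)" using s K_nonneg by (simp add: \<rho>_def)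
  have \<rho>: "0 < \<rho>" unfolding \<rho>_def using s v \<mu> K_nonneg by (intro divide_pos_pos mult_pos_pos) auto
  have "2 * (\<rho> / s) \<le> (6 + 2 * K) * (\<rho> / s)" using K_nonneg \<rho> s by (intro mult_right_mono) auto
  also have "\<dots> \<le> width s * 1" unfolding \<rho>_eq using \<mu> v by (intro mult_left_mono) auto
  finally have "\<rho> / s < 1 / 2" using v by linarith
  then have "\<rho> < s / 2" using s by (simp add: field_simps)
  then have s': "s / 2 \<le> s'" "s' \<le> 1" "0 < s'" using d s by (auto simp: s'_def)
  have "\<bar>oscillation s - oscillation s'\<bar> \<le> 2 / (s / 2) * \<bar>s - s'\<bar>"
    using s s1 s' by (intro oscillation_Lipschitz) auto
  also have "\<dots> \<le> 2 / (s / 2) * \<rho>" using d s by (intro mult_left_mono) auto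
  finally have o: "\<bar>oscillation s - oscillation s'\<bar> \<le> 4 * (\<rho> / s)" by simp
  have "\<bar>width s - width s'\<bar> \<le> K / (s / 2) * \<bar>s - s'\<bar>"
    using s s1 s' by (intro width_Lipschitz) auto
  also have "\<dots> \<le> K / (s / 2) * \<rho>" using d s K_nonneg by (intro mult_left_mono) auto
  finally have wd: "\<bar>width s - width s'\<bar> \<le> 2 * K * (\<rho> / s)" by (simp add: mult.commute[of K])
  have "\<rho> \<le> \<rho> / s" using s s1 \<rho> by (simp add: field_simps)
  have "(6 + 2 * K) * (\<rho> / s) = 6 * (\<rho> / s) + 2 * K * (\<rho> / s)" by (simp only: distrib_right)
  moreover have "0 < \<rho> / s" using \<rho> s by simp
  moreover have "width s * (1 - \<mu>) = width s - \<mu> * width s" by (simp add: right_diff_distrib)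
  ultimately have "\<bar>Im w - oscillation s'\<bar> < width s'"
    using o wd dw(2) \<mu>(3) \<open>\<rho> \<le> \<rho> / s\<close> \<rho>_eq by linarith
  then show "w \<in> domain" using s'(3) by (simp add: domain_def s'_def)
qed

text \<open>The path moves along the corridor and towards the boundary at the same time.  The reparametrization
  \<open>r e = 1 - (1 - e)^N\<close> turns the logarithmic divergence at the boundary into the power \<open>-1/N\<close> of
  the relative distance, which the polynomial growth of \<open>\<phi>\<close> tolerates when \<open>N\<close> is large.\<close>

lemma hyperbolic_metric_bound:
  fixes \<eta> t \<sigma> :: real and N :: nat
  assumes t: "0 \<le> t" and \<eta>: "\<bar>\<eta>\<bar> < 1" and \<sigma>: "\<bar>\<sigma>\<bar> = 1" and N: "0 < N"
  shows "hyperbolic_metric domain (Complex 0 (oscillation 1)) (Complex (\<sigma> * (1 - 1 / L t)) (sin (L t) / L t + \<eta> / \<Phi> t))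
    \<le> 4 * (4 + K) * (3 + K) * real N * (1 + t) / root N (1 - \<bar>\<eta>\<bar>)"
proof -
  define r where "r e = 1 - (1 - e) ^ N" for e :: real
  define r' where "r' e = real N * (1 - e) ^ (N - 1)" for e :: real
  \<comment> \<open>\<open>r\<close> runs from 0 to 1, so the path starts on the centre line at
    level 1 (\<open>L 0 = 1\<close>) and ends at the given point; at time \<open>e\<close> its
    relative height is \<open>\<eta> * r e\<close>.\<close>
  define \<gamma> where "\<gamma> e = Complex (\<sigma> * (1 - 1 / L (t * r e))) (sin (L (t * r e)) / L (t * r e) + \<eta> * r e / \<Phi> (t * r e))" for e
  define \<gamma>' where "\<gamma>' e = (let x = t * r e in
     Complex (\<sigma> * (1 / (\<Phi> x * (L x)\<^sup>2) * (t * r' e)))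
      ((cos (L x) * L x - sin (L x)) / (L x)\<^sup>2 * (1 / \<Phi> x) * (t * r' e) +
       (\<eta> * r' e / \<Phi> x - \<eta> * r e * (\<Phi>' x * (t * r' e)) / (\<Phi> x)\<^sup>2)))" for e
  \<comment> \<open>In units of \<open>r' e / (\<Phi> * L)\<close>: moving along the corridor costs
    \<open>t\<close> times \<open>1\<close> (horizontally) plus \<open>2\<close> (centre line) plus
    \<open>K\<close> (changing width), and moving across it costs \<open>1 + t\<close>.\<close>
  define k where "k e = (4 + K) * (1 + t) * r' e / (\<Phi> (t * r e) * L (t * r e))" for e
  define rad where "rad e = (1 / L (t * r e)) * (1 / \<Phi> (t * r e)) * (1 - \<bar>\<eta>\<bar> * r e) / (6 + 2 * K)" for e
  have r01: "0 \<le> r e" "r e \<le> 1" "0 \<le> r' e" if "e \<in> {0..1}" for e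
    using that by (auto simp: r_def r'_def power_le_one)
  have x0: "0 \<le> t * r e" "t * r e \<le> t" if "e \<in> {0..1}" for e
    using r01[OF that] t by (auto intro: mult_left_le)
  have lr: "\<bar>\<eta>\<bar> * r e < 1" "0 \<le> \<bar>\<eta>\<bar> * r e" if "e \<in> {0..1}" for e
  proof -
    have "\<bar>\<eta>\<bar> * r e \<le> \<bar>\<eta>\<bar>" using r01[OF that] by (intro mult_left_le) auto
    then show "\<bar>\<eta>\<bar> * r e < 1" using \<eta> by simp
  qed (use r01[OF that] in simp)
  have deriv_r: "(r has_real_derivative r' e) (at e)" for e
    unfolding r_def[abs_def] r'_def by (auto intro!: derivative_eq_intros)
  have deriv_x: "((\<lambda>e. t * r e) has_real_derivative t * r' e) (at e)" for e
    using deriv_r by (rule DERIV_cmult)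
  have deriv: "(\<gamma> has_vector_derivative \<gamma>' e) (at e within {0..1})" if "e \<in> {0..1}" for e
  proof -
    let ?x = "t * r e"
    have dL: "((\<lambda>e. L (t * r e)) has_real_derivative 1 / \<Phi> ?x * (t * r' e)) (at e)"
      using DERIV_chain2[OF deriv_L[OF x0(1)[OF that]] deriv_x] .
    have d\<Phi>: "((\<lambda>e. \<Phi> (t * r e)) has_real_derivative \<Phi>' ?x * (t * r' e)) (at e)"
      using DERIV_chain2[OF deriv_\<Phi>[OF x0(1)[OF that]] deriv_x] .
    have nz: "L ?x \<noteq> 0" "\<Phi> ?x \<noteq> 0" using L_ge_1[OF x0(1)[OF that]] \<Phi>_pos[OF x0(1)[OF that]] by auto
    have "((\<lambda>e. \<sigma> * (1 - 1 / L (t * r e))) has_real_derivative \<sigma> * (0 - (0 * L ?x - 1 * (1 / \<Phi> ?x * (t * r' e))) / (L ?x * L ?x))) (at e)"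
      by (intro DERIV_cmult DERIV_diff DERIV_const DERIV_divide dL nz)
    moreover have "((\<lambda>e. sin (L (t * r e)) / L (t * r e) + \<eta> * r e / \<Phi> (t * r e)) has_real_derivative
      (cos (L ?x) * (1 / \<Phi> ?x * (t * r' e)) * L ?x - sin (L ?x) * (1 / \<Phi> ?x * (t * r' e))) / (L ?x * L ?x) +
      (\<eta> * r' e * \<Phi> ?x - \<eta> * r e * (\<Phi>' ?x * (t * r' e))) / (\<Phi> ?x * \<Phi> ?x)) (at e)"
      by (intro DERIV_add DERIV_divide DERIV_cmult d\<Phi> deriv_r dL nz DERIV_chain2[OF DERIV_sin])
    moreover have "\<sigma> * (0 - (0 * L ?x - 1 * (1 / \<Phi> ?x * (t * r' e))) / (L ?x * L ?x)) = Re (\<gamma>' e)"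
      by (simp add: \<gamma>'_def Let_def power2_eq_square)
    moreover have "(cos (L ?x) * (1 / \<Phi> ?x * (t * r' e)) * L ?x - sin (L ?x) * (1 / \<Phi> ?x * (t * r' e))) / (L ?x * L ?x) +
      (\<eta> * r' e * \<Phi> ?x - \<eta> * r e * (\<Phi>' ?x * (t * r' e))) / (\<Phi> ?x * \<Phi> ?x) = Im (\<gamma>' e)"
    proof -
      have "cos (L ?x) * (1 / \<Phi> ?x * (t * r' e)) * L ?x - sin (L ?x) * (1 / \<Phi> ?x * (t * r' e)) =
         (cos (L ?x) * L ?x - sin (L ?x)) * (1 / \<Phi> ?x * (t * r' e))"
      proof -
        have "p * d * l - q * d = (p * l - q) * d" for p q d l :: real by (simp add: algebra_simps)
        then show ?thesis .
      qed
      moreover have "(\<eta> * r' e * \<Phi> ?x - \<eta> * r e * (\<Phi>' ?x * (t * r' e))) / (\<Phi> ?x * \<Phi> ?x) =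
         \<eta> * r' e / \<Phi> ?x - \<eta> * r e * (\<Phi>' ?x * (t * r' e)) / (\<Phi> ?x * \<Phi> ?x)"
        using nz by (simp add: diff_divide_distrib)
      ultimately show ?thesis by (simp add: \<gamma>'_def Let_def power2_eq_square)
    qed
    ultimately show ?thesis
      unfolding has_vector_derivative_complex_iff by (auto simp: \<gamma>_def intro!: has_field_derivative_at_within)
  qed
  have speed: "cmod (\<gamma>' e) \<le> k e" if "e \<in> {0..1}" for e
  proof -
    define x where "x = t * r e"
    define u where "u = 1 / (\<Phi> x * L x)"
    have x: "0 \<le> x" "x \<le> t" using x0[OF that] by (auto simp: x_def)
    have L: "1 \<le> L x" "L x \<le> 1 + x" and P: "0 < \<Phi> x" using L_ge_1 L_le \<Phi>_pos x by auto
    have u0: "0 < u" using L P by (simp add: u_def)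
    define X where "X = t * r' e"
    have tr: "0 \<le> X" "0 \<le> r' e" using t r01[OF that] by (auto simp: X_def)
    have a: "\<bar>\<sigma> * (1 / (\<Phi> x * (L x)\<^sup>2) * X)\<bar> \<le> u * X"
    proof -
      have "1 / (\<Phi> x * (L x)\<^sup>2) \<le> u"
        unfolding u_def using L P self_le_power[of "L x" 2] by (intro divide_left_mono mult_left_mono mult_pos_pos) auto
      then have "1 / (\<Phi> x * (L x)\<^sup>2) * X \<le> u * X" using tr by (intro mult_right_mono)
      moreover have "0 \<le> 1 / (\<Phi> x * (L x)\<^sup>2) * X" using P tr by (intro mult_nonneg_nonneg) auto
      ultimately show ?thesis using \<sigma> by (simp add: abs_mult)
    qed
    have b: "\<bar>(cos (L x) * L x - sin (L x)) / (L x)\<^sup>2 * (1 / \<Phi> x) * X\<bar> \<le> 2 * u * X"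
    proof -
      have "\<bar>cos (L x) * L x - sin (L x)\<bar> \<le> \<bar>cos (L x) * L x\<bar> + \<bar>sin (L x)\<bar>" by (rule abs_triangle_ineq4)
      also have "\<dots> \<le> 1 * L x + 1" using L by (intro add_mono) (auto simp: abs_mult intro!: mult_right_mono)
      finally have "\<bar>cos (L x) * L x - sin (L x)\<bar> \<le> 2 * L x" using L by simp
      then have "\<bar>cos (L x) * L x - sin (L x)\<bar> / (L x)\<^sup>2 \<le> 2 * L x / (L x)\<^sup>2" by (intro divide_right_mono) auto
      also have "\<dots> = 2 / L x" using L by (simp add: power2_eq_square)
      finally have "\<bar>cos (L x) * L x - sin (L x)\<bar> / (L x)\<^sup>2 * (1 / \<Phi> x) * X \<le> 2 / L x * (1 / \<Phi> x) * X"
        using P tr by (intro mult_right_mono) auto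
      also have "2 / L x * (1 / \<Phi> x) * X = 2 * u * X" by (simp add: u_def mult.commute)
      also have "\<bar>cos (L x) * L x - sin (L x)\<bar> / (L x)\<^sup>2 * (1 / \<Phi> x) * X = \<bar>(cos (L x) * L x - sin (L x)) / (L x)\<^sup>2 * (1 / \<Phi> x) * X\<bar>"
        using P tr by (simp add: abs_mult)
      finally show ?thesis .
    qed
    have c: "\<bar>\<eta> * r' e / \<Phi> x\<bar> \<le> u * (1 + t) * r' e"
    proof -
      have "\<bar>\<eta> * r' e / \<Phi> x\<bar> = \<bar>\<eta>\<bar> * (r' e / \<Phi> x)" using tr P by (simp add: abs_mult)
      also have "\<dots> \<le> 1 * (r' e / \<Phi> x)" using \<eta> tr P by (intro mult_right_mono) auto
      also have "\<dots> = u * L x * r' e" using L P by (simp add: u_def)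
      also have "\<dots> \<le> u * (1 + t) * r' e" using L x u0 tr by (intro mult_right_mono mult_left_mono) auto
      finally show ?thesis .
    qed
    have d: "\<bar>\<eta> * r e * (\<Phi>' x * X) / (\<Phi> x)\<^sup>2\<bar> \<le> K * u * X"
    proof -
      have "\<bar>\<eta> * r e * (\<Phi>' x * X) / (\<Phi> x)\<^sup>2\<bar> = \<bar>\<eta> * r e\<bar> * (\<bar>\<Phi>' x\<bar> / (\<Phi> x)\<^sup>2 * X)"
        using tr by (simp add: abs_mult)
      also have "\<dots> \<le> 1 * (\<bar>\<Phi>' x\<bar> / (\<Phi> x)\<^sup>2 * X)"
        using lr[OF that] tr r01[OF that] by (intro mult_right_mono) (auto simp: abs_mult)
      also have "\<dots> \<le> 1 * (K * u * X)"
      proof (intro mult_left_mono mult_right_mono tr(1))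
        have "\<bar>\<Phi>' x\<bar> / (\<Phi> x)\<^sup>2 \<le> (K * \<Phi> x / (1 + x)) / (\<Phi> x)\<^sup>2" using \<Phi>'_le[OF x(1)] by (intro divide_right_mono) auto
        also have "\<dots> = K * (1 / (\<Phi> x * (1 + x)))" using P by (simp add: power2_eq_square)
        also have "\<dots> \<le> K * u"
          unfolding u_def using L P K_nonneg by (intro mult_left_mono divide_left_mono mult_pos_pos) auto
        finally show "\<bar>\<Phi>' x\<bar> / (\<Phi> x)\<^sup>2 \<le> K * u" .
      qed simp
      finally show ?thesis by simp
    qed
    have triangle: "\<bar>p\<bar> \<le> p' \<Longrightarrow> \<bar>q\<bar> \<le> q' \<Longrightarrow> \<bar>v\<bar> \<le> v' \<Longrightarrow> \<bar>p + (q - v)\<bar> \<le> p' + (q' + v')" for p q v p' q' v' :: real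
      by linarith
    have "cmod (\<gamma>' e) \<le> \<bar>Re (\<gamma>' e)\<bar> + \<bar>Im (\<gamma>' e)\<bar>" by (rule cmod_le)
    also have "\<dots> \<le> u * X + (2 * u * X + (u * (1 + t) * r' e + K * u * X))"
    proof -
      have "\<bar>Re (\<gamma>' e)\<bar> \<le> u * X" using a by (simp add: \<gamma>'_def Let_def x_def[symmetric] X_def[symmetric])
      moreover have "Im (\<gamma>' e) = (cos (L x) * L x - sin (L x)) / (L x)\<^sup>2 * (1 / \<Phi> x) * X +
       (\<eta> * r' e / \<Phi> x - \<eta> * r e * (\<Phi>' x * X) / (\<Phi> x)\<^sup>2)" by (simp only: \<gamma>'_def Let_def x_def[symmetric] X_def[symmetric] complex.sel)
      then have "\<bar>Im (\<gamma>' e)\<bar> \<le> 2 * u * X + (u * (1 + t) * r' e + K * u * X)"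
        using triangle[OF b c d] by (simp only:)
      ultimately show ?thesis by linarith
    qed
    also have "\<dots> = (3 + K) * (t * (u * r' e)) + (1 + t) * (u * r' e)" by (simp add: X_def algebra_simps)
    also have "\<dots> \<le> (3 + K) * ((1 + t) * (u * r' e)) + (1 + t) * (u * r' e)"
      using K_nonneg u0 tr by (intro add_mono mult_left_mono mult_right_mono) auto
    also have "\<dots> = k e" by (simp add: k_def u_def x_def algebra_simps add_divide_distrib)
    finally show ?thesis .
  qed
  have rad_pos: "0 < rad e" if "e \<in> {0..1}" for e
    unfolding rad_def using L_ge_1[OF x0(1)[OF that]] \<Phi>_pos[OF x0(1)[OF that]] lr[OF that] K_nonneg
    by (intro divide_pos_pos mult_pos_pos) auto
  have ball: "ball (\<gamma> e) (rad e) \<subseteq> domain" if "e \<in> {0..1}" for e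
  proof -
    let ?x = "t * r e"
    have L: "1 \<le> L ?x" and P: "0 < \<Phi> ?x" using L_ge_1 \<Phi>_pos x0[OF that] by auto
    have "\<bar>Re (\<gamma> e)\<bar> = 1 - 1 / L ?x" using \<sigma> L by (simp add: \<gamma>_def abs_mult)
    then have s: "1 / L ?x = 1 - \<bar>Re (\<gamma> e)\<bar>" by simp
    have w: "width (1 / L ?x) = 1 / \<Phi> ?x" using width_L x0[OF that] by blast
    have "Im (\<gamma> e) - oscillation (1 / L ?x) = \<eta> * r e / \<Phi> ?x" by (simp add: \<gamma>_def oscillation_def)
    then have "\<bar>Im (\<gamma> e) - oscillation (1 / L ?x)\<bar> \<le> \<bar>\<eta>\<bar> * r e * width (1 / L ?x)"
      using P r01[OF that] by (simp add: w abs_mult)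
    from ball_subset_domain[OF s _ lr(2)[OF that] lr(1)[OF that] this] show ?thesis
      using L by (simp add: rad_def w)
  qed
  define \<beta> where "\<beta> = root N (1 - \<bar>\<eta>\<bar>)"
  have \<beta>: "0 < \<beta>" "\<beta> ^ N = 1 - \<bar>\<eta>\<bar>" using \<eta> N by (auto simp: \<beta>_def)
  \<comment> \<open>The product of the 2 from the density, \<open>4 + K\<close> from the speed,
    \<open>6 + 2 * K\<close> from the inscribed disc and \<open>N\<close> from \<open>r'\<close>,
    times \<open>1 + t\<close>.\<close>
  define D where "D = 4 * (4 + K) * (3 + K) * real N * (1 + t)"
  have le: "2 * k e \<le> D / \<beta> * rad e" if "e \<in> {0..1}" for e
  proof -
    define q where "q = 1 - e"
    have q: "0 \<le> q" "q \<le> 1" using that by (auto simp: q_def)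
    define u where "u = 1 / (\<Phi> (t * r e) * L (t * r e))"
    have u0: "0 < u" using L_ge_1[OF x0(1)[OF that]] \<Phi>_pos[OF x0(1)[OF that]] by (simp add: u_def)
    have 1: "1 - \<bar>\<eta>\<bar> * r e = (1 - \<bar>\<eta>\<bar>) + \<bar>\<eta>\<bar> * q ^ N" by (simp add: r_def q_def algebra_simps)
    \<comment> \<open>The right side dominates both \<open>\<beta> ^ N\<close> and
      \<open>q ^ N\<close>, hence also this mixed power; it cancels the factor
      \<open>(1 - e) ^ (N - 1)\<close> of the speed and leaves \<open>1 / \<beta>\<close>.\<close>
    have "\<beta> * q ^ (N - 1) \<le> 1 - \<bar>\<eta>\<bar> * r e"
    proof (cases "\<beta> \<le> q")
      case True
      have "\<beta> * q ^ (N - 1) \<le> q * q ^ (N - 1)" using True q by (intro mult_right_mono) auto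
      also have "\<dots> = q ^ N" using N by (simp add: power_eq_if)
      also have "\<dots> \<le> 1 - \<bar>\<eta>\<bar> * r e"
      proof -
        have "(1 - \<bar>\<eta>\<bar>) * q ^ N \<le> (1 - \<bar>\<eta>\<bar>) * 1" using \<eta> q by (intro mult_left_mono power_le_one) auto
        then show ?thesis unfolding 1 by (simp add: left_diff_distrib)
      qed
      finally show ?thesis .
    next
      case False
      then have "\<beta> * q ^ (N - 1) \<le> \<beta> * \<beta> ^ (N - 1)" using \<beta> q by (intro mult_left_mono power_mono) auto
      also have "\<dots> = \<beta> ^ N" using N by (simp add: power_eq_if)
      also have "\<dots> \<le> 1 - \<bar>\<eta>\<bar> * r e" unfolding 1 \<beta>(2) using q by simp
      finally show ?thesis .
    qed
    then have "q ^ (N - 1) \<le> (1 - \<bar>\<eta>\<bar> * r e) / \<beta>" using \<beta> by (simp add: pos_le_divide_eq mult.commute)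
    then have "(2 * (4 + K) * (1 + t) * real N * u) * q ^ (N - 1) \<le> (2 * (4 + K) * (1 + t) * real N * u) * ((1 - \<bar>\<eta>\<bar> * r e) / \<beta>)"
      using K_nonneg t u0 by (intro mult_left_mono) auto
    moreover have "2 * k e = (2 * (4 + K) * (1 + t) * real N * u) * q ^ (N - 1)"
      by (simp add: k_def r'_def u_def q_def)
    moreover have "D / \<beta> * rad e = (2 * (4 + K) * (1 + t) * real N * u) * ((1 - \<bar>\<eta>\<bar> * r e) / \<beta>)"
    proof -
      have "rad e = u * (1 - \<bar>\<eta>\<bar> * r e) / (2 * (3 + K))" by (simp add: rad_def u_def mult.commute)
      moreover have "4 * p * c * n * y / b' * (d * z / (2 * c)) = (2 * p * y * n * d) * (z / b')" if "c \<noteq> 0" for p c n y b' d z :: real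
        using that by simp
      ultimately show ?thesis using K_nonneg by (simp only: D_def)
    qed
    ultimately show ?thesis by (simp only:)
  qed
  have cont_L: "continuous_on {0..1} (\<lambda>e. L (t * r e))" and cont_P: "continuous_on {0..1} (\<lambda>e. \<Phi> (t * r e))"
    using x0 by (auto intro!: continuous_on_compose2[OF continuous_L] continuous_on_compose2[OF continuous_\<Phi>] continuous_intros simp: r_def)
  have nz: "L (t * r e) \<noteq> 0" "\<Phi> (t * r e) \<noteq> 0" if "e \<in> {0..1}" for e
    using L_ge_1[OF x0(1)[OF that]] \<Phi>_pos[OF x0(1)[OF that]] by auto
  have "hyperbolic_metric domain (\<gamma> 0) (\<gamma> 1) \<le> D / \<beta>"
  proof (rule hyperbolic_metric_le[OF open_domain simply_connected_domain domain_neq_UNIV deriv speed ball rad_pos])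
    show "continuous_on {0..1} k" unfolding k_def r'_def
      using nz by (intro continuous_intros cont_L cont_P) auto
    show "continuous_on {0..1} rad" unfolding rad_def
      using nz K_nonneg by (intro continuous_intros cont_L cont_P) (auto simp: r_def intro!: continuous_intros)
  qed (use le in auto)
  moreover have "\<gamma> 0 = Complex 0 (oscillation 1)" by (simp add: \<gamma>_def r_def L_0 oscillation_def)
  moreover have "\<gamma> 1 = Complex (\<sigma> * (1 - 1 / L t)) (sin (L t) / L t + \<eta> / \<Phi> t)" using N by (simp add: \<gamma>_def r_def zero_power)
  ultimately show ?thesis by (simp add: D_def \<beta>_def)
qed

end

section \<open>Integrability over the corridor\<close>

lemma nn_integral_inverse_sqrt_finite:
  "(\<integral>\<^sup>+u. ennreal (1 / sqrt (1 - \<bar>u\<bar>)) * indicator {-1<..<1} u \<partial>lborel) < \<infinity>"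
proof -
  define g where "g x = ennreal (x powr (- 1 / 2)) * indicator {0..1} x" for x :: real
  have [measurable]: "g \<in> borel_measurable borel" unfolding g_def by measurable
  have "(\<integral>\<^sup>+x. g x \<partial>lborel) = ennreal (1 powr (- 1 / 2 + 1) / (- 1 / 2 + 1))"
    unfolding g_def by (intro nn_integral_has_integral_lebesgue' has_integral_powr_from_0) auto
  then have g: "(\<integral>\<^sup>+x. g x \<partial>lborel) = 2" by simp
  have "(\<integral>\<^sup>+u. ennreal (1 / sqrt (1 - \<bar>u\<bar>)) * indicator {-1<..<1} u \<partial>lborel) \<le> (\<integral>\<^sup>+u. g (1 + 1 * u) + g (1 + (-1) * u) \<partial>lborel)"
  proof (rule nn_integral_mono)
    fix u :: real
    have *: "1 / sqrt y = y powr (- 1 / 2)" if "0 < y" for y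
      using that by (simp add: powr_minus_divide powr_half_sqrt)
    show "ennreal (1 / sqrt (1 - \<bar>u\<bar>)) * indicator {-1<..<1} u \<le> g (1 + 1 * u) + g (1 + (-1) * u)"
    proof (cases "u \<in> {-1<..<1}")
      case True
      show ?thesis
      proof (cases "0 \<le> u")
        case True': True
        have "ennreal (1 / sqrt (1 - \<bar>u\<bar>)) * indicator {-1<..<1} u = g (1 + (-1) * u)"
          using True True' *[of "1 - u"] by (simp add: g_def)
        then show ?thesis by (metis add.commute add_increasing2 order_refl zero_le)
      next
        case False
        have "ennreal (1 / sqrt (1 - \<bar>u\<bar>)) * indicator {-1<..<1} u = g (1 + 1 * u)"
          using True False *[of "1 + u"] by (simp add: g_def)
        then show ?thesis by (metis add_increasing2 order_refl zero_le)
      qed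
    qed simp
  qed
  also have "\<dots> = (\<integral>\<^sup>+u. g (1 + 1 * u) \<partial>lborel) + (\<integral>\<^sup>+u. g (1 + (-1) * u) \<partial>lborel)"
    by (rule nn_integral_add) measurable
  also have "\<dots> = 2 + 2"
    using nn_integral_real_affine[of g 1 1] nn_integral_real_affine[of g "-1" 1] g by simp
  also have "\<dots> < \<infinity>" by simp
  finally show ?thesis .
qed

context regular_weight
begin

lemma nn_integral_hyperbolic_finite:
  fixes \<phi> :: "real \<Rightarrow> real"
  assumes nonneg: "\<And>t. t \<ge> 0 \<Longrightarrow> \<phi> t \<ge> 0" and mono: "\<And>s t. 0 \<le> s \<Longrightarrow> s \<le> t \<Longrightarrow> \<phi> s \<le> \<phi> t"
    and M: "M > 0" "\<And>s t. s \<ge> 0 \<Longrightarrow> t \<ge> 0 \<Longrightarrow> \<phi> (s + t) \<le> M * (\<phi> s + \<phi> t)"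
    and le: "\<And>t. 0 \<le> t \<Longrightarrow> \<phi> t \<le> \<Phi> t"
  shows "(\<integral>\<^sup>+z\<in>domain. ennreal (\<phi> (hyperbolic_metric domain (Complex 0 (oscillation 1)) z)) \<partial>lebesgue) < \<infinity>"
proof -
  let ?h = "hyperbolic_metric domain (Complex 0 (oscillation 1))"
  obtain n where "2 * M < 2 ^ n" using real_arch_pow[of 2 "2 * M"] by auto
  \<comment> \<open>The successor ensures \<open>0 < p\<close>, so that the root of order
    \<open>N\<close> below is a genuine one.\<close>
  define p where "p = Suc n"
  have "(0::real) < 2 ^ n" by simp
  then have p: "2 * M \<le> 2 ^ p" "0 < p" using \<open>2 * M < 2 ^ n\<close> unfolding p_def power_Suc by linarith+
  have doubling: "\<phi> (2 * t) \<le> 2 ^ p * \<phi> t" if "0 \<le> t" for t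
  proof -
    have "\<phi> (2 * t) \<le> 2 * M * \<phi> t" using M(2)[of t t] that by simp
    also have "\<dots> \<le> 2 ^ p * \<phi> t" using p nonneg[OF that] by (intro mult_right_mono) auto
    finally show ?thesis .
  qed
  \<comment> \<open>Enlarging the argument of \<phi> by the factor \<open>C0 / \<beta>\<close> costs
    \<open>\<beta> ^ p\<close> in the denominator; with \<beta> a root of order \<open>2 * p\<close>
    this is a square root, and its reciprocal is integrable.\<close>
  define N where "N = 2 * p"
  define C0 where "C0 = 4 * (4 + K) * (3 + K) * real N"
  have "1 * 1 * 1 \<le> 4 * (4 + K) * (3 + K) * real N"
    using K_nonneg p by (intro mult_mono) (auto simp: N_def)
  then have C0: "1 \<le> C0" by (simp add: C0_def)
  define C where "C = (2 * C0) ^ p * (M * (\<phi> 1 + 1))"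
  have C_nonneg: "0 \<le> C" unfolding C_def using C0 M(1) nonneg[of 1] by simp
  define ratio where "ratio z = \<bar>Im z - oscillation (1 - \<bar>Re z\<bar>)\<bar> / width (1 - \<bar>Re z\<bar>)" for z
  define bound where "bound z = C / width (1 - \<bar>Re z\<bar>) * (1 / sqrt (1 - ratio z))" for z
  have main: "\<phi> (?h z) \<le> bound z" if "z \<in> domain" for z
  proof -
    define s where "s = 1 - \<bar>Re z\<bar>"
    have s: "0 < s" "s \<le> 1" using that by (auto simp: domain_def s_def)
    obtain t where t: "0 \<le> t" "s = 1 / L t" "width s = 1 / \<Phi> t" by (rule level_cases[OF s])
    define \<eta> where "\<eta> = (Im z - oscillation s) * \<Phi> t"
    define \<sigma> where "\<sigma> = (if 0 \<le> Re z then 1 else -1 :: real)"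
    have P: "0 < \<Phi> t" using \<Phi>_pos t(1) by blast
    have ratio: "ratio z = \<bar>\<eta>\<bar>" using P t by (simp add: ratio_def \<eta>_def s_def[symmetric] abs_mult)
    have "ratio z < 1" using that v_pos[OF s] by (simp add: ratio_def domain_def s_def[symmetric] divide_less_eq)
    then have \<eta>: "\<bar>\<eta>\<bar> < 1" by (simp add: ratio)
    have z: "z = Complex (\<sigma> * (1 - 1 / L t)) (sin (L t) / L t + \<eta> / \<Phi> t)"
    proof (rule complex_eqI)
      have "1 - 1 / L t = \<bar>Re z\<bar>" using t(2) by (simp add: s_def)
      then show "Re z = Re (Complex (\<sigma> * (1 - 1 / L t)) (sin (L t) / L t + \<eta> / \<Phi> t))" by (simp add: \<sigma>_def)
      have "oscillation s = sin (L t) / L t" by (simp add: oscillation_def t(2))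
      then show "Im z = Im (Complex (\<sigma> * (1 - 1 / L t)) (sin (L t) / L t + \<eta> / \<Phi> t))" using P by (simp add: \<eta>_def)
    qed
    define \<beta> where "\<beta> = root N (1 - \<bar>\<eta>\<bar>)"
    have "0 < N" using p by (simp add: N_def)
    have \<beta>: "0 < \<beta>" "\<beta> \<le> 1" "\<beta> ^ N = 1 - \<bar>\<eta>\<bar>"
      using \<eta> \<open>0 < N\<close> by (auto simp: \<beta>_def real_root_le_1_iff)
    have "\<bar>\<sigma>\<bar> = 1" by (simp add: \<sigma>_def)
    from hyperbolic_metric_bound[OF t(1) \<eta> this \<open>0 < N\<close>] have "?h z \<le> C0 * (1 + t) / \<beta>"
      unfolding C0_def \<beta>_def z[symmetric] .
    then have h: "?h z \<le> (C0 / \<beta>) * (1 + t)" by simp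
    have c1: "1 \<le> C0 / \<beta>" using C0 \<beta> by (simp add: le_divide_eq)
    have "0 \<le> ?h z" by (simp add: hyperbolic_metric_def)
    then have "\<phi> (?h z) \<le> \<phi> ((C0 / \<beta>) * (1 + t))" using h by (rule mono)
    also have "\<dots> \<le> (2 * (C0 / \<beta>)) ^ p * \<phi> (1 + t)"
      using c1 t(1) by (intro doubling_power_bound nonneg mono doubling) auto
    also have "(2 * (C0 / \<beta>)) ^ p = (2 * C0) ^ p / \<beta> ^ p" by (simp add: power_divide)
    also have "\<beta> ^ p = sqrt (1 - \<bar>\<eta>\<bar>)"
    proof (rule real_sqrt_unique[symmetric])
      show "(\<beta> ^ p)\<^sup>2 = 1 - \<bar>\<eta>\<bar>" using \<beta>(3) by (simp add: N_def power_mult[symmetric] mult.commute)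
    qed (use \<beta> in simp)
    also have "(2 * C0) ^ p / sqrt (1 - \<bar>\<eta>\<bar>) * \<phi> (1 + t) \<le> (2 * C0) ^ p / sqrt (1 - \<bar>\<eta>\<bar>) * (M * (\<phi> 1 + 1) * \<Phi> t)"
    proof (rule mult_left_mono)
      have "1 \<le> \<Phi> t" using \<Phi>_ge[OF t(1)] t(1) by (simp add: distrib_left)
      then have "\<phi> 1 * 1 \<le> \<phi> 1 * \<Phi> t" using nonneg[of 1] by (intro mult_left_mono) auto
      then have "\<phi> 1 + \<phi> t \<le> (\<phi> 1 + 1) * \<Phi> t" using le[OF t(1)] by (simp add: distrib_right)
      then have "M * (\<phi> 1 + \<phi> t) \<le> M * ((\<phi> 1 + 1) * \<Phi> t)" using M(1) by (intro mult_left_mono) auto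
      then show "\<phi> (1 + t) \<le> M * (\<phi> 1 + 1) * \<Phi> t" using M(2)[of 1 t] t(1) by (simp add: mult.assoc)
    qed (use C0 \<eta> in auto)
    also have "\<dots> = bound z"
      unfolding bound_def s_def[symmetric] t(3) ratio by (simp add: C_def)
    finally show ?thesis .
  qed
  have dom_meas [measurable]: "domain \<in> sets borel" using open_domain by simp
  have cont_ratio: "continuous_on domain ratio" and cont_bound: "continuous_on domain bound"
  proof -
    have sub: "domain \<subseteq> {z. \<bar>Re z\<bar> \<le> 1}" by (auto simp: domain_def)
    have w: "continuous_on domain (\<lambda>z. width (1 - \<bar>Re z\<bar>))"
      using continuous_v_abs sub by (rule continuous_on_subset)
    have pos: "0 < width (1 - \<bar>Re z\<bar>)" if "z \<in> domain" for z
      using that by (intro v_pos) (auto simp: domain_def)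
    show r: "continuous_on domain ratio"
      unfolding ratio_def using pos
      by (intro continuous_intros w continuous_on_compose2[OF continuous_oscillation]) force+
    have lt: "ratio z < 1" if "z \<in> domain" for z
      using pos[OF that] that by (simp add: ratio_def domain_def divide_less_eq)
    show "continuous_on domain bound"
      unfolding bound_def by (intro continuous_intros w r) (use pos lt in force)+
  qed
  \<comment> \<open>The majorant is Borel because \<open>bound\<close> is continuous on the open
    domain. Tonelli's theorem is applied to it, so measurability of the hyperbolic distance never
    has to be established.\<close>
  define g where "g z = ennreal (indicator domain z *\<^sub>R bound z)" for z
  have [measurable]: "g \<in> borel_measurable borel"
    unfolding g_def
    using borel_measurable_continuous_on_indicator[OF dom_meas cont_bound] by measurable
  define I where "I = (\<integral>\<^sup>+u. ennreal (1 / sqrt (1 - \<bar>u\<bar>)) * indicator {-1<..<1} u \<partial>lborel)"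
  \<comment> \<open>Substituting \<open>y = oscillation (1 - \<bar>x\<bar>) + w * u\<close> makes
    \<open>u\<close> the relative height; the Jacobian \<open>w\<close> cancels the
    \<open>1 / w\<close> in \<open>bound\<close>, so the estimate is uniform in
    \<open>x\<close>.\<close>
  have inner: "(\<integral>\<^sup>+y. g (Complex x y) \<partial>lborel) \<le> ennreal C * I * indicator {-1..1} x" for x
  proof (cases "\<bar>x\<bar> < 1")
    case False
    then have "g (Complex x y) = 0" for y by (simp add: g_def domain_def)
    then show ?thesis by simp
  next
    case True
    define w where "w = width (1 - \<bar>x\<bar>)"
    have w: "0 < w" unfolding w_def using True by (intro v_pos) auto
    have "(\<integral>\<^sup>+y. g (Complex x y) \<partial>lborel) = ennreal w * (\<integral>\<^sup>+u. g (Complex x (oscillation (1 - \<bar>x\<bar>) + w * u)) \<partial>lborel)"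
    proof -
      have [measurable]: "(\<lambda>y. Complex x y) \<in> borel \<rightarrow>\<^sub>M borel"
        by (intro borel_measurable_continuous_onI continuous_intros)
      show ?thesis using nn_integral_real_affine[of "\<lambda>y. g (Complex x y)" w "oscillation (1 - \<bar>x\<bar>)"] w by simp
    qed
    also have "(\<lambda>u. g (Complex x (oscillation (1 - \<bar>x\<bar>) + w * u))) =
        (\<lambda>u. ennreal (C / w) * (ennreal (1 / sqrt (1 - \<bar>u\<bar>)) * indicator {-1<..<1} u))"
    proof
      fix u :: real
      let ?z = "Complex x (oscillation (1 - \<bar>x\<bar>) + w * u)"
      have r: "ratio ?z = \<bar>u\<bar>" using w by (simp add: ratio_def w_def[symmetric] abs_mult)
      have mem: "?z \<in> domain \<longleftrightarrow> u \<in> {-1<..<1}" using True w by (auto simp: domain_def w_def[symmetric] abs_mult)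
      show "g ?z = ennreal (C / w) * (ennreal (1 / sqrt (1 - \<bar>u\<bar>)) * indicator {-1<..<1} u)"
      proof (cases "u \<in> {-1<..<1}")
        case True
        then have "\<bar>u\<bar> < 1" by auto
        then show ?thesis using True mem w C_nonneg
          by (simp add: g_def bound_def r w_def[symmetric] ennreal_mult[symmetric])
      next
        case False then show ?thesis using mem by (simp add: g_def)
      qed
    qed
    also have "ennreal w * (\<integral>\<^sup>+u. ennreal (C / w) * (ennreal (1 / sqrt (1 - \<bar>u\<bar>)) * indicator {-1<..<1} u) \<partial>lborel) = ennreal w * (ennreal (C / w) * I)"
      unfolding I_def by (subst nn_integral_cmult) auto
    also have "\<dots> = ennreal C * I"
      using w C_nonneg by (simp add: mult.assoc[symmetric] ennreal_mult[symmetric])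
    finally show ?thesis using True by (simp add: abs_less_iff less_imp_le)
  qed
  have "(\<integral>\<^sup>+z\<in>domain. ennreal (\<phi> (?h z)) \<partial>lebesgue) \<le> (\<integral>\<^sup>+z. g z \<partial>lebesgue)"
    by (intro nn_integral_mono) (auto simp: g_def indicator_def intro!: ennreal_leI main)
  also have "\<dots> = (\<integral>\<^sup>+z. g z \<partial>lborel)" by (rule nn_integral_completion) measurable
  also have "\<dots> = (\<integral>\<^sup>+x. \<integral>\<^sup>+y. g (Complex x y) \<partial>lborel \<partial>lborel)" by (rule nn_integral_complex) measurable
  also have "\<dots> \<le> (\<integral>\<^sup>+(x::real). ennreal C * I * indicator {-1..1} x \<partial>lborel)" by (intro nn_integral_mono inner)
  also have "\<dots> = ennreal C * I * 2" by (simp add: nn_integral_cmult)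
  also have "\<dots> < \<infinity>"
    using nn_integral_inverse_sqrt_finite by (simp add: I_def[symmetric] ennreal_mult_less_top)
  finally show ?thesis .
qed

end

theorem theorem1p5:
  fixes \<phi> :: "real \<Rightarrow> real" and G :: "complex set" and g\<^sub>0 :: complex
  assumes "\<And>t. t \<ge> 0 \<Longrightarrow> \<phi> t \<ge> 0"
    and "continuous_on {0..} \<phi>"
    and "strict_mono_on {0..} \<phi>"
    and "filterlim \<phi> at_top at_top"
    and "\<exists>M>0. \<forall>s\<ge>0. \<forall>t\<ge>0. \<phi> (s + t) \<le> M * (\<phi> s + \<phi> t)"
    and "(\<integral>\<^sup>+s\<in>{1..}. ennreal (1 / \<phi> s) \<partial>lebesgue) = \<infinity>"
    and "open G" and "simply_connected G" and "G \<noteq> UNIV" and "g\<^sub>0 \<in> G"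
    and "(\<integral>\<^sup>+z\<in>G. ennreal (\<phi> (hyperbolic_metric G g\<^sub>0 z)) \<partial>lebesgue) < \<infinity>"
  shows "\<exists>\<Omega> z\<^sub>0. Jordan_domain \<Omega> \<and> z\<^sub>0 \<in> \<Omega> \<and>
           (\<integral>\<^sup>+z\<in>\<Omega>. ennreal (\<phi> (hyperbolic_metric \<Omega> z\<^sub>0 z)) \<partial>lebesgue) < \<infinity> \<and>
           (\<exists>\<psi>. homeomorphic_parametrization \<Omega> \<psi> \<and>
                \<not> (\<exists>\<Psi>. homeomorphic_W11_extension \<Omega> \<psi> \<Psi>))"
proof -
  obtain M where M: "M > 0" "\<And>s t. s \<ge> 0 \<Longrightarrow> t \<ge> 0 \<Longrightarrow> \<phi> (s + t) \<le> M * (\<phi> s + \<phi> t)"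
    using assms(5) by blast
  have mono: "\<phi> s \<le> \<phi> t" if "0 \<le> s" "s \<le> t" for s t
    using assms(3) that by (cases "s = t") (auto simp: strict_mono_on_def intro: less_imp_le)
  obtain \<Phi> \<Phi>' L K where W:
    "\<And>t. 0 \<le> t \<Longrightarrow> (\<Phi> has_real_derivative \<Phi>' t) (at t)"
    "\<And>t. 0 \<le> t \<Longrightarrow> \<phi> t \<le> \<Phi> t" "\<And>t. 0 \<le> t \<Longrightarrow> 4 * (1 + t) \<le> \<Phi> t"
    "\<And>t. 0 \<le> t \<Longrightarrow> \<bar>\<Phi>' t\<bar> \<le> K * \<Phi> t / (1 + t)"
    "L 0 = 1" "\<And>t. 0 \<le> t \<Longrightarrow> (L has_real_derivative 1 / \<Phi> t) (at t)" "filterlim L at_top at_top"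
    using regular_majorant[OF assms(1-3) M assms(6)] by metis
  interpret regular_weight \<Phi> \<Phi>' L K
    using W by unfold_locales
  show ?thesis
    using Jordan_domain_domain zero_level_in_domain parametrization_without_extension
      nn_integral_hyperbolic_finite[OF assms(1) mono M W(2)] by blast
qed

end
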